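(* The map $j_0$ induces a bijection $$\bar j_0\colon PSL_2(\mathbb Z)\backslash\mathbb H'\to P\Gamma\backslash\mathcal D'_G .$$
   Context: $\omega=e^{2\pi i/3}$, $\mathcal E=\mathbb Z[\omega]\subset\mathbb C$, $\theta=\omega-\omega^2$. $\Lambda=\mathcal E^{5}$ with the hermitian form $(x,y)_\Lambda=-x_1\bar y_1+\sum_{i=2}^5x_i\bar y_i$. $\mathcal D$ is the set of one-dimensional complex subspaces of $\Lambda\otimes_{\mathcal E}\mathbb C=\mathbb C^5$ on which the form is negative definite. $\mathcal D'\subset\mathcal D$ is the set of points not orthogonal to any $v\in\Lambda$ with $(v,v)_\Lambda=1$. $\Gamma=\mathrm{Aut}(\Lambda)$ is the group of $\mathcal E$-linear automorphisms of $\Lambda$ preserving the form, and $P\Gamma=\Gamma/\mu_6$, where $\mu_6=\mathcal E^\times$ acts by scalars; $P\Gamma$ acts on $\mathcal D$ and $\mathcal D'$. $G$ is the group of order 54 given as the subgroup of $GL_3(\mathcal E)$ generated by the permutation matrices and the diagonal matrix $\mathrm{diag}(1,\omega,\omega^2)$ (the complex reflection group $G(3,3,3)$). $\mathcal D'_G$ is the set of points of $\mathcal D'$ whose stabilizer in $P\Gamma$ is isomorphic to $G$. $\mathbb H$ is the upper half-plane with the usual action of $PSL_2(\mathbb Z)$, and $\mathbb H'\subset\mathbb H$ is the complement of the $PSL_2(\mathbb Z)$-orbits of the points $i$ and $\omega$. The map $j_0\colon\mathbb H\to\mathcal D$ sends $\tau$ to the line spanned by $\tau v_1+v_2$, where $v_1=(-\theta,\omega^2,\omega^2,\omega^2,0)$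 and $v_2=(1,0,0,0,1)$. The induced map $\bar j_0$ sends the class of $\tau$ to the class of $j_0(\tau)$. *)

theory Defs
  imports "HOL-Analysis.Analysis" "HOL-Algebra.Group_Action" "HOL-Algebra.Generated_Groups"
begin

section \<open>The Eisenstein integers\<close>

definition omega :: complex where
  "omega = exp (2 * of_real pi * \<i> / 3)"

text \<open>The ring generated by \<^term>\<open>omega\<close>; since \<open>omega\<^sup>2 = - 1 - omega\<close>, it is spanned
  over the integers by \<open>1\<close> and \<^term>\<open>omega\<close>.\<close>

definition eisenstein :: "complex set" where
  "eisenstein = {of_int a + of_int b * omega | a b. True}"

definition eisenstein_units :: "complex set" where
  "eisenstein_units = {u \<in> eisenstein. \<exists>v \<in> eisenstein. u * v = 1}"

definition theta :: complex where
  "theta = omega - omega ^ 2"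


section \<open>The Lorentzian lattice and its complex hyperbolic space\<close>

text \<open>In the index type \<^typ>\<open>5\<close> the numeral \<open>5\<close> is equal to \<open>0\<close>, so the five coordinates
  of a vector are those at \<open>1, \<dots>, 5\<close>.\<close>

definition herm :: "complex ^ 5 \<Rightarrow> complex ^ 5 \<Rightarrow> complex" where
  "herm x y = - (x $ 1) * cnj (y $ 1) + (\<Sum>i\<in>{2, 3, 4, 5}. x $ i * cnj (y $ i))"

definition Lattice :: "(complex ^ 5) set" where
  "Lattice = {x. \<forall>i. x $ i \<in> eisenstein}"

definition ch4 :: "(complex ^ 5) set set" where
  "ch4 = {L. vec.subspace L \<and> vec.dim L = 1 \<and> (\<forall>x\<in>L. x \<noteq> 0 \<longrightarrow> Re (herm x x) < 0)}"

definition ch4' :: "(complex ^ 5) set set" where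
  "ch4' = {L \<in> ch4. \<not> (\<exists>v \<in> Lattice. herm v v = 1 \<and> (\<forall>x\<in>L. herm x v = 0))}"


section \<open>The isometry group of the lattice and its action\<close>

definition Lattice_Aut :: "(complex ^ 5 \<Rightarrow> complex ^ 5) monoid" where
  "Lattice_Aut = BijGroup Lattice
     \<lparr>carrier := {g \<in> Bij Lattice.
        (\<forall>x\<in>Lattice. \<forall>y\<in>Lattice. g (x + y) = g x + g y) \<and>
        (\<forall>a\<in>eisenstein. \<forall>x\<in>Lattice. g (a *s x) = a *s g x) \<and>
        (\<forall>x\<in>Lattice. \<forall>y\<in>Lattice. herm (g x) (g y) = herm x y)}\<rparr>"

definition unit_scalars :: "(complex ^ 5 \<Rightarrow> complex ^ 5) set" where
  "unit_scalars = {\<lambda>x\<in>Lattice. u *s x | u. u \<in> eisenstein_units}"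

definition PGamma :: "(complex ^ 5 \<Rightarrow> complex ^ 5) set monoid" where
  "PGamma = Lattice_Aut Mod unit_scalars"

text \<open>The complex-linear extension of a lattice automorphism, determined by its values on
  the standard basis.\<close>

definition lin_ext :: "(complex ^ 5 \<Rightarrow> complex ^ 5) \<Rightarrow> complex ^ 5 \<Rightarrow> complex ^ 5" where
  "lin_ext g x = (\<Sum>i\<in>UNIV. x $ i *s g (axis i 1))"

text \<open>An element of \<^term>\<open>PGamma\<close> is a coset, all of whose members have the same effect on lines;
  \<^const>\<open>the_elem\<close> extracts the common image.\<close>

definition PGamma_act ::
    "(complex ^ 5 \<Rightarrow> complex ^ 5) set \<Rightarrow> (complex ^ 5) set \<Rightarrow> (complex ^ 5) set" where
  "PGamma_act C = (\<lambda>L\<in>ch4. the_elem ((\<lambda>g. lin_ext g ` L) ` C))"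

definition PGamma_stab :: "(complex ^ 5) set \<Rightarrow> (complex ^ 5 \<Rightarrow> complex ^ 5) set monoid" where
  "PGamma_stab L = PGamma \<lparr>carrier := stabilizer PGamma PGamma_act L\<rparr>"


section \<open>The complex reflection group $G(3,3,3)$\<close>

definition GL3_eisenstein :: "(complex ^ 3 ^ 3) monoid" where
  "GL3_eisenstein =
     \<lparr>carrier = {A. (\<forall>i j. A $ i $ j \<in> eisenstein) \<and>
        (\<exists>B. (\<forall>i j. B $ i $ j \<in> eisenstein) \<and> A ** B = mat 1 \<and> B ** A = mat 1)},
      mult = (**), one = mat 1\<rparr>"

definition perm_matrix :: "(3 \<Rightarrow> 3) \<Rightarrow> complex ^ 3 ^ 3" where
  "perm_matrix p = (\<chi> i j. if i = p j then 1 else 0)"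

definition diag_omega :: "complex ^ 3 ^ 3" where
  "diag_omega = vector [vector [1, 0, 0], vector [0, omega, 0], vector [0, 0, omega ^ 2]]"

definition G333 :: "(complex ^ 3 ^ 3) monoid" where
  "G333 = GL3_eisenstein
     \<lparr>carrier := generate GL3_eisenstein (insert diag_omega {perm_matrix p | p. bij p})\<rparr>"

definition ch4'_G :: "(complex ^ 5) set set" where
  "ch4'_G = {L \<in> ch4'. PGamma_stab L \<cong> G333}"


section \<open>The modular group acting on the upper half-plane\<close>

definition SL2Z :: "(int ^ 2 ^ 2) monoid" where
  "SL2Z = \<lparr>carrier = {A. det A = 1}, mult = (**), one = mat 1\<rparr>"

definition PSL2Z :: "(int ^ 2 ^ 2) set monoid" where
  "PSL2Z = SL2Z Mod {mat 1, - mat 1}"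

definition upper_half_plane :: "complex set" where
  "upper_half_plane = {\<tau>. Im \<tau> > 0}"

definition moebius_int :: "int ^ 2 ^ 2 \<Rightarrow> complex \<Rightarrow> complex" where
  "moebius_int A \<tau> =
     (of_int (A $ 1 $ 1) * \<tau> + of_int (A $ 1 $ 2)) / (of_int (A $ 2 $ 1) * \<tau> + of_int (A $ 2 $ 2))"

definition PSL2Z_act :: "(int ^ 2 ^ 2) set \<Rightarrow> complex \<Rightarrow> complex" where
  "PSL2Z_act C = (\<lambda>\<tau>\<in>upper_half_plane. the_elem ((\<lambda>A. moebius_int A \<tau>) ` C))"

definition upper_half_plane' :: "complex set" where
  "upper_half_plane' =
     upper_half_plane - (orbit PSL2Z PSL2Z_act \<i> \<union> orbit PSL2Z PSL2Z_act omega)"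


section \<open>The map from the upper half-plane to complex hyperbolic space\<close>

definition v1 :: "complex ^ 5" where
  "v1 = vector [- theta, omega ^ 2, omega ^ 2, omega ^ 2, 0]"

definition v2 :: "complex ^ 5" where
  "v2 = vector [1, 0, 0, 0, 1]"

definition j0 :: "complex \<Rightarrow> (complex ^ 5) set" where
  "j0 \<tau> = vec.span {\<tau> *s v1 + v2}"

text \<open>The map on classes; it is meaningful when all members of the class \<open>X\<close> have images in one
  orbit of \<^term>\<open>PGamma\<close>.\<close>

definition j0_bar :: "complex set \<Rightarrow> (complex ^ 5) set set" where
  "j0_bar X = the_elem ((\<lambda>\<tau>. orbit PGamma PGamma_act (j0 \<tau>)) ` X)"

end

theory Submission
  imports Defs
begin

text \<open>The lattice vectors orthogonal to \<open>v1\<close> and \<open>v2\<close> form the root lattice \<open>W\<close> of \<open>G(3,3,3)\<close>, and the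
  automorphisms of the lattice that fix \<open>v1\<close> and \<open>v2\<close> are exactly the elements of \<open>G(3,3,3)\<close>.

  If \<open>\<tau>\<close> is not in the orbit of \<open>\<omega>\<close>, every norm 2 lattice vector orthogonal to \<open>j\<^sub>0(\<tau>)\<close> lies in \<open>W\<close>. So an
  automorphism taking \<open>j\<^sub>0(\<tau>)\<close> to \<open>j\<^sub>0(\<tau>')\<close> preserves the plane of \<open>v1\<close> and \<open>v2\<close>, where it acts as a unit times an
  element of \<open>SL\<^sub>2(\<int>)\<close>. This gives injectivity and the stabilizers; conversely \<open>SL\<^sub>2(\<int>)\<close> lifts to the lattice.

  For surjectivity, a group isomorphic to \<open>G(3,3,3)\<close> stabilizing a line \<open>L\<close> contains a Heisenberg group of order 27
  generated by products of involutions, which therefore lifts to automorphisms fixing \<open>L\<close> pointwise. An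
  eigenvector argument yields three orthogonal lattice vectors of norm 3, permuted cyclically; since the lattice is
  unimodular and has no norm 1 vector orthogonal to \<open>L\<close>, they span with their glue a copy of \<open>W\<close>. By Witt
  cancellation over \<open>\<rat>(\<omega>)\<close> its complement contains a null vector, and a lattice basis adapted to it moves this
  copy of \<open>W\<close> to the standard one, hence \<open>L\<close> to some \<open>j\<^sub>0(\<tau>)\<close>. Points equivalent to \<open>i\<close> or \<open>\<omega>\<close> are excluded because
  their stabilizers have more than 54 elements.\<close>

section \<open>Eisenstein integers\<close>

text \<open>The form of a v1 + b v2 with c v1 + d v2 is \<open>theta\<close> times a cnj d - b cnj
  c, for integer coefficients \<open>theta\<close> times a determinant; hence SL_2(\<int>) acts on
  the plane by isometries. The plane and \<open>W\<close> are glued along a group of order 9, so an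
  isometry of one extends to the lattice only together with a matching action on the other. The
  obstacle in the converse direction is that the stabilizer is known only up to abstract isomorphism
  and modulo scalars. Involutions can be lifted: the rank 5 is odd and -1 is not a square among the
  Eisenstein integers, so a lift squares to 1 after rescaling by a unit, and a sign makes it fix the
  line pointwise. Lifts of the latter kind are unique, so all relations lift with them. Signature
  (4,1) does the rest: the complement of a negative line is positive of dimension 4, with room for
  only one three-dimensional representation of the Heisenberg group with nontrivial centre. Modulo
  \<open>theta\<close> the possible glue of the three norm 3 vectors is a cyclic ternary code of
  length 3, small enough to enumerate.\<close>

lemma omega_Complex: "omega = Complex (-1/2) (sqrt 3 / 2)"
proof -
  have "omega = cis (2 * pi / 3)"
    unfolding omega_def cis_conv_exp by (simp add: field_simps)
  thus ?thesis
    using cos_120 sin_120 by (simp add: complex_eq_iff)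
qed

lemma Re_omega [simp]: "Re omega = -1/2" and Im_omega [simp]: "Im omega = sqrt 3 / 2"
  by (simp_all add: omega_Complex)

lemma omega_mult: "omega * omega = -1 - omega"
  by (simp add: complex_eq_iff field_simps)

lemma omega_mult': "omega * (omega * x) = - x - omega * x"
  by (simp add: mult.assoc[symmetric] omega_mult algebra_simps)

lemma omega_sq: "omega\<^sup>2 = -1 - omega"
  by (simp add: power2_eq_square omega_mult)

lemma cnj_omega [simp]: "cnj omega = -1 - omega"
  by (simp add: complex_eq_iff)

lemma omega_cube [simp]: "omega ^ 3 = 1"
  by (simp add: power3_eq_cube omega_mult algebra_simps)

text \<open>Rewriting with these brings polynomials in \<open>omega\<close> to degree at most one;
  \<open>omega_mult'\<close> reaches squares inside right-nested products.\<close>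

lemmas omega_simps = algebra_simps omega_mult omega_mult'

lemma theta_eq: "theta = 1 + 2 * omega"
  by (simp add: theta_def omega_sq)

lemma theta_sq: "theta * theta = -3"
  by (simp add: complex_eq_iff theta_eq)

lemma theta_sq': "theta * (theta * x) = -3 * x"
  by (simp add: mult.assoc[symmetric] theta_sq)

lemma theta_nz [simp]: "theta \<noteq> 0"
  using theta_sq by auto

lemma cnj_theta [simp]: "cnj theta = - theta"
  by (simp add: theta_eq)

lemma div_theta: "x / theta = - (x * theta) / 3"
  by (simp add: divide_simps mult.assoc theta_sq)

lemma omega_nz [simp]: "omega \<noteq> 0"
  using omega_cube by force

lemma omega_ne_1 [simp]: "omega \<noteq> 1"
  by (simp add: complex_eq_iff)

lemma eisensteinI: "x = of_int a + of_int b * omega \<Longrightarrow> x \<in> eisenstein"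
  by (auto simp: eisenstein_def)

lemma eisensteinE:
  assumes "x \<in> eisenstein" obtains a b where "x = of_int a + of_int b * omega"
  using assms by (auto simp: eisenstein_def)

lemma eis_of_int [simp, intro]: "of_int a \<in> eisenstein"
  by (rule eisensteinI[of _ a 0]) simp

lemma eis_0 [simp, intro]: "0 \<in> eisenstein" using eis_of_int[of 0] by simp
lemma eis_1 [simp, intro]: "1 \<in> eisenstein" using eis_of_int[of 1] by simp
lemma eis_numeral [simp, intro]: "numeral n \<in> eisenstein"
  using eis_of_int[of "numeral n"] by simp

lemma eis_omega [simp, intro]: "omega \<in> eisenstein"
  by (rule eisensteinI[of _ 0 1]) simp

lemma eis_add [intro]: "x \<in> eisenstein \<Longrightarrow> y \<in> eisenstein \<Longrightarrow> x + y \<in> eisenstein"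
proof (elim eisensteinE)
  fix a b c d assume "x = of_int a + of_int b * omega" "y = of_int c + of_int d * omega"
  thus ?thesis by (intro eisensteinI[of _ "a+c" "b+d"]) (simp add: algebra_simps)
qed

lemma eis_mult [intro]: "x \<in> eisenstein \<Longrightarrow> y \<in> eisenstein \<Longrightarrow> x * y \<in> eisenstein"
proof (elim eisensteinE)
  fix a b c d assume "x = of_int a + of_int b * omega" "y = of_int c + of_int d * omega"
  thus ?thesis by (intro eisensteinI[of _ "a*c-b*d" "a*d+b*c-b*d"])
      (simp add: omega_simps)
qed

lemma eis_minus [simp]: "- x \<in> eisenstein \<longleftrightarrow> x \<in> eisenstein"
proof -
  have "- x \<in> eisenstein" if "x \<in> eisenstein" for x
    using eis_mult[OF eis_of_int[of "-1"] that] by simp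
  from this this[of "-x"] show ?thesis by auto
qed

lemma eis_diff [intro]: "x \<in> eisenstein \<Longrightarrow> y \<in> eisenstein \<Longrightarrow> x - y \<in> eisenstein"
  using eis_add[of x "-y"] by simp

lemma eis_power [intro]: "x \<in> eisenstein \<Longrightarrow> x ^ n \<in> eisenstein"
  by (induction n) auto

lemma eis_sum [intro]: "(\<And>i. i \<in> I \<Longrightarrow> f i \<in> eisenstein) \<Longrightarrow> sum f I \<in> eisenstein"
  by (induction I rule: infinite_finite_induct) auto

lemma eis_prod [intro]: "(\<And>i. i \<in> I \<Longrightarrow> f i \<in> eisenstein) \<Longrightarrow> prod f I \<in> eisenstein"
  by (induction I rule: infinite_finite_induct) auto

lemma eis_theta [simp, intro]: "theta \<in> eisenstein"
  unfolding theta_eq by auto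

lemma eis_cnj [simp]: "cnj x \<in> eisenstein \<longleftrightarrow> x \<in> eisenstein"
proof -
  have "cnj x \<in> eisenstein" if "x \<in> eisenstein" for x
    using that by (elim eisensteinE) (auto intro!: eis_add eis_mult eis_diff)
  from this this[of "cnj x"] show ?thesis by auto
qed

lemma eis_norm:
  assumes "x = of_int a + of_int b * omega"
  shows "x * cnj x = of_int (a*a - a*b + b*b)"
  unfolding assms by (simp add: omega_simps)

lemma eis_cmod_sq_int:
  assumes "x \<in> eisenstein" obtains n :: nat where "(cmod x)\<^sup>2 = real n"
proof -
  from assms obtain a b where x: "x = of_int a + of_int b * omega" by (elim eisensteinE)
  have "complex_of_real ((cmod x)\<^sup>2) = of_real (real_of_int (a*a - a*b + b*b))"
    using eis_norm[OF x] complex_norm_square[of x] by simp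
  hence e: "(cmod x)\<^sup>2 = real_of_int (a*a - a*b + b*b)" by (simp only: of_real_eq_iff)
  hence "0 \<le> a*a - a*b + b*b" by (metis zero_le_power2 of_int_0_le_iff)
  hence "real_of_int (a*a - a*b + b*b) = real (nat (a*a - a*b + b*b))" by (simp only: of_nat_nat)
  with e that show ?thesis by metis
qed

lemma eis_cmod_lt_1: "x \<in> eisenstein \<Longrightarrow> cmod x < 1 \<Longrightarrow> x = 0"
proof (rule ccontr)
  assume x: "x \<in> eisenstein" "cmod x < 1" "x \<noteq> 0"
  from x(1) obtain n where n: "(cmod x)\<^sup>2 = real n" by (rule eis_cmod_sq_int)
  have "(cmod x)\<^sup>2 < 1" "0 < (cmod x)\<^sup>2" using x by (auto simp: power_less_one_iff)
  thus False using n by simp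
qed

lemma eis_real:
  assumes "x \<in> eisenstein" "Im x = 0" obtains n where "x = of_int n"
  using assms by (elim eisensteinE) (auto)

lemma eis_imaginary:
  assumes "x \<in> eisenstein" "Re x = 0" obtains n where "x = of_int n * theta"
proof -
  from assms obtain a b where x: "x = of_int a + of_int b * omega" by (elim eisensteinE)
  with assms have "real_of_int (2 * a) = real_of_int b" by simp
  hence "b = 2 * a" by (simp only: of_int_eq_iff)
  thus thesis by (intro that[of a]) (simp add: x theta_eq algebra_simps)
qed

text \<open>Rounding the quotient to the hexagonal lattice, first in the imaginary and then in the
  real direction, leaves an error of squared modulus at most 1/4 + 3/16.\<close>

lemma eis_euclid:
  assumes "d \<noteq> 0"
  obtains q where "q \<in> eisenstein" "cmod (x - q * d) < cmod d"
proof -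
  define z where "z = x / d"
  define b where "b = round (Im z / (sqrt 3 / 2))"
  define a where "a = round (Re z + b / 2)"
  define q where "q = of_int a + of_int b * omega"
  have 1: "\<bar>Re (z - q)\<bar> \<le> 1/2"
    using of_int_round_abs_le[of "Re z + b / 2"] unfolding q_def a_def
    by (simp add: abs_minus_commute algebra_simps)
  have "\<bar>of_int b - Im z / (sqrt 3 / 2)\<bar> \<le> 1/2"
    using of_int_round_abs_le[of "Im z / (sqrt 3 / 2)"] unfolding b_def by simp
  moreover have "Im (z - q) = (Im z / (sqrt 3 / 2) - of_int b) * (sqrt 3 / 2)"
    unfolding q_def by (simp add: field_simps)
  ultimately have 2: "\<bar>Im (z - q)\<bar> \<le> 1/2 * (sqrt 3 / 2)"
    by (simp only: abs_mult abs_minus_commute) (simp add: mult_right_mono)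
  have "(cmod (z - q))\<^sup>2 = \<bar>Re (z-q)\<bar>\<^sup>2 + \<bar>Im (z-q)\<bar>\<^sup>2" by (simp add: cmod_power2)
  also have "\<dots> \<le> (1/2)\<^sup>2 + (1/2 * (sqrt 3 / 2))\<^sup>2"
    by (intro add_mono power_mono 1 2) auto
  also have "\<dots> < 1\<^sup>2" by (simp add: power_mult_distrib power_divide)
  finally have "cmod (z - q) < 1" by (rule power_less_imp_less_base) auto
  moreover have "x - q * d = (z - q) * d" using assms by (simp add: z_def field_simps)
  ultimately have "cmod (x - q * d) < cmod d" using assms by (simp add: norm_mult)
  moreover have "q \<in> eisenstein" by (auto simp: q_def)
  ultimately show ?thesis using that by blast
qed

lemma eis_cmod_1:
  assumes "x \<in> eisenstein" "cmod x = 1"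
  shows "x \<in> {1, -1, omega, -omega, omega\<^sup>2, -(omega\<^sup>2)}"
proof -
  from assms obtain a b where x: "x = of_int a + of_int b * omega" by (elim eisensteinE)
  have "(of_int (a*a - a*b + b*b) :: complex) = of_int 1"
    using eis_norm[OF x] complex_norm_square[of x] assms by simp
  hence e: "a*a - a*b + b*b = 1" by (simp only: of_int_eq_iff)
  \<comment> \<open>Four times the norm form, completed to a square in either variable, leaves only
    the coordinates -1, 0 and 1.\<close>
  have "(2*a-b)*(2*a-b) + 3*(b*b) = 4" "(2*b-a)*(2*b-a) + 3*(a*a) = 4"
    using e by (auto simp: algebra_simps)
  moreover have "0 \<le> (2*a-b)*(2*a-b)" "0 \<le> (2*b-a)*(2*b-a)" by (rule zero_le_square)+
  ultimately have "b*b < 2*2" "a*a < 2*2" by linarith+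
  hence "\<bar>b\<bar> < 2" "\<bar>a\<bar> < 2"
    using power2_less_imp_less[of "\<bar>a\<bar>" 2]
      power2_less_imp_less[of "\<bar>b\<bar>" 2] by (auto simp: power2_eq_square)
  hence "b \<in> {-1,0,1}" "a \<in> {-1,0,1}" by auto
  with e show ?thesis by (auto simp: x omega_sq)
qed

lemma eisenstein_units_iff: "u \<in> eisenstein_units \<longleftrightarrow> u \<in> eisenstein \<and> cmod u = 1"
proof
  assume "u \<in> eisenstein_units"
  then obtain v where v: "u \<in> eisenstein" "v \<in> eisenstein" "u * v = 1"
    by (auto simp: eisenstein_units_def)
  hence p: "cmod u * cmod v = 1" by (metis norm_mult norm_one)
  have "\<not> cmod u < 1" "\<not> cmod v < 1" using v eis_cmod_lt_1 by force+
  hence "cmod u = 1" using p mult_left_mono[of 1 "cmod v" "cmod u"] by simp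
  with v show "u \<in> eisenstein \<and> cmod u = 1" by simp
next
  assume "u \<in> eisenstein \<and> cmod u = 1"
  moreover from this have "u * cnj u = 1" using complex_norm_square[of u] by simp
  ultimately show "u \<in> eisenstein_units" using eis_cnj unfolding eisenstein_units_def by blast
qed

lemma unit_cnj: "cmod u = 1 \<Longrightarrow> u * cnj u = 1"
  using complex_norm_square[of u] by simp

lemma cmod_omega [simp]: "cmod omega = 1"
proof -
  have "(cmod omega)\<^sup>2 = 1" by (simp add: cmod_power2 power_divide)
  thus ?thesis using norm_ge_zero[of omega] by (metis abs_norm_cancel power2_eq_1_iff abs_1 norm_minus_cancel norm_one abs_minus_cancel)
qed

lemma eis_mod_theta:
  assumes "x \<in> eisenstein"
  obtains k y where "k \<in> {0, 1, -1}" "y \<in> eisenstein" "x = k + theta * y"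
proof -
  from assms obtain a b where x: "x = of_int a + of_int b * omega" by (elim eisensteinE)
  \<comment> \<open>Modulo \<open>theta\<close> the element \<open>omega\<close> is 1, so the
    residue is that of a + b modulo 3; adding 1 before dividing centres it at 0.\<close>
  define m where "m = (a + b + 1) div 3"
  define r where "r = (a + b + 1) mod 3"
  have ab: "a = 3 * m + r - 1 - b" unfolding m_def r_def using div_mult_mod_eq[of "a+b+1" 3] by linarith
  have "r \<in> {0,1,2}" unfolding r_def by (auto)
  hence k: "of_int (r - 1) \<in> {0,1,-1::complex}" by auto
  have "x = of_int (r - 1) + theta * (- theta * of_int m - omega\<^sup>2 * of_int b)"
    unfolding x ab by (simp add: theta_eq omega_sq omega_simps)
  moreover have "- theta * of_int m - omega\<^sup>2 * of_int b \<in> eisenstein"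
    by (intro eis_diff eis_mult eis_power) auto
  ultimately show thesis using that k by blast
qed

section \<open>Hermitian space and lattice isometries\<close>

lemma exhaust_5: fixes x :: 5 shows "x = 1 \<or> x = 2 \<or> x = 3 \<or> x = 4 \<or> x = 5"
proof (induct x)
  case (of_int z)
  hence "z = 0 \<or> z = 1 \<or> z = 2 \<or> z = 3 \<or> z = 4" by auto
  thus ?case by auto
qed

lemma forall_5: "(\<forall>i::5. P i) \<longleftrightarrow> P 1 \<and> P 2 \<and> P 3 \<and> P 4 \<and> P 5"
  by (metis exhaust_5)

lemma UNIV_5: "(UNIV :: 5 set) = {1, 2, 3, 4, 5}"
  using exhaust_5 by auto

lemma sum_5: "sum f (UNIV :: 5 set) = f 1 + f 2 + f 3 + f 4 + f 5"
  unfolding UNIV_5 by (simp add: ac_simps)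

lemma vector_5 [simp]:
  "(vector [a, b, c, d, e] :: 'a::zero ^ 5) $ 1 = a"
  "(vector [a, b, c, d, e] :: 'a ^ 5) $ 2 = b"
  "(vector [a, b, c, d, e] :: 'a ^ 5) $ 3 = c"
  "(vector [a, b, c, d, e] :: 'a ^ 5) $ 4 = d"
  "(vector [a, b, c, d, e] :: 'a ^ 5) $ 5 = e"
  by (simp_all add: vector_def)

lemma herm_eq: "herm x y = - x$1 * cnj (y$1) + x$2 * cnj (y$2) + x$3 * cnj (y$3)
    + x$4 * cnj (y$4) + x$5 * cnj (y$5)"
  by (simp add: herm_def)

lemma herm_add_left: "herm (x + y) z = herm x z + herm y z"
  and herm_add_right: "herm z (x + y) = herm z x + herm z y"
  and herm_diff_left: "herm (x - y) z = herm x z - herm y z"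
  and herm_diff_right: "herm z (x - y) = herm z x - herm z y"
  and herm_minus_left: "herm (- x) z = - herm x z"
  and herm_minus_right: "herm z (- x) = - herm z x"
  and herm_scale_left: "herm (c *s x) z = c * herm x z"
  and herm_scale_right: "herm z (c *s x) = cnj c * herm z x"
  by (simp_all add: herm_eq algebra_simps)

lemma herm_zero [simp]: "herm 0 z = 0" "herm z 0 = 0"
  by (simp_all add: herm_eq)

lemmas herm_lin = herm_add_left herm_add_right herm_diff_left herm_diff_right
  herm_minus_left herm_minus_right herm_scale_left herm_scale_right

lemma herm_cnj: "cnj (herm x y) = herm y x"
  by (simp add: herm_eq algebra_simps)

lemma herm_self_real: "Im (herm x x) = 0"
  using herm_cnj[of x x] by (simp add: complex_eq_iff)

lemma herm_eq_0_sym: "herm x y = 0 \<longleftrightarrow> herm y x = 0"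
  by (metis herm_cnj complex_cnj_zero)

lemma herm_sum_left: "herm (sum f I) z = (\<Sum>i\<in>I. herm (f i) z)"
  by (induction I rule: infinite_finite_induct) (simp_all add: herm_lin)

lemma herm_sum_right: "herm z (sum f I) = (\<Sum>i\<in>I. herm z (f i))"
  by (induction I rule: infinite_finite_induct) (simp_all add: herm_lin)

lemma herm_axis:
  "herm x (axis 1 1) = - x$1" "herm x (axis 2 1) = x$2" "herm x (axis 3 1) = x$3"
  "herm x (axis 4 1) = x$4" "herm x (axis 5 1) = x$5"
  by (simp_all add: herm_eq axis_def)

lemma herm_nondegenerate: "(\<And>y. herm x y = 0) \<Longrightarrow> x = 0"
  using herm_axis[of x] by (simp add: vec_eq_iff forall_5)

lemma LatticeI: "(\<And>i. x $ i \<in> eisenstein) \<Longrightarrow> x \<in> Lattice"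
  by (simp add: Lattice_def)

lemma LatticeD: "x \<in> Lattice \<Longrightarrow> x $ i \<in> eisenstein"
  by (simp add: Lattice_def)

lemma Lattice_iff5: "x \<in> Lattice \<longleftrightarrow> x$1 \<in> eisenstein \<and> x$2 \<in> eisenstein \<and> x$3 \<in> eisenstein
    \<and> x$4 \<in> eisenstein \<and> x$5 \<in> eisenstein"
  unfolding Lattice_def by (simp add: forall_5)

lemma Lattice_0 [simp, intro]: "0 \<in> Lattice"
  and Lattice_add [intro]: "x \<in> Lattice \<Longrightarrow> y \<in> Lattice \<Longrightarrow> x + y \<in> Lattice"
  and Lattice_diff [intro]: "x \<in> Lattice \<Longrightarrow> y \<in> Lattice \<Longrightarrow> x - y \<in> Lattice"
  and Lattice_uminus [intro]: "x \<in> Lattice \<Longrightarrow> - x \<in> Lattice"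
  and Lattice_scale [intro]: "c \<in> eisenstein \<Longrightarrow> x \<in> Lattice \<Longrightarrow> c *s x \<in> Lattice"
  by (auto simp: Lattice_def)

lemma Lattice_axis [simp, intro]: "axis i 1 \<in> Lattice"
  by (auto simp: Lattice_def axis_def)

lemma Lattice_sum [intro]: "(\<And>i. i \<in> I \<Longrightarrow> f i \<in> Lattice) \<Longrightarrow> sum f I \<in> Lattice"
  by (induction I rule: infinite_finite_induct) auto

lemma herm_Lattice [intro]: "x \<in> Lattice \<Longrightarrow> y \<in> Lattice \<Longrightarrow> herm x y \<in> eisenstein"
  unfolding herm_eq by (intro eis_add eis_mult) (auto simp: Lattice_def)

text \<open>Self-duality: pairing with the standard basis reads off the coordinates up to sign.
  Vectors obtained by division are shown to be integral in this way.\<close>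

lemma Lattice_unimodular:
  assumes "\<And>y. y \<in> Lattice \<Longrightarrow> herm x y \<in> eisenstein"
  shows "x \<in> Lattice"
  unfolding Lattice_iff5
  using assms[OF Lattice_axis, of 1] assms[OF Lattice_axis, of 2] assms[OF Lattice_axis, of 3]
    assms[OF Lattice_axis, of 4] assms[OF Lattice_axis, of 5]
  by (simp add: herm_axis)

lemma Lattice_unimodular':
  assumes "\<And>y. y \<in> Lattice \<Longrightarrow> herm y x \<in> eisenstein"
  shows "x \<in> Lattice"
  by (rule Lattice_unimodular) (metis assms eis_cnj herm_cnj)

text \<open>The pairings of \<open>x\<close> with the lattice form an ideal of a Euclidean ring. A
  nonzero value \<open>d\<close> of least norm generates it, and self-duality allows
  \<open>x\<close> to be divided by \<open>cnj d\<close>.\<close>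

lemma Lattice_primitive:
  assumes "x \<in> Lattice" "x \<noteq> 0"
  obtains c x' y where "c \<noteq> 0" "x' \<in> Lattice" "x = c *s x'" "y \<in> Lattice" "herm y x' = 1"
proof -
  define P where "P = (\<lambda>n::nat. \<exists>y\<in>Lattice. herm y x \<noteq> 0 \<and> (cmod (herm y x))\<^sup>2 = real n)"
  have "\<exists>n. P n"
  proof -
    obtain i where "x $ i \<noteq> 0" using assms by (auto simp: vec_eq_iff)
    hence "\<exists>y\<in>Lattice. herm x y \<noteq> 0"
      using herm_axis[of x] exhaust_5[of i] by (metis Lattice_axis neg_equal_0_iff_equal)
    then obtain y where y: "y \<in> Lattice" "herm y x \<noteq> 0" using herm_eq_0_sym by metis
    obtain n where "(cmod (herm y x))\<^sup>2 = real n"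
      using eis_cmod_sq_int herm_Lattice[OF y(1) assms(1)] by metis
    with y show ?thesis by (auto simp: P_def)
  qed
  then obtain n where n: "P n" "\<And>m. m < n \<Longrightarrow> \<not> P m" by (meson exists_least_iff)
  then obtain y where y: "y \<in> Lattice" "herm y x \<noteq> 0" "(cmod (herm y x))\<^sup>2 = real n"
    by (auto simp: P_def)
  define d where "d = herm y x"
  have dz: "d \<noteq> 0" using y by (simp add: d_def)
  have div: "herm z x / d \<in> eisenstein" if z: "z \<in> Lattice" for z
  proof -
    obtain q where q: "q \<in> eisenstein" "cmod (herm z x - q * d) < cmod d"
      using eis_euclid[OF dz] by metis
    have zq: "z - q *s y \<in> Lattice" using z q y by auto
    have h: "herm (z - q *s y) x = herm z x - q * d" by (simp add: herm_lin d_def)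
    have "herm (z - q *s y) x = 0"
    proof (rule ccontr)
      assume nz: "herm (z - q *s y) x \<noteq> 0"
      obtain m where m: "(cmod (herm (z - q *s y) x))\<^sup>2 = real m"
        using eis_cmod_sq_int herm_Lattice[OF zq assms(1)] by metis
      hence "P m" using zq nz by (auto simp: P_def)
      moreover have "real m < real n"
        using q(2) m y(3) h by (metis d_def norm_ge_zero power_strict_mono zero_less_numeral)
      ultimately show False using n(2) by simp
    qed
    hence "herm z x = q * d" using h by simp
    thus ?thesis using q dz by simp
  qed
  define x' where "x' = inverse (cnj d) *s x"
  have "x' \<in> Lattice"
    by (rule Lattice_unimodular') (use div in \<open>simp add: x'_def herm_lin divide_inverse mult.commute\<close>)
  moreover have "x = cnj d *s x'" using dz by (simp add: x'_def vec_eq_iff)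
  moreover have "herm y x' = 1" using dz by (simp add: x'_def herm_lin d_def)
  ultimately show ?thesis using that[of "cnj d" x' y] dz y(1) by simp
qed

section \<open>Automorphisms of the lattice as integral isometry matrices\<close>

definition Lattice_mats :: "(complex ^ 5 ^ 5) set" where
  "Lattice_mats = {A. (\<forall>i j. A $ i $ j \<in> eisenstein) \<and> (\<forall>x y. herm (A *v x) (A *v y) = herm x y)}"

lemma mats_herm: "A \<in> Lattice_mats \<Longrightarrow> herm (A *v x) (A *v y) = herm x y"
  by (simp add: Lattice_mats_def)

lemma mats_Lattice: "A \<in> Lattice_mats \<Longrightarrow> x \<in> Lattice \<Longrightarrow> A *v x \<in> Lattice"
  by (auto simp: Lattice_mats_def Lattice_def matrix_vector_mult_def intro!: eis_sum eis_mult)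

lemma mat_mult_vec [simp]: "mat c *v x = c *s (x :: 'a::comm_ring_1 ^ 'n)"
proof -
  have "(\<Sum>j\<in>UNIV. (if i = j then c else 0) * x $ j) = (\<Sum>j\<in>UNIV. if i = j then c * x $ j else 0)" for i
    by (intro sum.cong) auto
  thus ?thesis by (simp add: matrix_vector_mult_def mat_def vec_eq_iff)
qed

lemma mats_matI:
  assumes "\<And>x. x \<in> Lattice \<Longrightarrow> A *v x \<in> Lattice" "\<And>x y. herm (A *v x) (A *v y) = herm x y"
  shows "A \<in> Lattice_mats"
proof -
  have "A $ i $ j \<in> eisenstein" for i j
    using LatticeD[OF assms(1)[OF Lattice_axis[of j]], of i]
    by (simp add: matrix_vector_mult_def axis_def if_distrib cong: if_cong)
  thus ?thesis using assms(2) by (simp add: Lattice_mats_def)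
qed

lemma mats_mult: "A \<in> Lattice_mats \<Longrightarrow> B \<in> Lattice_mats \<Longrightarrow> A ** B \<in> Lattice_mats"
  by (rule mats_matI) (auto simp: matrix_vector_mul_assoc[symmetric] mats_Lattice mats_herm)

lemma mats_mat: "u \<in> eisenstein \<Longrightarrow> cmod u = 1 \<Longrightarrow> mat u \<in> Lattice_mats"
  by (rule mats_matI) (auto simp: herm_lin unit_cnj mult.assoc[symmetric] mult.commute[of "cnj u"])

lemma mats_1: "mat 1 \<in> Lattice_mats"
  by (simp add: mats_mat)

lemma isometry_inj:
  assumes "\<And>x y. herm (A *v x) (A *v y) = herm x y"
  shows "inj ((*v) A)"
proof (rule injI)
  fix x y assume "A *v x = A *v y"
  hence "A *v (x - y) = 0" by (simp add: matrix_vector_mult_diff_distrib)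
  hence "herm (x - y) z = 0" for z using assms[of "x - y" z] by simp
  thus "x = y" using herm_nondegenerate[of "x - y"] by simp
qed

text \<open>The inverse of an isometry is its adjoint, so it pairs lattice vectors integrally;
  self-duality then makes it preserve the lattice.\<close>

lemma mats_inv:
  assumes "A \<in> Lattice_mats"
  obtains B where "B \<in> Lattice_mats" "A ** B = mat 1" "B ** A = mat 1"
proof -
  have "inj ((*v) A)" by (rule isometry_inj) (simp add: mats_herm assms)
  then obtain B where B: "B ** A = mat 1" using matrix_left_invertible_injective by blast
  hence AB: "A ** B = mat 1" using matrix_left_right_inverse by blast
  have AB': "A *v (B *v x) = x" for x by (simp add: matrix_vector_mul_assoc AB)
  have "B \<in> Lattice_mats"
  proof (rule mats_matI)
    fix x y show "herm (B *v x) (B *v y) = herm x y"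
      using mats_herm[OF assms, of "B *v x" "B *v y"] by (simp add: AB')
  next
    fix x assume x: "x \<in> Lattice"
    show "B *v x \<in> Lattice"
    proof (rule Lattice_unimodular)
      fix y assume "y \<in> Lattice"
      hence "herm x (A *v y) \<in> eisenstein" using x mats_Lattice[OF assms] by auto
      thus "herm (B *v x) y \<in> eisenstein"
        using mats_herm[OF assms, of "B *v x" y] by (simp add: AB')
    qed
  qed
  with B AB that show ?thesis by blast
qed

text \<open>The source of explicit automorphisms: five lattice vectors with the Gram matrix of the
  standard basis serve as columns.\<close>

lemma mats_columns:
  fixes c :: "5 \<Rightarrow> complex ^ 5"
  assumes "\<And>i. c i \<in> Lattice" "\<And>i j. herm (c i) (c j) = herm (axis i 1) (axis j 1)"
  obtains A where "A \<in> Lattice_mats" "\<And>x. A *v x = (\<Sum>i\<in>UNIV. x $ i *s c i)"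
proof -
  define A where "A = (\<chi> i j. c j $ i)"
  have A: "A *v x = (\<Sum>i\<in>UNIV. x $ i *s c i)" for x
    by (simp add: A_def matrix_vector_mult_def vec_eq_iff mult.commute)
  have "herm (A *v x) (A *v y) = herm x y" for x y
  proof -
    have "herm (A *v x) (A *v y) = (\<Sum>j\<in>UNIV. \<Sum>i\<in>UNIV. x$i * (cnj (y$j) * herm (axis i 1) (axis j 1)))"
      unfolding A by (simp add: herm_sum_left herm_sum_right herm_scale_left herm_scale_right assms(2)
          sum_distrib_left mult.left_commute)
    also have "\<dots> = herm (\<Sum>i\<in>UNIV. x$i *s axis i 1) (\<Sum>i\<in>UNIV. y$i *s axis i 1)"
      by (simp add: herm_sum_left herm_sum_right herm_scale_left herm_scale_right
          sum_distrib_left mult.left_commute)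
    finally show ?thesis by (simp add: basis_expansion)
  qed
  moreover have "A *v x \<in> Lattice" if "x \<in> Lattice" for x
    unfolding A using assms(1) that LatticeD by (intro Lattice_sum Lattice_scale) auto
  ultimately have "A \<in> Lattice_mats" by (intro mats_matI) auto
  with A that show ?thesis by blast
qed

section \<open>The groups acting\<close>

text \<open>Cut down to \<open>Lattice\<close> so as to be extensional, as \<open>Bij\<close>
  requires.\<close>

definition lat_map :: "complex ^ 5 ^ 5 \<Rightarrow> complex ^ 5 \<Rightarrow> complex ^ 5" where
  "lat_map A = (\<lambda>x\<in>Lattice. A *v x)"

lemma lat_map_Bij: "A \<in> Lattice_mats \<Longrightarrow> lat_map A \<in> Bij Lattice"
proof -
  assume A: "A \<in> Lattice_mats"
  obtain B where B: "B \<in> Lattice_mats" "A ** B = mat 1" "B ** A = mat 1" using mats_inv[OF A] .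
  have "bij_betw (lat_map A) Lattice Lattice"
    by (rule bij_betw_byWitness[of _ "(*v) B"])
       (use A B in \<open>auto simp: lat_map_def matrix_vector_mul_assoc mats_Lattice\<close>)
  thus ?thesis by (auto simp: Bij_def lat_map_def)
qed

lemma lin_ext_lat_map: "lin_ext (lat_map A) x = A *v x"
proof -
  have "A *v x = A *v (\<Sum>i\<in>UNIV. x $ i *s axis i 1)" by (simp add: basis_expansion)
  also have "\<dots> = (\<Sum>i\<in>UNIV. x $ i *s (A *v axis i 1))"
    by (simp add: vec.linear_sum[OF matrix_vector_mul_linear_gen] vec.scale)
  finally show ?thesis by (simp add: lin_ext_def lat_map_def)
qed

lemma lat_map_inj: "lat_map A = lat_map B \<Longrightarrow> A = B"
  by (metis lin_ext_lat_map matrix_eq)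

lemma carrier_Lattice_Aut: "carrier Lattice_Aut = lat_map ` Lattice_mats"
proof (intro equalityI subsetI)
  fix g assume "g \<in> lat_map ` Lattice_mats"
  then obtain A where A: "A \<in> Lattice_mats" "g = lat_map A" by blast
  have "A *v (x + y) = A *v x + A *v y" for x y by (simp add: matrix_vector_right_distrib)
  thus "g \<in> carrier Lattice_Aut"
    using A lat_map_Bij[OF A(1)]
    by (auto simp: Lattice_Aut_def lat_map_def mats_herm Lattice_add Lattice_scale vec.scale)
next
  fix g assume "g \<in> carrier Lattice_Aut"
  hence g: "g \<in> Bij Lattice" "\<And>x y. x \<in> Lattice \<Longrightarrow> y \<in> Lattice \<Longrightarrow> g (x + y) = g x + g y"
    "\<And>a x. a \<in> eisenstein \<Longrightarrow> x \<in> Lattice \<Longrightarrow> g (a *s x) = a *s g x"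
    "\<And>x y. x \<in> Lattice \<Longrightarrow> y \<in> Lattice \<Longrightarrow> herm (g x) (g y) = herm x y"
    by (auto simp: Lattice_Aut_def)
  have gL: "g x \<in> Lattice" if "x \<in> Lattice" for x
    using g(1) that by (auto simp: Bij_def bij_betw_def)
  obtain A where A: "A \<in> Lattice_mats" "\<And>x. A *v x = (\<Sum>i\<in>UNIV. x $ i *s g (axis i 1))"
    using mats_columns[of "\<lambda>i. g (axis i 1)"] gL g(4) by auto
  have g0: "g 0 = 0" using g(2)[of 0 0] by simp
  have gsum: "g (sum f I) = (\<Sum>i\<in>I. g (f i))" if "\<And>i. f i \<in> Lattice" for f and I :: "5 set"
    using that by (induction I rule: infinite_finite_induct) (auto simp: g0 g(2) Lattice_sum)
  have "g x = A *v x" if x: "x \<in> Lattice" for x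
  proof -
    have "g x = g (\<Sum>i\<in>UNIV. x $ i *s axis i 1)" by (simp add: basis_expansion)
    also have "\<dots> = (\<Sum>i\<in>UNIV. g (x $ i *s axis i 1))"
      by (rule gsum) (use x LatticeD in auto)
    also have "\<dots> = A *v x" using x LatticeD by (auto simp: A(2) g(3))
    finally show ?thesis .
  qed
  hence "g = lat_map A" using g(1)
    by (auto simp: lat_map_def Bij_def extensional_def fun_eq_iff)
  with A show "g \<in> lat_map ` Lattice_mats" by blast
qed

lemma mult_Lattice_Aut:
  assumes "A \<in> Lattice_mats" "B \<in> Lattice_mats"
  shows "lat_map A \<otimes>\<^bsub>Lattice_Aut\<^esub> lat_map B = lat_map (A ** B)"
proof -
  have "lat_map A \<otimes>\<^bsub>Lattice_Aut\<^esub> lat_map B = compose Lattice (lat_map A) (lat_map B)"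
    using lat_map_Bij[OF assms(1)] lat_map_Bij[OF assms(2)] by (simp add: Lattice_Aut_def BijGroup_def)
  also have "\<dots> = lat_map (A ** B)"
    using mats_Lattice[OF assms(2)]
    by (auto simp: compose_def lat_map_def fun_eq_iff matrix_vector_mul_assoc)
  finally show ?thesis .
qed

text \<open>The group mu_6, described by modulus one so that closure under products and conjugation
  is immediate; \<open>eisenstein_units_iff\<close> identifies it with the units of the
  ring.\<close>

definition Eunits :: "complex set" where
  "Eunits = {u \<in> eisenstein. cmod u = 1}"

lemma Eunits_1 [simp, intro]: "1 \<in> Eunits"
  by (simp add: Eunits_def)

lemma Eunits_mult [intro]: "u \<in> Eunits \<Longrightarrow> v \<in> Eunits \<Longrightarrow> u * v \<in> Eunits"
  by (auto simp: Eunits_def norm_mult)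

lemma Eunits_cnj [intro]: "u \<in> Eunits \<Longrightarrow> cnj u \<in> Eunits"
  by (auto simp: Eunits_def)

lemma Eunits_cnj_mult: "u \<in> Eunits \<Longrightarrow> cnj u * u = 1"
  using unit_cnj[of u] by (simp add: Eunits_def mult.commute)

lemma Eunits_mats: "u \<in> Eunits \<Longrightarrow> mat u \<in> Lattice_mats"
  by (simp add: Eunits_def mats_mat)

text \<open>Every cube root of unity is a square, so mu_6 modulo squares is represented by 1 and -1.
  This serves both to normalise lifts of involutions and to find the real structure of the
  plane.\<close>

lemma eis_unit_square:
  assumes "u \<in> Eunits"
  obtains z s where "z \<in> Eunits" "s = 1 \<or> s = -1" "u = s * z\<^sup>2"
proof -
  have "u \<in> {1, -1, omega, -omega, omega\<^sup>2, -(omega\<^sup>2)}" using eis_cmod_1 assms by (auto simp: Eunits_def)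
  moreover have "(omega\<^sup>2)\<^sup>2 = omega" by (simp add: omega_sq power2_eq_square omega_simps)
  ultimately have "\<exists>z s. z \<in> {1, omega, omega\<^sup>2} \<and> (s = 1 \<or> s = -1) \<and> u = s * z\<^sup>2"
    by (elim insertE emptyE)
      ((rule exI[of _ 1], rule exI[of _ 1], simp; fail) | (rule exI[of _ 1], rule exI[of _ "-1"], simp; fail) |
       (rule exI[of _ omega], rule exI[of _ 1], simp; fail) | (rule exI[of _ omega], rule exI[of _ "-1"], simp; fail) |
       (rule exI[of _ "omega\<^sup>2"], rule exI[of _ 1], simp; fail) | (rule exI[of _ "omega\<^sup>2"], rule exI[of _ "-1"], simp; fail))+
  then obtain z s where "z \<in> {1, omega, omega\<^sup>2}" "s = 1 \<or> s = -1" "u = s * z\<^sup>2" by blast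
  moreover from this have "z \<in> Eunits" by (auto simp: Eunits_def norm_power)
  ultimately show ?thesis using that by blast
qed

definition lat_coset :: "complex ^ 5 ^ 5 \<Rightarrow> (complex ^ 5 \<Rightarrow> complex ^ 5) set" where
  "lat_coset A = (\<lambda>u. lat_map (mat u ** A)) ` Eunits"

lemma unit_scalars_eq: "unit_scalars = (\<lambda>u. lat_map (mat u)) ` Eunits"
  by (auto simp: unit_scalars_def lat_map_def eisenstein_units_iff Eunits_def)

lemma r_coset_unit_scalars:
  assumes "A \<in> Lattice_mats"
  shows "unit_scalars #>\<^bsub>Lattice_Aut\<^esub> lat_map A = lat_coset A"
proof -
  have eq: "lat_map (mat u) \<otimes>\<^bsub>Lattice_Aut\<^esub> lat_map A = lat_map (mat u ** A)" if "u \<in> Eunits" for u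
    by (rule mult_Lattice_Aut[OF Eunits_mats[OF that] assms])
  have "unit_scalars #>\<^bsub>Lattice_Aut\<^esub> lat_map A
      = (\<Union>u\<in>Eunits. {lat_map (mat u) \<otimes>\<^bsub>Lattice_Aut\<^esub> lat_map A})"
    unfolding r_coset_def unit_scalars_eq by auto
  also have "\<dots> = (\<Union>u\<in>Eunits. {lat_map (mat u ** A)})" by (intro SUP_cong) (auto simp: eq)
  also have "\<dots> = lat_coset A" unfolding lat_coset_def by auto
  finally show ?thesis .
qed

lemma carrier_PGamma: "carrier PGamma = lat_coset ` Lattice_mats"
  unfolding PGamma_def FactGroup_def RCOSETS_def carrier_Lattice_Aut
  using r_coset_unit_scalars by auto

lemma mat_commute: "mat u ** A = A ** mat u" for A :: "'a::field ^ 'n ^ 'n"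
  by (rule matrix_eq[THEN iffD2]) (simp add: matrix_vector_mul_assoc[symmetric] vec.scale)

lemma mat_mult_mat: "mat u ** mat v = (mat (u * v) :: 'a::field ^ 'n ^ 'n)"
  by (rule matrix_eq[THEN iffD2]) (simp add: matrix_vector_mul_assoc[symmetric])

lemma mult_PGamma:
  assumes "A \<in> Lattice_mats" "B \<in> Lattice_mats"
  shows "lat_coset A \<otimes>\<^bsub>PGamma\<^esub> lat_coset B = lat_coset (A ** B)"
proof -
  have e: "(mat u ** A) ** (mat v ** B) = mat (u * v) ** (A ** B)" for u v :: complex
  proof -
    have "(mat u ** A) ** (mat v ** B) = mat u ** (A ** mat v) ** B" by (simp add: matrix_mul_assoc)
    also have "\<dots> = mat u ** (mat v ** A) ** B" by (simp only: mat_commute)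
    finally show ?thesis by (simp add: matrix_mul_assoc mat_mult_mat)
  qed
  have eq: "lat_map (mat u ** A) \<otimes>\<^bsub>Lattice_Aut\<^esub> lat_map (mat v ** B) = lat_map (mat (u * v) ** (A ** B))"
    if "u \<in> Eunits" "v \<in> Eunits" for u v
    using mult_Lattice_Aut[OF mats_mult[OF Eunits_mats[OF that(1)] assms(1)] mats_mult[OF Eunits_mats[OF that(2)] assms(2)]]
    by (simp only: e)
  have "lat_coset A \<otimes>\<^bsub>PGamma\<^esub> lat_coset B = lat_coset A <#>\<^bsub>Lattice_Aut\<^esub> lat_coset B"
    by (simp add: PGamma_def FactGroup_def)
  also have "\<dots> = (\<Union>u\<in>Eunits. \<Union>v\<in>Eunits. {lat_map (mat u ** A) \<otimes>\<^bsub>Lattice_Aut\<^esub> lat_map (mat v ** B)})"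
    unfolding set_mult_def lat_coset_def by auto
  also have "\<dots> = (\<Union>u\<in>Eunits. \<Union>v\<in>Eunits. {lat_map (mat (u * v) ** (A ** B))})"
    by (intro SUP_cong refl) (auto simp: eq)
  also have "\<dots> = lat_coset (A ** B)"
  proof (intro equalityI subsetI)
    fix x assume "x \<in> lat_coset (A ** B)"
    then obtain u where "u \<in> Eunits" "x = lat_map (mat (u * 1) ** (A ** B))"
      by (auto simp: lat_coset_def)
    thus "x \<in> (\<Union>u\<in>Eunits. \<Union>v\<in>Eunits. {lat_map (mat (u * v) ** (A ** B))})" by blast
  qed (auto simp: lat_coset_def)
  finally show ?thesis .
qed

lemma lat_coset_eqD:
  assumes "lat_coset A = lat_coset B"
  obtains u where "u \<in> Eunits" "A = mat u ** B"
proof -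
  have "lat_map (mat 1 ** A) \<in> lat_coset A" unfolding lat_coset_def by (rule imageI) auto
  hence "lat_map A \<in> lat_coset B" using assms by simp
  thus ?thesis using lat_map_inj that unfolding lat_coset_def by blast
qed

lemma lat_coset_mat:
  assumes "u \<in> Eunits"
  shows "lat_coset (mat u ** A) = lat_coset A"
proof -
  have "lat_map (mat w ** (mat u ** A)) = lat_map (mat (w * u) ** A)" for w
    by (simp add: matrix_mul_assoc mat_mult_mat)
  moreover have "lat_map (mat w ** A) = lat_map (mat (w * cnj u) ** (mat u ** A))" for w
    using Eunits_cnj_mult[OF assms] by (simp add: matrix_mul_assoc mat_mult_mat mult.assoc)
  ultimately show ?thesis unfolding lat_coset_def using assms by (intro equalityI image_subsetI) blast+
qed

section \<open>Negative lines and the action on them\<close>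

lemma span_singleton: "vec.span {x} = {c *s x | c. True}" for x :: "complex ^ 'n"
  by (auto simp: vec.span_singleton)

lemma ch4_iff: "L \<in> ch4 \<longleftrightarrow> (\<exists>x. L = vec.span {x} \<and> Re (herm x x) < 0)"
proof
  assume L: "L \<in> ch4"
  hence d: "vec.subspace L" "vec.dim L = 1" "\<And>x. x \<in> L \<Longrightarrow> x \<noteq> 0 \<Longrightarrow> Re (herm x x) < 0"
    by (auto simp: ch4_def)
  obtain B where B: "B \<subseteq> L" "vec.independent B" "L \<subseteq> vec.span B" "card B = vec.dim L"
    using vec.basis_exists[of L] by blast
  then obtain x where x: "B = {x}" using d(2) by (metis card_1_singletonE)
  have "L = vec.span {x}" using B x d(1) by (metis subset_antisym vec.span_minimal)
  moreover have "x \<noteq> 0" using B(2) x vec.dependent_zero by blast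
  ultimately show "\<exists>x. L = vec.span {x} \<and> Re (herm x x) < 0" using d(3) B(1) x by blast
next
  assume "\<exists>x. L = vec.span {x} \<and> Re (herm x x) < 0"
  then obtain x where x: "L = vec.span {x}" "Re (herm x x) < 0" by blast
  have xz: "x \<noteq> 0" using x(2) by auto
  have "vec.dim L = 1" unfolding x(1) using xz
    by (metis vec.dim_span_eq_card_independent card.empty card_insert_disjoint empty_iff finite.emptyI One_nat_def vec.independent_empty vec.independent_insert vec.span_empty singletonD)
  moreover have "Re (herm (c *s x) (c *s x)) < 0" if "c *s x \<noteq> 0" for c
  proof -
    have "herm (c *s x) (c *s x) = of_real ((cmod c)\<^sup>2) * herm x x"
      by (simp add: herm_lin complex_norm_square del: of_real_power)
    hence "Re (herm (c *s x) (c *s x)) = (cmod c)\<^sup>2 * Re (herm x x)" by (simp del: of_real_power)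
    thus ?thesis using x(2) that by (auto intro!: mult_pos_neg)
  qed
  moreover have "vec.subspace L" unfolding x(1) by (rule vec.subspace_span)
  ultimately show "L \<in> ch4" unfolding ch4_def using x(1) span_singleton[of x] by auto
qed

lemma image_span: "(*v) A ` vec.span {x} = vec.span {A *v x}" for A :: "complex ^ 'n ^ 'm"
  unfolding span_singleton by (auto simp: vec.scale image_iff) (metis vec.scale)

lemma image_ch4: "A \<in> Lattice_mats \<Longrightarrow> L \<in> ch4 \<Longrightarrow> (*v) A ` L \<in> ch4"
proof -
  assume A: "A \<in> Lattice_mats" "L \<in> ch4"
  then obtain x where x: "L = vec.span {x}" "Re (herm x x) < 0" using ch4_iff by blast
  show ?thesis unfolding ch4_iff
    by (rule exI[of _ "A *v x"]) (use A x in \<open>simp add: image_span mats_herm\<close>)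
qed

lemma span_unit: "u \<noteq> 0 \<Longrightarrow> vec.span {u *s x} = vec.span {x}" for x :: "complex ^ 'n"
  by (simp add: vec.span_singleton set_eq_iff image_iff)
     (metis (no_types, opaque_lifting) nonzero_divide_eq_eq vector_smult_assoc)

lemma PGamma_act_coset:
  assumes "A \<in> Lattice_mats" "L \<in> ch4"
  shows "PGamma_act (lat_coset A) L = (*v) A ` L"
proof -
  obtain x where x: "L = vec.span {x}" using assms(2) ch4_iff by blast
  have e: "lin_ext (lat_map (mat u ** A)) ` L = (*v) A ` L" if "u \<in> Eunits" for u
  proof -
    have "lin_ext (lat_map (mat u ** A)) ` L = (*v) (mat u ** A) ` L" by (simp add: lin_ext_lat_map)
    also have "\<dots> = vec.span {u *s (A *v x)}" unfolding x image_span by (simp add: matrix_vector_mul_assoc[symmetric])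
    also have "\<dots> = vec.span {A *v x}" using that by (intro span_unit) (auto simp: Eunits_def)
    finally show ?thesis by (simp add: x image_span)
  qed
  hence "(\<lambda>g. lin_ext g ` L) ` lat_coset A = {(*v) A ` L}"
    unfolding lat_coset_def image_image using e by (auto simp: image_constant_conv cong: image_cong)
  thus ?thesis using assms(2) by (simp add: PGamma_act_def)
qed

lemma orbit_PGamma: "L \<in> ch4 \<Longrightarrow> orbit PGamma PGamma_act L = {(*v) A ` L | A. A \<in> Lattice_mats}"
  by (auto simp: orbit_def carrier_PGamma PGamma_act_coset)  (metis PGamma_act_coset imageI)

lemma carrier_stab: "L \<in> ch4 \<Longrightarrow>
    carrier (PGamma_stab L) = lat_coset ` {A \<in> Lattice_mats. (*v) A ` L = L}"
  by (auto simp: PGamma_stab_def stabilizer_def carrier_PGamma PGamma_act_coset)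

lemma orbit_PGamma_eqI:
  assumes "L \<in> ch4" "A \<in> Lattice_mats"
  shows "orbit PGamma PGamma_act ((*v) A ` L) = orbit PGamma PGamma_act L"
proof -
  obtain B where B: "B \<in> Lattice_mats" "B ** A = mat 1" using mats_inv[OF assms(2)] by metis
  have "\<exists>D\<in>Lattice_mats. (*v) C ` ((*v) A ` L) = (*v) D ` L" if "C \<in> Lattice_mats" for C
    by (rule bexI[of _ "C ** A"]) (auto simp: image_image matrix_vector_mul_assoc mats_mult that assms(2))
  moreover have "\<exists>D\<in>Lattice_mats. (*v) C ` L = (*v) D ` ((*v) A ` L)" if "C \<in> Lattice_mats" for C
    by (rule bexI[of _ "C ** B"]) (auto simp: image_image matrix_vector_mul_assoc matrix_mul_assoc[symmetric] B mats_mult that)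
  ultimately show ?thesis
    unfolding orbit_PGamma[OF assms(1)] orbit_PGamma[OF image_ch4[OF assms(2,1)]] by blast
qed

section \<open>The modular group\<close>

text \<open>Orbit equivalence under the modular group in terms of four integers;
  \<open>orbit_PSL2Z\<close> translates from cosets of matrices.\<close>

definition sl2_eq :: "complex \<Rightarrow> complex \<Rightarrow> bool" where
  "sl2_eq \<tau> \<tau>' \<longleftrightarrow> (\<exists>a b c d :: int. a * d - b * c = 1 \<and>
     \<tau>' = (of_int a * \<tau> + of_int b) / (of_int c * \<tau> + of_int d))"

lemma moebius_denom_nz:
  assumes "Im \<tau> > 0" "a * d - b * c = (1::int)"
  shows "of_int c * \<tau> + of_int d \<noteq> (0::complex)"
proof
  assume z: "of_int c * \<tau> + of_int d = (0::complex)"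
  hence "Im (of_int c * \<tau> + of_int d) = 0" by simp
  hence "c = 0" using assms(1) by simp
  with z have "d = 0" by simp
  with \<open>c = 0\<close> assms(2) show False by simp
qed

lemma Im_moebius:
  assumes "Im \<tau> > 0" "a * d - b * c = (1::int)"
  shows "Im ((of_int a * \<tau> + of_int b) / (of_int c * \<tau> + of_int d)) > 0"
proof -
  define D where "D = of_int c * \<tau> + of_int d"
  have D: "D \<noteq> 0" unfolding D_def by (rule moebius_denom_nz[OF assms])
  have "(of_int a * \<tau> + of_int b) / D = (of_int a * \<tau> + of_int b) * cnj D / of_real ((cmod D)\<^sup>2)"
    using D complex_div_cnj by blast
  hence "Im ((of_int a * \<tau> + of_int b) / D) = Im ((of_int a * \<tau> + of_int b) * cnj D) / (cmod D)\<^sup>2"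
    by (simp only: Im_divide_of_real)
  moreover have "Im ((of_int a * \<tau> + of_int b) * cnj D) = real_of_int (a * d - b * c) * Im \<tau>"
    unfolding D_def by (simp add: algebra_simps)
  ultimately show ?thesis using assms D unfolding D_def by simp
qed

lemma sl2_eq_Im: "sl2_eq \<tau> \<tau>' \<Longrightarrow> Im \<tau> > 0 \<Longrightarrow> Im \<tau>' > 0"
  unfolding sl2_eq_def using Im_moebius by blast

lemma sl2_eq_refl: "sl2_eq \<tau> \<tau>"
  unfolding sl2_eq_def by (rule exI[of _ 1], rule exI[of _ 0], rule exI[of _ 0], rule exI[of _ 1]) simp

lemma sl2_eq_trans:
  assumes "sl2_eq \<tau> \<tau>'" "sl2_eq \<tau>' \<tau>''" "Im \<tau> > 0"
  shows "sl2_eq \<tau> \<tau>''"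
proof -
  from assms(1) obtain a b c d where 1: "a * d - b * c = 1"
    "\<tau>' = (of_int a * \<tau> + of_int b) / (of_int c * \<tau> + of_int d)" unfolding sl2_eq_def by blast
  from assms(2) obtain a' b' c' d' where 2: "a' * d' - b' * c' = 1"
    "\<tau>'' = (of_int a' * \<tau>' + of_int b') / (of_int c' * \<tau>' + of_int d')" unfolding sl2_eq_def by blast
  define N D where "N = of_int a * \<tau> + of_int b" and "D = of_int c * \<tau> + of_int d"
  have D: "D \<noteq> 0" unfolding D_def by (rule moebius_denom_nz[OF assms(3) 1(1)])
  have "of_int a' * (N / D) + of_int b' = (of_int a' * N + of_int b' * D) / D"
    "of_int c' * (N / D) + of_int d' = (of_int c' * N + of_int d' * D) / D"
    using D by (simp_all add: field_simps)
  hence "\<tau>'' = (of_int a' * N + of_int b' * D) / (of_int c' * N + of_int d' * D)"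
    using 2(2) 1(2) D unfolding N_def[symmetric] D_def[symmetric] by simp
  also have "\<dots> = (of_int (a' * a + b' * c) * \<tau> + of_int (a' * b + b' * d))
      / (of_int (c' * a + d' * c) * \<tau> + of_int (c' * b + d' * d))"
    by (simp add: N_def D_def algebra_simps)
  finally have "\<tau>'' = (of_int (a' * a + b' * c) * \<tau> + of_int (a' * b + b' * d))
      / (of_int (c' * a + d' * c) * \<tau> + of_int (c' * b + d' * d))" .
  moreover have "(a' * a + b' * c) * (c' * b + d' * d) - (a' * b + b' * d) * (c' * a + d' * c)
      = (a * d - b * c) * (a' * d' - b' * c')" by (simp add: algebra_simps)
  ultimately show ?thesis unfolding sl2_eq_def using 1(1) 2(1) by (metis mult_1)
qed

lemma sl2_eq_sym:
  assumes "sl2_eq \<tau> \<tau>'" "Im \<tau> > 0"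
  shows "sl2_eq \<tau>' \<tau>"
proof -
  from assms(1) obtain a b c d where 1: "a * d - b * c = 1"
    "\<tau>' = (of_int a * \<tau> + of_int b) / (of_int c * \<tau> + of_int d)" unfolding sl2_eq_def by blast
  define N D where "N = of_int a * \<tau> + of_int b" and "D = of_int c * \<tau> + of_int d"
  have D: "D \<noteq> 0" unfolding D_def by (rule moebius_denom_nz[OF assms(2) 1(1)])
  have t: "of_int d * N + of_int (- b) * D = of_int (a * d - b * c) * \<tau>"
    "of_int (- c) * N + of_int a * D = of_int (a * d - b * c)"
    by (simp_all add: N_def D_def algebra_simps)
  have "of_int d * \<tau>' + of_int (- b) = (of_int d * N + of_int (- b) * D) / D"
    "of_int (- c) * \<tau>' + of_int a = (of_int (- c) * N + of_int a * D) / D"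
    using 1(2) D unfolding N_def[symmetric] D_def[symmetric] by (simp_all add: field_simps)
  hence "(of_int d * \<tau>' + of_int (- b)) / (of_int (- c) * \<tau>' + of_int a) = \<tau>"
    unfolding t 1(1) using D by simp
  moreover have "d * a - (- b) * (- c) = 1" using 1(1) by (simp add: algebra_simps)
  ultimately show ?thesis unfolding sl2_eq_def by metis
qed

lemma carrier_PSL2Z: "carrier PSL2Z = {{A, - A} | A. det A = 1}"
proof -
  have "- mat 1 ** A = - A" for A :: "int ^ 2 ^ 2"
    by (simp add: vec_eq_iff matrix_matrix_mult_def mat_def sum_2 forall_2)
  thus ?thesis
    unfolding PSL2Z_def FactGroup_def RCOSETS_def r_coset_def SL2Z_def by auto
qed

lemma PSL2Z_act_coset: "Im \<tau> > 0 \<Longrightarrow> PSL2Z_act {A, - A} \<tau> = moebius_int A \<tau>"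
proof -
  assume "Im \<tau> > 0"
  moreover have "moebius_int (- A) \<tau> = moebius_int A \<tau>"
  proof -
    have "moebius_int (- A) \<tau> = (- (of_int (A $ 1 $ 1) * \<tau> + of_int (A $ 1 $ 2)))
        / (- (of_int (A $ 2 $ 1) * \<tau> + of_int (A $ 2 $ 2)))" by (simp add: moebius_int_def)
    thus ?thesis unfolding moebius_int_def by (metis minus_divide_divide)
  qed
  ultimately show ?thesis by (simp add: PSL2Z_act_def upper_half_plane_def)
qed

lemma orbit_PSL2Z:
  assumes "Im \<tau> > 0"
  shows "orbit PSL2Z PSL2Z_act \<tau> = {\<tau>'. sl2_eq \<tau> \<tau>'}"
proof (intro equalityI subsetI)
  fix x assume "x \<in> orbit PSL2Z PSL2Z_act \<tau>"
  then obtain A :: "int ^ 2 ^ 2" where "det A = 1" "x = moebius_int A \<tau>"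
    using PSL2Z_act_coset[OF assms] unfolding orbit_def carrier_PSL2Z by auto
  thus "x \<in> {\<tau>'. sl2_eq \<tau> \<tau>'}"
    unfolding sl2_eq_def moebius_int_def det_2 by blast
next
  fix x assume "x \<in> {\<tau>'. sl2_eq \<tau> \<tau>'}"
  then obtain a b c d :: int where 1: "a * d - b * c = 1"
    "x = (of_int a * \<tau> + of_int b) / (of_int c * \<tau> + of_int d)" unfolding sl2_eq_def by blast
  define A :: "int ^ 2 ^ 2" where "A = vector [vector [a, b], vector [c, d]]"
  have "det A = 1" using 1 by (simp add: A_def det_2)
  moreover have "x = moebius_int A \<tau>" using 1 by (simp add: A_def moebius_int_def)
  ultimately show "x \<in> orbit PSL2Z PSL2Z_act \<tau>"
    unfolding orbit_def carrier_PSL2Z using PSL2Z_act_coset[OF assms, of A]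
    by (intro CollectI exI[of _ "{A, - A}"]) auto
qed

text \<open>Generation of SL_2(\<int>) by S and T: the closure rules are left multiplication by T,
  its inverse and S, and Euclid's algorithm on the first column decreases |c|. The square of S
  supplies -1.\<close>

lemma SL2Z_induct:
  fixes P :: "int \<Rightarrow> int \<Rightarrow> int \<Rightarrow> int \<Rightarrow> bool"
  assumes P1: "P 1 0 0 1"
    and PT: "\<And>a b c d. P a b c d \<Longrightarrow> P (a + c) (b + d) c d"
    and PT': "\<And>a b c d. P a b c d \<Longrightarrow> P (a - c) (b - d) c d"
    and PS: "\<And>a b c d. P a b c d \<Longrightarrow> P (- c) (- d) a b"
    and det: "a * d - b * c = 1"
  shows "P a b c d"
proof -
  have Tk: "P (a + k * c) (b + k * d) c d" if "P a b c d" for a b c d k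
  proof (induction k rule: int_induct[of _ 0])
    case base thus ?case using that by simp
  next
    case (step1 i) thus ?case using PT[of "a + i * c" "b + i * d" c d] by (simp add: algebra_simps)
  next
    case (step2 i) thus ?case using PT'[of "a + i * c" "b + i * d" c d] by (simp add: algebra_simps)
  qed
  have Pneg: "P (- a) (- b) (- c) (- d)" if "P a b c d" for a b c d
    using PS[OF PS[OF that]] .
  from det show ?thesis
  proof (induction "nat \<bar>c\<bar>" arbitrary: a b c d rule: less_induct)
    case less
    show ?case
    proof (cases "c = 0")
      case True
      with less.prems have "a * d = 1" by simp
      hence "a = 1 \<and> d = 1 \<or> a = -1 \<and> d = -1" by (simp add: zmult_eq_1_iff)
      moreover have "P 1 k 0 1" for k using Tk[OF P1, of k] by simp
      moreover have "P (-1) k 0 (-1)" for k using Pneg[OF \<open>P 1 (-k) 0 1\<close>] by simp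
      ultimately show ?thesis using True by auto
    next
      case False
      define q where "q = a div c"
      define r where "r = a mod c"
      have a: "a = q * c + r" by (simp add: q_def r_def)
      have "\<bar>r\<bar> < \<bar>c\<bar>" using False by (simp add: r_def abs_mod_less)
      moreover have "(- c) * (b - q * d) - (- d) * r = 1" using less.prems a by (simp add: algebra_simps)
      ultimately have "P (- c) (- d) r (b - q * d)" using less.hyps[of r "-c" "b - q * d" "-d"] by simp
      from Pneg[OF PS[OF this]] have "P r (b - q * d) c d" by simp
      from Tk[OF this, of q] show ?thesis by (simp add: a algebra_simps)
    qed
  qed
qed

section \<open>Elliptic points of the modular group\<close>

lemma sl2_eq_translate: "sl2_eq \<tau> (\<tau> + of_int k)"
  unfolding sl2_eq_def by (rule exI[of _ 1], rule exI[of _ k], rule exI[of _ 0], rule exI[of _ 1]) simp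

lemma sl2_eq_invert: "sl2_eq \<tau> (- 1 / \<tau>)"
  unfolding sl2_eq_def by (rule exI[of _ 0], rule exI[of _ "-1"], rule exI[of _ 1], rule exI[of _ 0]) simp

text \<open>Reduction theory of the fixed-point equation: a non-real fixed point forces trace 0, 1
  or -1, and then translations and inversions shrink |c| to 1, where the equation can be solved
  directly.\<close>

lemma elliptic_point:
  fixes a b c d :: int
  assumes "a * d - b * c = 1" "c \<noteq> 0" "Im \<tau> > 0"
    "of_int c * \<tau>\<^sup>2 + of_int (d - a) * \<tau> - of_int b = 0"
  shows "sl2_eq \<i> \<tau> \<or> sl2_eq omega \<tau>"
  using assms
proof (induction "nat \<bar>c\<bar>" arbitrary: a b c d \<tau> rule: less_induct)
  case less
  define t where "t = a + d"
  have t4: "t * t < 4"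
  proof -
    \<comment> \<open>The derivative of the quadratic at its root; its square is the discriminant
      t^2 - 4, negative because \<open>w\<close> is not real.\<close>
    define w where "w = of_int (2 * c) * \<tau> + of_int (d - a)"
    have "w\<^sup>2 = 4 * of_int c * (of_int c * \<tau>\<^sup>2 + of_int (d - a) * \<tau> - of_int b)
        + of_int ((d - a) * (d - a) + 4 * b * c)"
      by (simp add: w_def power2_eq_square algebra_simps)
    also have "\<dots> = of_int ((d - a) * (d - a) + 4 * b * c)" using less.prems(4) by simp
    also have "(d - a) * (d - a) + 4 * b * c = t * t - 4 * (a * d - b * c)"
      by (simp add: t_def algebra_simps)
    finally have w2: "w\<^sup>2 = of_int (t * t - 4)" using less.prems(1) by simp
    have Iw: "Im w \<noteq> 0" using less.prems by (simp add: w_def)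
    have "Im (w\<^sup>2) = 0" "Re (w\<^sup>2) = real_of_int (t * t - 4)" unfolding w2 by simp_all
    hence "Re w * Im w = 0" and e: "real_of_int (t * t - 4) = (Re w)\<^sup>2 - (Im w)\<^sup>2"
      by (auto simp: power2_eq_square)
    hence "Re w = 0" using Iw by simp
    moreover have "(Im w)\<^sup>2 > 0" using Iw by simp
    ultimately have "real_of_int (t * t - 4) < 0" unfolding e by simp
    thus ?thesis by linarith
  qed
  have t1: "\<bar>t\<bar> \<le> 1"
  proof (rule ccontr)
    assume "\<not> \<bar>t\<bar> \<le> 1"
    hence "2 * 2 \<le> \<bar>t\<bar> * \<bar>t\<bar>" by (intro mult_mono) auto
    thus False using t4 by simp
  qed
  \<comment> \<open>Conjugation by the translation by \<open>k\<close> replaces a by its remainder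
    \<open>r\<close> of least absolute value modulo c.\<close>
  define k where "k = round (real_of_int a / real_of_int c)"
  define r where "r = a - k * c"
  have r: "2 * \<bar>r\<bar> \<le> \<bar>c\<bar>"
  proof -
    have "\<bar>real_of_int k - real_of_int a / real_of_int c\<bar> \<le> 1/2"
      unfolding k_def by (rule of_int_round_abs_le)
    hence "\<bar>real_of_int k - real_of_int a / real_of_int c\<bar> * \<bar>real_of_int c\<bar> \<le> 1/2 * \<bar>real_of_int c\<bar>"
      by (rule mult_right_mono) simp
    hence "\<bar>(real_of_int k - real_of_int a / real_of_int c) * real_of_int c\<bar> \<le> 1/2 * \<bar>real_of_int c\<bar>"
      by (simp add: abs_mult)
    moreover have "(real_of_int k - real_of_int a / real_of_int c) * real_of_int c = - real_of_int r"
      using less.prems(2) by (simp add: r_def field_simps)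
    ultimately have "real_of_int (2 * \<bar>r\<bar>) \<le> real_of_int \<bar>c\<bar>" by simp
    thus ?thesis by (simp only: of_int_le_iff)
  qed
  define \<sigma> where "\<sigma> = \<tau> - of_int k"
  define b1 where "b1 = a * k + b - k * (c * k + d)"
  define d1 where "d1 = d + k * c"
  have d1: "d1 = t - r" by (simp add: d1_def t_def r_def)
  have det1: "r * d1 - b1 * c = 1"
    using less.prems(1) by (simp add: r_def d1_def b1_def algebra_simps)
  have I1: "Im \<sigma> > 0" using less.prems by (simp add: \<sigma>_def)
  have eq1: "of_int c * \<sigma>\<^sup>2 + of_int (d1 - r) * \<sigma> - of_int b1 = 0"
    using less.prems(4) by (simp add: \<sigma>_def d1_def r_def b1_def power2_eq_square algebra_simps)
  have \<sigma>\<tau>: "sl2_eq \<sigma> \<tau>" using sl2_eq_translate[of \<sigma> k] by (simp add: \<sigma>_def)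
  have I\<omega>: "Im \<i> > 0" "Im omega > 0" by simp_all
  have "sl2_eq \<i> \<sigma> \<or> sl2_eq omega \<sigma>"
  proof (cases "\<bar>c\<bar> = 1")
    case True
    hence c: "c * c = 1" by (auto simp: abs_if split: if_splits)
    have r0: "r = 0" using r True by simp
    hence "b1 * c = -1" using det1 by simp
    hence "b1 * (c * c) = - c" by (simp add: mult.assoc[symmetric])
    hence b1: "b1 = - c" using c by simp
    \<comment> \<open>Multiplied by c, which is 1 or -1, the equation becomes x^2 + s x + 1 = 0. Its
      root in the upper half-plane is i, \<open>omega\<close> or \<open>omega + 1\<close>.\<close>
    define s where "s = c * t"
    have "of_int c * (of_int c * \<sigma>\<^sup>2 + of_int (d1 - r) * \<sigma> - of_int b1) = of_int (c * c) * \<sigma>\<^sup>2 + of_int s * \<sigma> + of_int (c * c)"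
      unfolding b1 d1 r0 s_def by (simp add: algebra_simps)
    hence e: "\<sigma>\<^sup>2 + of_int s * \<sigma> + 1 = 0" unfolding eq1 c by simp
    have "s = 0 \<or> s = 1 \<or> s = -1" using t1 True unfolding s_def by (auto simp: abs_if split: if_splits)
    thus ?thesis
    proof (elim disjE)
      assume "s = 0"
      hence "(\<sigma> - \<i>) * (\<sigma> + \<i>) = 0" using e by (simp add: algebra_simps power2_eq_square)
      moreover have "\<sigma> + \<i> \<noteq> 0" using I1 by (auto simp: complex_eq_iff)
      ultimately show ?thesis using sl2_eq_refl by auto
    next
      assume "s = 1"
      hence "(\<sigma> - omega) * (\<sigma> - cnj omega) = 0"
        using e by (simp add: algebra_simps power2_eq_square omega_mult)
      moreover have "Im (\<sigma> - cnj omega) > 0" using I1 by (simp add: add_pos_pos)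
      hence "\<sigma> - cnj omega \<noteq> 0" by (metis less_irrefl zero_complex.simps(2))
      ultimately show ?thesis using sl2_eq_refl by auto
    next
      assume "s = -1"
      hence "(\<sigma> - (omega + 1)) * (\<sigma> + omega) = 0"
        using e by (simp add: algebra_simps power2_eq_square omega_mult)
      moreover have "Im (\<sigma> + omega) > 0" using I1 by (simp add: add_pos_pos)
      hence "\<sigma> + omega \<noteq> 0" by (metis less_irrefl zero_complex.simps(2))
      ultimately show ?thesis using sl2_eq_translate[of omega 1] by auto
    qed
  next
    case False
    hence c2: "\<bar>c\<bar> \<ge> 2" using less.prems(2) by linarith
    have b0: "b1 \<noteq> 0"
    proof
      assume "b1 = 0"
      hence "r = 1 \<and> d1 = 1 \<or> r = -1 \<and> d1 = -1" using det1 by (simp add: zmult_eq_1_iff)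
      thus False using d1 t1 by auto
    qed
    \<comment> \<open>The descent: b1 c = r t - r^2 - 1 is smaller than c^2 in absolute value,
      because |r| is at most |c|/2, |t| at most 1 and |c| at least 2.\<close>
    have "\<bar>b1\<bar> < \<bar>c\<bar>"
    proof (rule ccontr)
      assume "\<not> \<bar>b1\<bar> < \<bar>c\<bar>"
      hence "\<bar>c\<bar> * \<bar>c\<bar> \<le> \<bar>b1\<bar> * \<bar>c\<bar>" by (intro mult_right_mono) auto
      also have "\<dots> = \<bar>b1 * c\<bar>" by (simp add: abs_mult)
      also have "b1 * c = r * t - r * r - 1" using det1 d1 by (simp add: algebra_simps)
      also have "\<bar>r * t - r * r - 1\<bar> \<le> \<bar>r * t\<bar> + \<bar>r * r\<bar> + 1" by linarith
      also have "\<dots> \<le> \<bar>r\<bar> * 1 + \<bar>r\<bar> * \<bar>r\<bar> + 1"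
        unfolding abs_mult using t1 by (intro add_mono mult_left_mono) auto
      finally have 1: "\<bar>c\<bar> * \<bar>c\<bar> \<le> \<bar>r\<bar> + \<bar>r\<bar> * \<bar>r\<bar> + 1" by simp
      have "(2 * \<bar>r\<bar>) * (2 * \<bar>r\<bar>) \<le> \<bar>c\<bar> * \<bar>c\<bar>" using r by (intro mult_mono) auto
      hence "3 * (\<bar>c\<bar> * \<bar>c\<bar>) \<le> 2 * \<bar>c\<bar> + 4" using 1 r by linarith
      moreover have "2 * \<bar>c\<bar> \<le> \<bar>c\<bar> * \<bar>c\<bar>" using c2 by (intro mult_right_mono) auto
      ultimately show False using c2 by linarith
    qed
    hence lt: "nat \<bar>- b1\<bar> < nat \<bar>c\<bar>" by simp
    \<comment> \<open>Inversion puts \<open>- b1\<close> in the place of \<open>c\<close>, so the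
      induction hypothesis applies.\<close>
    define \<rho> where "\<rho> = - 1 / \<sigma>"
    have \<sigma>0: "\<sigma> \<noteq> 0" using I1 by auto
    have I2: "Im \<rho> > 0" unfolding \<rho>_def using sl2_eq_Im[OF sl2_eq_invert I1] .
    have "of_int (- b1) * \<rho>\<^sup>2 + of_int (r - d1) * \<rho> - of_int (- c)
        = (of_int c * \<sigma>\<^sup>2 + of_int (d1 - r) * \<sigma> - of_int b1) / \<sigma>\<^sup>2"
      using \<sigma>0 by (simp add: \<rho>_def field_simps power2_eq_square)
    hence eq2: "of_int (- b1) * \<rho>\<^sup>2 + of_int (r - d1) * \<rho> - of_int (- c) = 0" unfolding eq1 by simp
    have det2: "d1 * r - (- c) * (- b1) = 1" using det1 by (simp add: algebra_simps)
    have "sl2_eq \<i> \<rho> \<or> sl2_eq omega \<rho>"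
      by (rule less.hyps[OF lt det2 _ I2 eq2]) (use b0 in simp)
    moreover have "sl2_eq \<rho> \<sigma>" using sl2_eq_invert[of \<rho>] \<sigma>0 by (simp add: \<rho>_def)
    ultimately show ?thesis using sl2_eq_trans I\<omega> by blast
  qed
  thus ?case using \<sigma>\<tau> sl2_eq_trans I\<omega> by blast
qed

lemma upper_half_plane'_iff:
  "\<tau> \<in> upper_half_plane' \<longleftrightarrow> Im \<tau> > 0 \<and> \<not> sl2_eq \<i> \<tau> \<and> \<not> sl2_eq omega \<tau>"
proof -
  have "Im \<i> > 0" "Im omega > 0" by simp_all
  thus ?thesis unfolding upper_half_plane'_def upper_half_plane_def by (simp add: orbit_PSL2Z)
qed

lemma stabilizer_SL2Z_trivial:
  assumes "\<tau> \<in> upper_half_plane'" "a * d - b * c = (1::int)"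
    "(of_int a * \<tau> + of_int b) / (of_int c * \<tau> + of_int d) = \<tau>"
  shows "b = 0 \<and> c = 0 \<and> (a = 1 \<and> d = 1 \<or> a = -1 \<and> d = -1)"
proof -
  have I: "Im \<tau> > 0" and n: "\<not> sl2_eq \<i> \<tau>" "\<not> sl2_eq omega \<tau>"
    using assms(1) upper_half_plane'_iff by auto
  have eq: "of_int c * \<tau>\<^sup>2 + of_int (d - a) * \<tau> - of_int b = 0"
    using assms(3) moebius_denom_nz[OF I assms(2)] by (simp add: field_simps power2_eq_square)
  have c: "c = 0" using elliptic_point[OF assms(2) _ I eq] n by blast
  hence "Im (of_int (d - a) * \<tau> - of_int b) = 0" using eq by simp
  hence "d = a" using I by simp
  moreover have "b = 0" using eq c \<open>d = a\<close> by simp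
  ultimately show ?thesis using c assms(2) by (auto simp: zmult_eq_1_iff)
qed

section \<open>The hyperbolic plane spanned by v1, v2 and its orthogonal complement\<close>

lemma v1_nth [simp]: "v1 $ 1 = - theta" "v1 $ 2 = omega\<^sup>2" "v1 $ 3 = omega\<^sup>2" "v1 $ 4 = omega\<^sup>2" "v1 $ 5 = 0"
  by (simp_all add: v1_def)

lemma v2_nth [simp]: "v2 $ 1 = 1" "v2 $ 2 = 0" "v2 $ 3 = 0" "v2 $ 4 = 0" "v2 $ 5 = 1"
  by (simp_all add: v2_def)

lemma v1_Lattice [simp, intro]: "v1 \<in> Lattice" and v2_Lattice [simp, intro]: "v2 \<in> Lattice"
  by (auto simp: Lattice_iff5)

lemma herm_v1_v1 [simp]: "herm v1 v1 = 0"
  and herm_v2_v2 [simp]: "herm v2 v2 = 0"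
  and herm_v1_v2 [simp]: "herm v1 v2 = theta"
  and herm_v2_v1 [simp]: "herm v2 v1 = - theta"
  by (simp_all add: herm_eq omega_sq theta_eq omega_simps)

lemma herm_j0: "Re (herm (\<tau> *s v1 + v2) (\<tau> *s v1 + v2)) = - 2 * sqrt 3 * Im \<tau>"
  by (simp add: herm_lin theta_eq algebra_simps)

lemma j0_ch4: "Im \<tau> > 0 \<Longrightarrow> j0 \<tau> \<in> ch4"
  unfolding ch4_iff j0_def by (rule exI, rule conjI, rule refl, subst herm_j0) (simp add: mult_neg_pos)

lemma j0_mem: "\<tau> *s v1 + v2 \<in> j0 \<tau>"
  unfolding j0_def by (rule vec.span_base) simp

lemma v1_v2_independent:
  assumes "a *s v1 + b *s v2 = c *s v1 + d *s v2"
  shows "a = c" "b = d"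
proof -
  have "herm (a *s v1 + b *s v2) v2 = herm (c *s v1 + d *s v2) v2"
    "herm (a *s v1 + b *s v2) v1 = herm (c *s v1 + d *s v2) v1" using assms by simp_all
  thus "a = c" "b = d" by (simp_all add: herm_lin)
qed

lemma axis_nth: "axis i x $ j = (if j = i then x else 0)"
  by (simp add: axis_def)

lemma SL2Z_lift_gens:
  obtains S T where "S \<in> Lattice_mats" "T \<in> Lattice_mats" "S *v v1 = v2" "S *v v2 = - v1"
    "T *v v1 = v1" "T *v v2 = v1 + v2"
proof -
  \<comment> \<open>S and T act nontrivially on the discriminant group of the plane, so no lift can
    be the identity on its complement. The columns below are explicit isometries with the right
    effect on \<open>v1\<close> and \<open>v2\<close>.\<close>
  define s :: "5 \<Rightarrow> complex ^ 5" where "s = (\<lambda>i.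
     if i = 1 then vector [1 + 2 * omega, 0, 1 + omega, 1 + omega, 0]
     else if i = 2 then vector [0, 0, 0, 0, omega]
     else if i = 3 then vector [- omega, 0, - 1 - omega, - omega, 0]
     else if i = 4 then vector [- omega, 0, - omega, - 1 - omega, 0]
     else vector [0, 1 + omega, 0, 0, 0])"
  define t :: "5 \<Rightarrow> complex ^ 5" where "t = (\<lambda>i.
     if i = 1 then vector [- 2 * omega, - 1 - omega, - 1 - omega, - 1 - omega, 0]
     else if i = 2 then vector [omega, 1 + omega, 1 + omega, 0, 0]
     else if i = 3 then vector [omega, 0, 1 + omega, 1 + omega, 0]
     else if i = 4 then vector [omega, 1 + omega, 0, 1 + omega, 0]
     else vector [0, 0, 0, 0, 1])"
  have nz [simp]: "(2::5) \<noteq> 1" "(3::5) \<noteq> 1" "(4::5) \<noteq> 1" "(5::5) \<noteq> 1" "(3::5) \<noteq> 2" "(4::5) \<noteq> 2" "(5::5) \<noteq> 2"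
    "(4::5) \<noteq> 3" "(5::5) \<noteq> 3" "(5::5) \<noteq> 4" by simp_all
  have sL: "s i \<in> Lattice" and tL: "t i \<in> Lattice" for i
    unfolding s_def t_def by (auto simp: Lattice_iff5)
  have "\<forall>i j. herm (s i) (s j) = herm (axis i 1) (axis j 1)"
    unfolding forall_5 by (simp add: s_def herm_axis axis_nth herm_eq[of "vector _"] omega_simps)
  with sL obtain S where S: "S \<in> Lattice_mats" "\<And>x. S *v x = (\<Sum>i\<in>UNIV. x $ i *s s i)"
    using mats_columns[of s] by blast
  have "\<forall>i j. herm (t i) (t j) = herm (axis i 1) (axis j 1)"
    unfolding forall_5 by (simp add: t_def herm_axis axis_nth herm_eq[of "vector _"] omega_simps)
  with tL obtain T where T: "T \<in> Lattice_mats" "\<And>x. T *v x = (\<Sum>i\<in>UNIV. x $ i *s t i)"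
    using mats_columns[of t] by blast
  have "S *v v1 = v2" "S *v v2 = - v1" "T *v v1 = v1" "T *v v2 = v1 + v2"
    unfolding S(2) T(2) sum_5
    by (simp_all add: vec_eq_iff forall_5 s_def t_def omega_sq theta_eq omega_simps)
  with S(1) T(1) that show ?thesis by blast
qed

lemma SL2Z_lift:
  assumes "a * d - b * c = (1::int)"
  obtains A where "A \<in> Lattice_mats" "A *v v1 = of_int a *s v1 + of_int c *s v2"
    "A *v v2 = of_int b *s v1 + of_int d *s v2"
proof -
  obtain S T where ST: "S \<in> Lattice_mats" "T \<in> Lattice_mats" "S *v v1 = v2" "S *v v2 = - v1"
    "T *v v1 = v1" "T *v v2 = v1 + v2" using SL2Z_lift_gens .
  obtain T' where T': "T' \<in> Lattice_mats" "T' ** T = mat 1" using mats_inv[OF ST(2)] by metis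
  have T'T: "T' *v (T *v x) = x" for x by (simp add: matrix_vector_mul_assoc T'(2))
  have T'1: "T' *v v1 = v1" using T'T[of v1] ST by simp
  have T'2: "T' *v v2 = v2 - v1" using T'T[of v2] ST T'1 by (simp add: matrix_vector_right_distrib algebra_simps)
  define P where "P = (\<lambda>a b c d :: int. \<exists>A \<in> Lattice_mats. A *v v1 = of_int a *s v1 + of_int c *s v2 \<and>
    A *v v2 = of_int b *s v1 + of_int d *s v2)"
  have comp: "P a' b' c' d'" if pabc: "P a b c d" and "R \<in> Lattice_mats"
    "R *v (of_int a *s v1 + of_int c *s v2) = of_int a' *s v1 + of_int c' *s v2"
    "R *v (of_int b *s v1 + of_int d *s v2) = of_int b' *s v1 + of_int d' *s v2" for a b c d a' b' c' d' R
  proof -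
    obtain A where A: "A \<in> Lattice_mats" "A *v v1 = of_int a *s v1 + of_int c *s v2"
      "A *v v2 = of_int b *s v1 + of_int d *s v2" using pabc unfolding P_def by blast
    show ?thesis unfolding P_def
      by (rule bexI[of _ "R ** A"]) (use A that(2-) in \<open>auto simp: matrix_vector_mul_assoc[symmetric] mats_mult\<close>)
  qed
  note expand = matrix_vector_right_distrib vec.scale
  have "P a b c d"
  proof (rule SL2Z_induct[OF _ _ _ _ assms])
    show "P 1 0 0 1" unfolding P_def by (rule bexI[of _ "mat 1"]) (auto simp: mats_1)
  next
    fix a b c d assume P: "P a b c d"
    show "P (a + c) (b + d) c d"
      by (rule comp[OF P ST(2)]) (simp_all add: expand ST vec_eq_iff algebra_simps)
    show "P (a - c) (b - d) c d"
      by (rule comp[OF P T'(1)]) (simp_all add: expand T'1 T'2 vec_eq_iff algebra_simps)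
    show "P (- c) (- d) a b"
      by (rule comp[OF P ST(1)]) (simp_all add: expand ST vec_eq_iff algebra_simps)
  qed
  thus ?thesis unfolding P_def using that by blast
qed

lemma j0_lift:
  assumes "Im \<tau> > 0" "a * d - b * c = (1::int)"
    "A *v v1 = of_int a *s v1 + of_int c *s v2" "A *v v2 = of_int b *s v1 + of_int d *s v2"
  shows "(*v) A ` j0 \<tau> = j0 ((of_int a * \<tau> + of_int b) / (of_int c * \<tau> + of_int d))"
proof -
  define D where "D = of_int c * \<tau> + of_int d"
  have D: "D \<noteq> 0" unfolding D_def by (rule moebius_denom_nz[OF assms(1,2)])
  have "A *v (\<tau> *s v1 + v2) = D *s (((of_int a * \<tau> + of_int b) / D) *s v1 + v2)"
    using D by (simp add: matrix_vector_right_distrib vec.scale assms vec_eq_iff)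
      (simp add: D_def algebra_simps)
  thus ?thesis unfolding j0_def image_span D_def[symmetric] by (simp only: span_unit[OF D])
qed

lemma sl2_eq_j0:
  assumes "sl2_eq \<tau> \<tau>'" "Im \<tau> > 0"
  obtains A where "A \<in> Lattice_mats" "(*v) A ` j0 \<tau> = j0 \<tau>'"
proof -
  from assms(1) obtain a b c d where 1: "a * d - b * c = 1"
    "\<tau>' = (of_int a * \<tau> + of_int b) / (of_int c * \<tau> + of_int d)" unfolding sl2_eq_def by blast
  obtain A where "A \<in> Lattice_mats" "A *v v1 = of_int a *s v1 + of_int c *s v2"
    "A *v v2 = of_int b *s v1 + of_int d *s v2" using SL2Z_lift[OF 1(1)] by blast
  with j0_lift[OF assms(2) 1(1)] 1(2) that show ?thesis by metis
qed

text \<open>\<open>kappa\<close> is \<open>\<omega>/\<theta>\<close>. Its multiples in the first and last coordinates make \<open>iota\<close> an isometry from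
  \<open>\<complex>\<^sup>3\<close> with the standard form onto the complement of \<open>v1\<close> and \<open>v2\<close>; \<open>proj\<close> is its adjoint.\<close>

definition kappa :: complex where "kappa = (2 + omega) / 3"

lemma kappa_theta: "kappa * theta = omega"
  by (simp add: kappa_def theta_eq omega_simps)

lemma cnj_kappa [simp]: "cnj kappa = (1 - omega) / 3"
  by (simp add: kappa_def)

definition iota_mat :: "complex ^ 3 ^ 5" where
  "iota_mat = vector [vector [kappa, kappa, kappa], vector [1, 0, 0], vector [0, 1, 0], vector [0, 0, 1],
     vector [kappa, kappa, kappa]]"

definition proj_mat :: "complex ^ 5 ^ 3" where
  "proj_mat = vector [vector [(omega - 1) / 3, 1, 0, 0, (1 - omega) / 3],
     vector [(omega - 1) / 3, 0, 1, 0, (1 - omega) / 3], vector [(omega - 1) / 3, 0, 0, 1, (1 - omega) / 3]]"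

definition iota :: "complex ^ 3 \<Rightarrow> complex ^ 5" where "iota w = iota_mat *v w"
definition proj :: "complex ^ 5 \<Rightarrow> complex ^ 3" where "proj x = proj_mat *v x"

definition hdot :: "complex ^ 3 \<Rightarrow> complex ^ 3 \<Rightarrow> complex" where
  "hdot w z = w $ 1 * cnj (z $ 1) + w $ 2 * cnj (z $ 2) + w $ 3 * cnj (z $ 3)"

lemma iota_nth [simp]: "iota w $ 1 = kappa * (w$1 + w$2 + w$3)" "iota w $ 2 = w$1" "iota w $ 3 = w$2"
  "iota w $ 4 = w$3" "iota w $ 5 = kappa * (w$1 + w$2 + w$3)"
  by (simp_all add: iota_def iota_mat_def matrix_vector_mult_def sum_3 algebra_simps)

lemma proj_nth [simp]: "proj x $ 1 = x$2 + (x$1 - x$5) * (omega - 1) / 3"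
  "proj x $ 2 = x$3 + (x$1 - x$5) * (omega - 1) / 3" "proj x $ 3 = x$4 + (x$1 - x$5) * (omega - 1) / 3"
  by (simp_all add: proj_def proj_mat_def matrix_vector_mult_def sum_5 field_simps)

lemma iota_lin: "iota (w + z) = iota w + iota z" "iota (w - z) = iota w - iota z" "iota (c *s w) = c *s iota w"
  "iota 0 = 0"
  by (simp_all add: iota_def matrix_vector_right_distrib matrix_vector_mult_diff_distrib vec.scale)

lemma proj_lin: "proj (x + y) = proj x + proj y" "proj (x - y) = proj x - proj y" "proj (c *s x) = c *s proj x"
  by (simp_all add: proj_def matrix_vector_right_distrib matrix_vector_mult_diff_distrib vec.scale)

lemma herm_iota_iota: "herm (iota w) (iota z) = hdot w z"
  by (simp add: herm_eq hdot_def)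

lemma herm_iota: "herm x (iota w) = hdot (proj x) w"
  by (simp add: herm_eq hdot_def field_simps)

lemma proj_iota [simp]: "proj (iota w) = w"
  by (simp add: vec_eq_iff forall_3)

lemma proj_v [simp]: "proj v1 = 0" "proj v2 = 0"
  by (simp_all add: vec_eq_iff forall_3 theta_eq omega_sq field_simps omega_mult omega_mult')

lemma iota_perp_v [simp]: "herm (iota w) v1 = 0" "herm (iota w) v2 = 0" "herm v1 (iota w) = 0" "herm v2 (iota w) = 0"
proof -
  show "herm v1 (iota w) = 0" "herm v2 (iota w) = 0" by (simp_all add: herm_iota hdot_def)
  thus "herm (iota w) v1 = 0" "herm (iota w) v2 = 0" using herm_eq_0_sym by blast+
qed

lemma iota_inj: "iota w = iota z \<longleftrightarrow> w = z"
  by (metis proj_iota)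

text \<open>Since \<open>v1\<close> and \<open>v2\<close> are null, the coefficient of each is read
  off by pairing with the other; the minus sign comes from
  \<open>herm v2 v1 = - theta\<close>.\<close>

lemma U_W_decomp: "x = iota (proj x) + (herm x v2 / theta) *s v1 + (- herm x v1 / theta) *s v2"
  unfolding div_theta
  by (simp add: vec_eq_iff forall_5 herm_eq theta_eq omega_sq kappa_def field_simps omega_mult omega_mult')

lemma hdot_lin: "hdot (w + z) u = hdot w u + hdot z u" "hdot (w - z) u = hdot w u - hdot z u"
  "hdot (c *s w) u = c * hdot w u" "hdot u (w + z) = hdot u w + hdot u z" "hdot u (w - z) = hdot u w - hdot u z"
  "hdot u (c *s w) = cnj c * hdot u w" "hdot 0 u = 0" "hdot u 0 = 0"
  by (simp_all add: hdot_def algebra_simps)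

text \<open>\<open>N\<close> on the complement and the identity on the plane. Written as the
  identity plus a correction, so that integrality becomes a condition on the correction.\<close>

definition W_ext :: "complex ^ 3 ^ 3 \<Rightarrow> complex ^ 5 ^ 5" where
  "W_ext N = mat 1 + iota_mat ** (N - mat 1) ** proj_mat"

lemma matrix_vector_mult_diff_rdistrib: "(A - B) *v x = A *v x - B *v (x :: 'a::comm_ring_1 ^ 'n)"
  by (simp add: matrix_vector_mult_def vec_eq_iff sum_subtractf left_diff_distrib)

lemma W_ext_apply: "W_ext N *v x = x + iota (N *v proj x - proj x)"
  unfolding W_ext_def iota_def proj_def
  by (simp add: matrix_vector_mult_add_rdistrib matrix_vector_mul_assoc[symmetric] matrix_vector_mult_diff_rdistrib)

lemma W_ext_iota: "W_ext N *v iota w = iota (N *v w)"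
  by (simp add: W_ext_apply iota_lin)

lemma W_ext_v [simp]: "W_ext N *v v1 = v1" "W_ext N *v v2 = v2"
  by (simp_all add: W_ext_apply iota_lin)

lemma proj_W_ext: "proj (W_ext N *v x) = N *v proj x"
  by (simp add: W_ext_apply proj_lin)

lemma W_ext_mult: "W_ext (N ** M) = W_ext N ** W_ext M"
proof (rule matrix_eq[THEN iffD2], rule allI)
  fix x
  have "W_ext N *v (W_ext M *v x) = W_ext M *v x + iota (N *v (M *v proj x) - M *v proj x)"
    by (subst W_ext_apply[of N]) (simp add: proj_W_ext)
  also have "\<dots> = x + iota (N *v (M *v proj x) - proj x)"
    by (simp add: W_ext_apply[of M] iota_lin)
  finally show "W_ext (N ** M) *v x = (W_ext N ** W_ext M) *v x"
    by (simp add: matrix_vector_mul_assoc[symmetric] W_ext_apply)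
qed

lemma W_ext_1: "W_ext (mat 1) = mat 1"
  by (rule matrix_eq[THEN iffD2]) (simp add: W_ext_apply iota_lin)

lemma W_ext_inj: "W_ext N = W_ext M \<Longrightarrow> N = M"
  by (metis W_ext_iota iota_inj matrix_eq)

lemma W_ext_matsI:
  assumes "\<And>w z. hdot (N *v w) (N *v z) = hdot w z"
    "\<And>x. x \<in> Lattice \<Longrightarrow> iota (N *v proj x - proj x) \<in> Lattice"
  shows "W_ext N \<in> Lattice_mats"
proof (rule mats_matI)
  fix x assume "x \<in> Lattice" thus "W_ext N *v x \<in> Lattice" unfolding W_ext_apply using assms(2) by auto
next
  fix x y
  have "herm (W_ext N *v x) (W_ext N *v y) = herm x y + hdot (N *v proj x) (N *v proj y) - hdot (proj x) (proj y)"
  proof -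
    have h: "herm (iota w) y = hdot w (proj y)" for w y
      using herm_iota[of y w] herm_cnj[of y "iota w"] by (simp add: hdot_def mult.commute)
    show ?thesis
      unfolding W_ext_apply by (simp add: herm_lin h herm_iota hdot_lin proj_lin)
  qed
  thus "herm (W_ext N *v x) (W_ext N *v y) = herm x y" by (simp add: assms)
qed

lemma mats_fix_v_W_ext:
  assumes "A \<in> Lattice_mats" "A *v v1 = v1" "A *v v2 = v2"
  obtains N where "A = W_ext N"
proof -
  define N where "N = proj_mat ** A ** iota_mat"
  have N: "N *v w = proj (A *v iota w)" for w
    by (simp add: N_def proj_def iota_def matrix_vector_mul_assoc matrix_mul_assoc)
  have Ai: "A *v iota w = iota (N *v w)" for w
  proof -
    have "herm (A *v iota w) v1 = 0" "herm (A *v iota w) v2 = 0"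
      using mats_herm[OF assms(1), of "iota w"] assms(2,3) iota_perp_v by metis+
    thus ?thesis using U_W_decomp[of "A *v iota w"] by (simp add: N)
  qed
  have "A *v x = W_ext N *v x" for x
    by (subst (1 2) U_W_decomp[of x])
      (simp add: matrix_vector_right_distrib matrix_vector_mult_diff_distrib vec.scale assms Ai W_ext_iota)
  thus ?thesis using that matrix_eq by blast
qed

section \<open>The group G(3,3,3) as the group of automorphisms fixing the plane\<close>

definition diag3 :: "(3 \<Rightarrow> complex) \<Rightarrow> complex ^ 3 ^ 3" where
  "diag3 d = (\<chi> i j. if i = j then d j else 0)"

lemma diag3_apply: "(diag3 d *v w) $ i = d i * w $ i"
proof -
  have "(\<Sum>j\<in>UNIV. (if i = j then d j else 0) * w $ j) = (\<Sum>j\<in>UNIV. if i = j then d j * w $ j else 0)"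
    by (intro sum.cong) auto
  thus ?thesis by (simp add: diag3_def matrix_vector_mult_def)
qed

lemma perm_matrix_apply:
  assumes "bij p" shows "(perm_matrix p *v w) $ (p i) = w $ i"
proof -
  have "(\<Sum>j\<in>UNIV. (if p i = p j then 1 else 0) * w $ j) = (\<Sum>j\<in>UNIV. if i = j then w $ j else 0)"
    by (intro sum.cong) (use bij_is_inj[OF assms] in \<open>auto dest: injD\<close>)
  thus ?thesis by (simp add: perm_matrix_def matrix_vector_mult_def)
qed

lemma hdot_sum: "hdot w z = (\<Sum>i\<in>UNIV. w $ i * cnj (z $ i))"
  by (simp add: hdot_def sum_3)

lemma sum_perm3:
  fixes p :: "3 \<Rightarrow> 3" shows "bij p \<Longrightarrow> (\<Sum>i\<in>UNIV. f (p i)) = (\<Sum>i\<in>UNIV. f i)"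
  by (rule sum.reindex_bij_betw)

lemma iota_LatticeI:
  assumes "\<And>i. w $ i \<in> eisenstein" "kappa * (\<Sum>i\<in>UNIV. w $ i) \<in> eisenstein"
  shows "iota w \<in> Lattice"
  using assms by (simp add: Lattice_iff5 sum_3)

text \<open>The projection of the lattice is the dual of \<open>W\<close>: integral vectors shifted
  by Eisenstein multiples of (1,1,1)/theta, since (omega - 1)/3 is a unit times 1/theta.\<close>

lemma Lattice_proj:
  assumes "x \<in> Lattice"
  obtains c y where "c \<in> eisenstein" "\<And>i. y i \<in> eisenstein" "\<And>i. proj x $ i = y i + c * (omega - 1) / 3"
proof
  show "x $ 1 - x $ 5 \<in> eisenstein" using LatticeD[OF assms] by auto
  show "(\<lambda>i::3. if i = 1 then x$2 else if i = 2 then x$3 else x$4) i \<in> eisenstein" for i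
    using LatticeD[OF assms] by auto
  show "proj x $ i = (\<lambda>i::3. if i = 1 then x$2 else if i = 2 then x$3 else x$4) i
      + (x $ 1 - x $ 5) * (omega - 1) / 3" for i
    using exhaust_3[of i] by auto
qed

lemma W_ext_perm:
  assumes p: "bij p" shows "W_ext (perm_matrix p) \<in> Lattice_mats"
proof (rule W_ext_matsI)
  note pm = perm_matrix_apply[OF p]
  show "hdot (perm_matrix p *v w) (perm_matrix p *v z) = hdot w z" for w z
    unfolding hdot_sum by (subst sum_perm3[OF p, symmetric]) (simp add: pm)
  fix x assume "x \<in> Lattice"
  then obtain c y where y: "\<And>i. y i \<in> eisenstein" "\<And>i. proj x $ i = y i + c * (omega - 1) / 3"
    using Lattice_proj by metis
  show "iota (perm_matrix p *v proj x - proj x) \<in> Lattice"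
  proof (rule iota_LatticeI)
    fix i
    have "(perm_matrix p *v proj x - proj x) $ i = y (inv_into UNIV p i) - y i"
      using pm[of "proj x" "inv_into UNIV p i"] p by (simp add: surj_f_inv_f bij_is_surj y(2))
    thus "(perm_matrix p *v proj x - proj x) $ i \<in> eisenstein" using y(1) by auto
  next
    have "(\<Sum>i\<in>UNIV. (perm_matrix p *v proj x) $ i) = (\<Sum>i\<in>UNIV. proj x $ i)"
      by (subst sum_perm3[OF p, symmetric]) (simp add: pm)
    thus "kappa * (\<Sum>i\<in>UNIV. (perm_matrix p *v proj x - proj x) $ i) \<in> eisenstein"
      by (simp add: sum_subtractf)
  qed
qed

lemma kappa_1_omega: "kappa * (omega - 1) = -1"
  by (simp add: kappa_def field_simps omega_mult omega_mult')

lemma diag_omega_eq: "diag_omega = diag3 (\<lambda>i. if i = 1 then 1 else if i = 2 then omega else omega\<^sup>2)"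
  by (simp add: diag_omega_def diag3_def vec_eq_iff forall_3)

lemma W_ext_diag_omega: "W_ext diag_omega \<in> Lattice_mats"
proof (rule W_ext_matsI)
  have dm: "(diag_omega *v w) $ 1 = w $ 1" "(diag_omega *v w) $ 2 = omega * w $ 2"
    "(diag_omega *v w) $ 3 = omega\<^sup>2 * w $ 3" for w
    unfolding diag_omega_eq by (simp_all add: diag3_apply)
  show "hdot (diag_omega *v w) (diag_omega *v z) = hdot w z" for w z
    by (simp add: hdot_def dm omega_sq omega_simps)
  fix x assume "x \<in> Lattice"
  then obtain c y where y: "c \<in> eisenstein" "\<And>i. y i \<in> eisenstein" "\<And>i. proj x $ i = y i + c * (omega - 1) / 3"
    using Lattice_proj by metis
  have n: "(diag_omega *v proj x - proj x) $ 1 = 0"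
    "(diag_omega *v proj x - proj x) $ 2 = (omega - 1) * y 2 - omega * c"
    "(diag_omega *v proj x - proj x) $ 3 = (omega\<^sup>2 - 1) * y 3 + c"
    by (simp_all add: dm y(3) omega_sq field_simps omega_mult omega_mult' del: proj_nth)
  show "iota (diag_omega *v proj x - proj x) \<in> Lattice"
  proof (rule iota_LatticeI)
    show "(diag_omega *v proj x - proj x) $ i \<in> eisenstein" for i
      using exhaust_3[of i] n y by (auto simp del: vector_minus_component intro!: eis_add eis_diff eis_mult eis_power)
    have "kappa * (\<Sum>i\<in>UNIV. (diag_omega *v proj x - proj x) $ i)
        = kappa * (omega - 1) * (y 2 + (omega + 1) * y 3 - c)"
      unfolding sum_3 n by (simp add: algebra_simps power2_eq_square)
    also have "\<dots> \<in> eisenstein" unfolding kappa_1_omega using y by (auto intro!: eis_add eis_diff eis_mult)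
    finally show "kappa * (\<Sum>i\<in>UNIV. (diag_omega *v proj x - proj x) $ i) \<in> eisenstein" .
  qed
qed

lemma eis_div_3:
  assumes "(of_int a + of_int b * omega) / 3 \<in> eisenstein"
  shows "3 dvd a \<and> 3 dvd b"
proof -
  obtain m n where mn: "(of_int a + of_int b * omega) / 3 = of_int m + of_int n * omega"
    using assms by (elim eisensteinE)
  hence e: "of_int a + of_int b * omega = of_int (3 * m) + of_int (3 * n) * omega"
    by (simp add: field_simps)
  from arg_cong[OF e, of Im] have "real_of_int b = real_of_int (3 * n)" by simp
  hence b: "b = 3 * n" by (simp only: of_int_eq_iff)
  with e have "(of_int a :: complex) = of_int (3 * m)" by simp
  hence "a = 3 * m" by (simp only: of_int_eq_iff)
  with b show ?thesis by simp
qed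

definition dd :: "complex \<Rightarrow> complex \<Rightarrow> complex \<Rightarrow> complex ^ 3 ^ 3" where
  "dd a b c = diag3 (\<lambda>i. if i = 1 then a else if i = 2 then b else c)"

lemma dd_mult: "dd a b c ** dd a' b' c' = dd (a * a') (b * b') (c * c')"
  by (simp add: dd_def diag3_def vec_eq_iff forall_3 matrix_matrix_mult_def sum_3)

lemma dd_shift: "perm_matrix (\<lambda>i. i + 1) ** dd a b c ** perm_matrix (\<lambda>i. i - 1) = dd c a b"
  by (simp add: dd_def diag3_def perm_matrix_def vec_eq_iff forall_3 matrix_matrix_mult_def sum_3)

lemma bij_shift3: "bij (\<lambda>i::3. i + 1)" "bij (\<lambda>i::3. i - 1)"
  by (rule o_bij[of "\<lambda>i. i - 1"], auto simp: fun_eq_iff)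
     (rule o_bij[of "\<lambda>i. i + 1"], auto simp: fun_eq_iff)

definition G333_gens :: "(complex ^ 3 ^ 3) set" where
  "G333_gens = insert diag_omega {perm_matrix p | p. bij p}"

lemma carrier_G333_gen: "carrier G333 = generate GL3_eisenstein G333_gens"
  by (simp add: G333_def G333_gens_def)

lemma mult_G333: "A \<otimes>\<^bsub>G333\<^esub> B = A ** B"
  by (simp add: G333_def GL3_eisenstein_def)

lemma G333_mult: "A \<in> carrier G333 \<Longrightarrow> B \<in> carrier G333 \<Longrightarrow> A ** B \<in> carrier G333"
  unfolding carrier_G333_gen using generate.eng[of A GL3_eisenstein G333_gens B] by (simp add: GL3_eisenstein_def)

lemma G333_one: "mat 1 \<in> carrier G333"
  unfolding carrier_G333_gen using generate.one[of GL3_eisenstein G333_gens] by (simp add: GL3_eisenstein_def)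

lemma G333_perm: "bij p \<Longrightarrow> perm_matrix p \<in> carrier G333"
  unfolding carrier_G333_gen by (rule generate.incl) (auto simp: G333_gens_def)

text \<open>Three cube roots of unity have a sum divisible by 3 exactly if they are all equal or all
  distinct. These nine diagonal matrices arise from \<open>diag_omega\<close> by products and cyclic
  shifts.\<close>

lemma G333_dd:
  assumes "a \<in> {1, omega, omega\<^sup>2}" "b \<in> {1, omega, omega\<^sup>2}" "c \<in> {1, omega, omega\<^sup>2}" "(a + b + c) / 3 \<in> eisenstein"
  shows "dd a b c \<in> carrier G333"
proof -
  have w: "omega * omega = omega\<^sup>2" "omega * omega\<^sup>2 = 1" "omega\<^sup>2 * omega = 1" "omega\<^sup>2 * omega\<^sup>2 = omega" "omega ^ 4 = omega"
    by (simp_all add: omega_sq omega_simps power4_eq_xxxx)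
  have ww: "omega\<^sup>2 = of_int (-1) + of_int (-1) * omega" "omega = of_int 0 + of_int 1 * omega" "1 = of_int 1 + of_int 0 * omega"
    by (simp_all add: omega_sq)
  have sh: "dd z x y \<in> carrier G333" if "dd x y z \<in> carrier G333" for x y z
    using G333_mult[OF G333_mult[OF G333_perm[OF bij_shift3(1)] that] G333_perm[OF bij_shift3(2)]]
    unfolding dd_shift .
  have D: "dd 1 omega (omega\<^sup>2) \<in> carrier G333"
    unfolding carrier_G333_gen by (rule generate.incl) (simp add: G333_gens_def dd_def diag_omega_eq)
  have D': "dd 1 (omega\<^sup>2) omega \<in> carrier G333" using G333_mult[OF D D] by (simp add: dd_mult w)
  have O: "dd omega omega omega \<in> carrier G333" using G333_mult[OF D sh[OF D']] by (simp add: dd_mult w)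
  have O': "dd (omega\<^sup>2) (omega\<^sup>2) (omega\<^sup>2) \<in> carrier G333" using G333_mult[OF O O] by (simp add: dd_mult w)
  have I: "dd 1 1 1 \<in> carrier G333" using G333_mult[OF O O'] by (simp add: dd_mult w)
  note all = I O O' D D' sh[OF D] sh[OF D'] sh[OF sh[OF D]] sh[OF sh[OF D']]
  \<comment> \<open>Integer coordinates with respect to 1 and \<open>omega\<close>; the last branch
    stands for \<open>omega\<^sup>2\<close>.\<close>
  define v :: "complex \<Rightarrow> int \<times> int" where "v = (\<lambda>x. if x = 1 then (1, 0) else if x = omega then (0, 1) else (-1, -1))"
  have ne: "omega\<^sup>2 \<noteq> 1" "omega\<^sup>2 \<noteq> omega" by (simp_all add: omega_sq complex_eq_iff)
  have v: "x = of_int (fst (v x)) + of_int (snd (v x)) * omega" if "x \<in> {1, omega, omega\<^sup>2}" for x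
    using that ne by (auto simp: v_def omega_sq)
  have "a + b + c = of_int (fst (v a) + fst (v b) + fst (v c)) + of_int (snd (v a) + snd (v b) + snd (v c)) * omega"
    by (subst v[OF assms(1)], subst v[OF assms(2)], subst v[OF assms(3)]) (simp add: algebra_simps)
  hence "3 dvd fst (v a) + fst (v b) + fst (v c) \<and> 3 dvd snd (v a) + snd (v b) + snd (v c)"
    using assms(4) eis_div_3 by metis
  thus ?thesis using assms(1-3) all ne by (auto simp: v_def)
qed

lemma inv_GL3_eisenstein:
  assumes "\<And>i j. B $ i $ j \<in> eisenstein" "\<And>i j. A $ i $ j \<in> eisenstein" "A ** B = mat 1" "B ** A = mat 1"
  shows "inv\<^bsub>GL3_eisenstein\<^esub> A = B"
  unfolding m_inv_def
proof (rule the_equality)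
  show "B \<in> carrier GL3_eisenstein \<and> A \<otimes>\<^bsub>GL3_eisenstein\<^esub> B = \<one>\<^bsub>GL3_eisenstein\<^esub> \<and>
      B \<otimes>\<^bsub>GL3_eisenstein\<^esub> A = \<one>\<^bsub>GL3_eisenstein\<^esub>"
    using assms unfolding GL3_eisenstein_def by auto
  fix C assume "C \<in> carrier GL3_eisenstein \<and> A \<otimes>\<^bsub>GL3_eisenstein\<^esub> C = \<one>\<^bsub>GL3_eisenstein\<^esub> \<and>
      C \<otimes>\<^bsub>GL3_eisenstein\<^esub> A = \<one>\<^bsub>GL3_eisenstein\<^esub>"
  hence "A ** C = mat 1" by (simp add: GL3_eisenstein_def)
  thus "C = B" by (metis assms(4) matrix_mul_assoc matrix_mul_lid matrix_mul_rid)
qed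

lemma perm_matrix_mult: "perm_matrix p ** perm_matrix q = perm_matrix (p \<circ> q)"
proof -
  have "(\<Sum>k\<in>UNIV. (if i = p k then 1 else 0) * (if k = q j then 1 else 0)) = (if i = p (q j) then 1 else (0::complex))" for i j
  proof -
    have "(\<Sum>k\<in>UNIV. (if i = p k then 1 else 0) * (if k = q j then 1 else (0::complex)))
      = (\<Sum>k\<in>UNIV. if k = q j then (if i = p k then 1 else 0) else 0)" by (intro sum.cong) auto
    thus ?thesis by simp
  qed
  thus ?thesis by (simp add: perm_matrix_def vec_eq_iff matrix_matrix_mult_def)
qed

lemma perm_matrix_id: "perm_matrix id = mat 1"
  by (simp add: perm_matrix_def mat_def vec_eq_iff)

lemma W_ext_inverse:
  assumes "W_ext A \<in> Lattice_mats" "A ** B = mat 1"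
  shows "W_ext B \<in> Lattice_mats"
proof -
  obtain C where C: "C \<in> Lattice_mats" "C ** W_ext A = mat 1" using mats_inv[OF assms(1)] by metis
  have "W_ext A ** W_ext B = mat 1" using assms(2) by (metis W_ext_mult W_ext_1)
  hence "W_ext B = C" using C(2) by (metis matrix_mul_assoc matrix_mul_lid matrix_mul_rid)
  with C show ?thesis by simp
qed

lemma G333_gens_inv:
  assumes "A \<in> G333_gens"
  obtains "A ** inv\<^bsub>GL3_eisenstein\<^esub> A = mat 1"
proof -
  have "\<exists>B. (\<forall>i j. B $ i $ j \<in> eisenstein) \<and> (\<forall>i j. A $ i $ j \<in> eisenstein) \<and> A ** B = mat 1 \<and> B ** A = mat 1"
  proof (cases "A = diag_omega")
    case True
    hence A: "A = dd 1 omega (omega\<^sup>2)" by (simp add: dd_def diag_omega_eq)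
    have "dd 1 1 1 = mat 1" by (simp add: dd_def diag3_def mat_def vec_eq_iff)
    hence "A ** dd 1 (omega\<^sup>2) omega = mat 1" "dd 1 (omega\<^sup>2) omega ** A = mat 1"
      unfolding A dd_mult by (simp_all add: omega_sq omega_simps)
    moreover have "dd 1 (omega\<^sup>2) omega $ i $ j \<in> eisenstein" "A $ i $ j \<in> eisenstein" for i j
      by (auto simp: A dd_def diag3_def)
    ultimately show ?thesis by blast
  next
    case False
    then obtain p where p: "A = perm_matrix p" "bij p" using assms by (auto simp: G333_gens_def)
    have "A ** perm_matrix (inv_into UNIV p) = mat 1" "perm_matrix (inv_into UNIV p) ** A = mat 1"
      unfolding p(1) perm_matrix_mult using p(2) perm_matrix_id
      by (simp_all add: surj_iff[THEN iffD1] inj_iff[THEN iffD1] bij_is_surj bij_is_inj)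
    moreover have "perm_matrix q $ i $ j \<in> eisenstein" for q i j
      by (auto simp: perm_matrix_def)
    ultimately show ?thesis using p(1) by blast
  qed
  then obtain B where "\<And>i j. B $ i $ j \<in> eisenstein" "\<And>i j. A $ i $ j \<in> eisenstein"
    "A ** B = mat 1" "B ** A = mat 1" by blast
  with inv_GL3_eisenstein that show ?thesis by metis
qed

lemma G333_W_ext: "A \<in> carrier G333 \<Longrightarrow> W_ext A \<in> Lattice_mats"
proof -
  have gens: "W_ext h \<in> Lattice_mats" if "h \<in> G333_gens" for h
    using that W_ext_perm W_ext_diag_omega by (auto simp: G333_gens_def)
  assume "A \<in> carrier G333"
  hence "A \<in> generate GL3_eisenstein G333_gens" by (simp add: carrier_G333_gen)
  thus ?thesis
  proof (induction rule: generate.induct)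
    case one thus ?case by (simp add: GL3_eisenstein_def W_ext_1 mats_1)
  next
    case (incl h) thus ?case by (rule gens)
  next
    case (inv h) thus ?case using G333_gens_inv[OF inv] W_ext_inverse[OF gens[OF inv]] by blast
  next
    case (eng h1 h2) thus ?case by (simp add: GL3_eisenstein_def W_ext_mult mats_mult)
  qed
qed

lemma nat_sum_3_eq_1:
  assumes "(\<Sum>i\<in>(UNIV::3 set). f i) = (1::nat)"
  obtains i where "f i = 1" "\<And>j. j \<noteq> i \<Longrightarrow> f j = 0"
proof -
  have "f 1 + f 2 + f 3 = 1" using assms by (simp add: sum_3)
  hence "f 1 = 1 \<and> f 2 = 0 \<and> f 3 = 0 \<or> f 1 = 0 \<and> f 2 = 1 \<and> f 3 = 0 \<or> f 1 = 0 \<and> f 2 = 0 \<and> f 3 = 1" by presburger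
  thus ?thesis
  proof (elim disjE)
    assume h: "f 1 = 1 \<and> f 2 = 0 \<and> f 3 = 0"
    show ?thesis by (rule that[of 1]) (use h exhaust_3 in \<open>metis+\<close>)
  next
    assume h: "f 1 = 0 \<and> f 2 = 1 \<and> f 3 = 0"
    show ?thesis by (rule that[of 2]) (use h exhaust_3 in \<open>metis+\<close>)
  next
    assume h: "f 1 = 0 \<and> f 2 = 0 \<and> f 3 = 1"
    show ?thesis by (rule that[of 3]) (use h exhaust_3 in \<open>metis+\<close>)
  qed
qed

text \<open>The columns of \<open>N\<close> are Eisenstein vectors of length 1, so each has a single
  nonzero entry, a unit. Which units occur is then decided by integrality of the entries that carry
  \<open>kappa\<close>.\<close>

lemma W_ext_monomial:
  assumes "W_ext N \<in> Lattice_mats"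
  obtains p a b c where "bij p" "N = perm_matrix p ** dd a b c" "a \<in> {1, omega, omega\<^sup>2}"
    "b \<in> {1, omega, omega\<^sup>2}" "c \<in> {1, omega, omega\<^sup>2}" "(a + b + c) / 3 \<in> eisenstein"
proof -
  have unit: "hdot (N *v w) (N *v z) = hdot w z" for w z
    using mats_herm[OF assms, of "iota w" "iota z"] by (simp add: W_ext_iota herm_iota_iota)
  have diff: "iota (N *v proj x - proj x) \<in> Lattice" if "x \<in> Lattice" for x
    using mats_Lattice[OF assms that] that Lattice_diff[of "W_ext N *v x" x] by (simp add: W_ext_apply)
  have col: "(N *v axis j 1) $ i = N $ i $ j" for i j
    by (simp add: matrix_vector_mult_def axis_def if_distrib cong: if_cong)
  \<comment> \<open>The lattice vectors that project to the standard basis of the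
    complement.\<close>
  define e :: "3 \<Rightarrow> 5" where "e = (\<lambda>j. if j = 1 then 2 else if j = 2 then 3 else 4)"
  have pe: "proj (axis (e j) 1) = axis j 1" for j
    using exhaust_3[of j] by (auto simp: e_def vec_eq_iff forall_3 axis_nth)
  have ent: "N $ i $ j \<in> eisenstein" for i j
  proof -
    have L: "iota (N *v axis j 1 - axis j 1) \<in> Lattice" using diff[OF Lattice_axis, of "e j"] by (simp add: pe)
    have "(N *v axis j 1 - axis j 1) $ i \<in> eisenstein"
      using LatticeD[OF L, of 2] LatticeD[OF L, of 3] LatticeD[OF L, of 4] exhaust_3[of i] by auto
    hence "N $ i $ j - axis j 1 $ i \<in> eisenstein" by (simp add: col)
    moreover have "axis j 1 $ i \<in> eisenstein" by (auto simp: axis_nth)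
    ultimately show ?thesis using eis_add by force
  qed
  have csum: "kappa * ((\<Sum>i\<in>UNIV. N $ i $ j) - 1) \<in> eisenstein" for j
  proof -
    have "iota (N *v axis j 1 - axis j 1) \<in> Lattice" using diff[OF Lattice_axis, of "e j"] by (simp add: pe)
    from LatticeD[OF this, of 1]
    have "kappa * (\<Sum>i\<in>UNIV. (N *v axis j 1 - axis j 1) $ i) \<in> eisenstein" by (simp add: sum_3)
    moreover have "(\<Sum>i\<in>UNIV. axis j 1 $ i) = (1::complex)" by (simp add: axis_def)
    ultimately show ?thesis by (simp add: sum_subtractf col)
  qed
  have "\<exists>i. cmod (N $ i $ j) = 1 \<and> (\<forall>k. k \<noteq> i \<longrightarrow> N $ k $ j = 0)" for j
  proof -
    have "\<forall>i. \<exists>n::nat. (cmod (N $ i $ j))\<^sup>2 = real n" using ent eis_cmod_sq_int by metis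
    then obtain f :: "3 \<Rightarrow> nat" where f: "\<And>i. (cmod (N $ i $ j))\<^sup>2 = real (f i)" by metis
    have "hdot (N *v axis j 1) (N *v axis j 1) = 1"
      unfolding unit using exhaust_3[of j] by (auto simp: hdot_def axis_nth)
    hence "(\<Sum>i\<in>UNIV. N $ i $ j * cnj (N $ i $ j)) = 1" by (simp add: hdot_sum col)
    hence "(\<Sum>i\<in>UNIV. complex_of_real (real (f i))) = 1"
      by (simp only: complex_norm_square[symmetric] of_real_power[symmetric] f)
    hence "of_nat (\<Sum>i\<in>UNIV. f i) = (of_nat 1 :: complex)" by simp
    hence "(\<Sum>i\<in>UNIV. f i) = 1" by (simp only: of_nat_eq_iff)
    then obtain i where i: "f i = 1" "\<And>k. k \<noteq> i \<Longrightarrow> f k = 0" by (rule nat_sum_3_eq_1) blast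
    have "cmod (N $ i $ j) = 1" using f[of i] i(1) by (intro power2_eq_imp_eq[of _ 1]) auto
    moreover have "N $ k $ j = 0" if "k \<noteq> i" for k using f[of k] i(2)[OF that] by simp
    ultimately show ?thesis by blast
  qed
  hence "\<exists>p. \<forall>j. cmod (N $ p j $ j) = 1 \<and> (\<forall>k. k \<noteq> p j \<longrightarrow> N $ k $ j = 0)" by (intro choice allI)
  then obtain p where p: "\<And>j. cmod (N $ p j $ j) = 1" "\<And>j k. k \<noteq> p j \<Longrightarrow> N $ k $ j = 0" by blast
  define d where "d = (\<lambda>j. N $ p j $ j)"
  have cs: "(\<Sum>i\<in>UNIV. N $ i $ j) = d j" for j
  proof -
    have "(\<Sum>i\<in>UNIV. N $ i $ j) = (\<Sum>i\<in>UNIV. if i = p j then d j else 0)"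
      by (intro sum.cong) (auto simp: d_def p)
    thus ?thesis by simp
  qed
  have d3: "d j \<in> {1, omega, omega\<^sup>2}" for j
  proof -
    \<comment> \<open>As \<open>kappa\<close> is \<open>omega / theta\<close>, the unit must be 1
      modulo \<open>theta\<close>; this discards the negatives of the cube roots of unity.\<close>
    have k: "kappa * (d j - 1) \<in> eisenstein" using csum[of j] by (simp add: cs)
    have e1: "kappa * (-1 - 1) = (of_int (-4) + of_int (-2) * omega) / 3"
      and e2: "kappa * (- omega - 1) = (of_int (-1) + of_int (-2) * omega) / 3"
      and e3: "kappa * (- (omega\<^sup>2) - 1) = (of_int (-1) + of_int 1 * omega) / 3"
      by (simp_all add: kappa_def omega_sq field_simps omega_mult omega_mult')
    have "kappa * (-1 - 1) \<notin> eisenstein"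
      by (rule notI, drule eis_div_3[of "-4" "-2", folded e1], simp)
    moreover have "kappa * (- omega - 1) \<notin> eisenstein"
      by (rule notI, drule eis_div_3[of "-1" "-2", folded e2], simp)
    moreover have "kappa * (- (omega\<^sup>2) - 1) \<notin> eisenstein"
      by (rule notI, drule eis_div_3[of "-1" "1", folded e3], simp)
    ultimately have "d j \<noteq> -1" "d j \<noteq> -omega" "d j \<noteq> -(omega\<^sup>2)" using k by metis+
    thus ?thesis using eis_cmod_1[of "d j"] ent p by (auto simp: d_def)
  qed
  have inj: "inj p"
  proof (rule injI, rule ccontr)
    fix j k assume jk: "p j = p k" "j \<noteq> k"
    have "hdot (N *v axis j 1) (N *v axis k 1) = 0"
      by (subst unit, unfold hdot_sum, rule sum.neutral) (use jk(2) in \<open>auto simp: axis_nth\<close>)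
    hence "0 = (\<Sum>i\<in>UNIV. N $ i $ j * cnj (N $ i $ k))" by (simp add: hdot_sum col)
    also have "\<dots> = (\<Sum>i\<in>UNIV. if i = p j then d j * cnj (d k) else 0)"
      by (intro sum.cong) (auto simp: d_def p jk(1))
    finally have "d j * cnj (d k) = 0" by simp
    thus False using p(1)[of j] p(1)[of k] by (auto simp: d_def)
  qed
  hence bij: "bij p" using finite_UNIV_inj_surj[of p] by (simp add: bij_def)
  have N: "N = perm_matrix p ** dd (d 1) (d 2) (d 3)"
  proof -
    have dd: "dd (d 1) (d 2) (d 3) = diag3 d" unfolding dd_def diag3_def by (simp add: vec_eq_iff forall_3)
    have "(\<Sum>k\<in>UNIV. (if i = p k then 1 else 0) * (if k = j then d j else 0)) = N $ i $ j" for i j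
    proof -
      have "(\<Sum>k\<in>UNIV. (if i = p k then 1 else 0) * (if k = j then d j else 0))
        = (\<Sum>k\<in>UNIV. if k = j then (if i = p j then d j else 0) else 0)" by (intro sum.cong) auto
      thus ?thesis using p(2)[of i j] by (auto simp: d_def)
    qed
    thus ?thesis unfolding dd by (simp add: vec_eq_iff perm_matrix_def diag3_def matrix_matrix_mult_def)
  qed
  have "(d 1 + d 2 + d 3) / 3 \<in> eisenstein"
  proof -
    \<comment> \<open>The fifth basis vector projects to (q, q, q), a generator of the dual of
      \<open>W\<close> modulo integral vectors, and tests the sum of the three units.\<close>
    define q where "q = (1 - omega) / 3"
    have pa: "proj (axis 5 1) = (\<chi> i. q)" by (simp add: vec_eq_iff forall_3 axis_nth q_def field_simps)
    have "(N *v (\<chi> i. q)) $ i = q * (\<Sum>j\<in>UNIV. N $ i $ j)" for i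
      by (simp add: matrix_vector_mult_def sum_distrib_left mult.commute)
    hence "(\<Sum>i\<in>UNIV. (N *v (\<chi> i. q)) $ i) = q * (\<Sum>i\<in>UNIV. \<Sum>j\<in>UNIV. N $ i $ j)"
      by (simp only: sum_distrib_left[symmetric])
    also have "(\<Sum>i\<in>UNIV. \<Sum>j\<in>UNIV. N $ i $ j) = (\<Sum>j\<in>UNIV. \<Sum>i\<in>UNIV. N $ i $ j)"
      by (rule sum.swap)
    finally have s: "(\<Sum>i\<in>UNIV. (N *v (\<chi> i. q)) $ i) = q * (d 1 + d 2 + d 3)" by (simp add: cs sum_3)
    have "iota (N *v (\<chi> i. q) - (\<chi> i. q)) \<in> Lattice" using diff[OF Lattice_axis, of 5] by (simp only: pa)
    from LatticeD[OF this, of 1]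
    have "kappa * (\<Sum>i\<in>UNIV. (N *v (\<chi> i. q) - (\<chi> i. q)) $ i) \<in> eisenstein" by (simp add: sum_3)
    also have "(\<Sum>i\<in>UNIV. (N *v (\<chi> i. q) - (\<chi> i. q)) $ i) = q * (d 1 + d 2 + d 3 - 3)"
      by (simp add: sum_subtractf s algebra_simps)
    also have "kappa * (q * (d 1 + d 2 + d 3 - 3)) = - (kappa * (omega - 1)) * (d 1 + d 2 + d 3 - 3) / 3"
      by (simp add: q_def field_simps)
    also have "\<dots> = (d 1 + d 2 + d 3) / 3 - 1" unfolding kappa_1_omega by (simp add: field_simps)
    finally have "(d 1 + d 2 + d 3) / 3 - 1 + 1 \<in> eisenstein" by blast
    thus ?thesis by simp
  qed
  with bij N d3 that show ?thesis by metis
qed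

lemma carrier_G333: "carrier G333 = {N. W_ext N \<in> Lattice_mats}"
proof (intro equalityI subsetI)
  fix N assume "N \<in> {N. W_ext N \<in> Lattice_mats}"
  hence "W_ext N \<in> Lattice_mats" by simp
  then obtain p a b c where "bij p" "N = perm_matrix p ** dd a b c" "a \<in> {1, omega, omega\<^sup>2}"
    "b \<in> {1, omega, omega\<^sup>2}" "c \<in> {1, omega, omega\<^sup>2}" "(a + b + c) / 3 \<in> eisenstein"
    by (rule W_ext_monomial)
  thus "N \<in> carrier G333" using G333_mult G333_perm G333_dd by metis
qed (use G333_W_ext in blast)

text \<open>Finiteness is what excludes the elliptic points: an injection between finite sets of
  equal size is onto.\<close>

lemma finite_G333: "finite (carrier G333)"
proof -
  let ?S = "{1, omega, omega\<^sup>2}"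
  let ?f = "\<lambda>(p, a, b, c). perm_matrix p ** dd a b c"
  have "carrier G333 \<subseteq> ?f ` (UNIV \<times> ?S \<times> ?S \<times> ?S)"
  proof
    fix N assume "N \<in> carrier G333"
    hence "W_ext N \<in> Lattice_mats" by (simp add: carrier_G333)
    then obtain p a b c where N: "N = perm_matrix p ** dd a b c" "a \<in> ?S" "b \<in> ?S" "c \<in> ?S"
      by (rule W_ext_monomial)
    have "N = ?f (p, a, b, c)" using N(1) by simp
    moreover have "(p, a, b, c) \<in> UNIV \<times> ?S \<times> ?S \<times> ?S" using N(2-4) by blast
    ultimately show "N \<in> ?f ` (UNIV \<times> ?S \<times> ?S \<times> ?S)" by (rule image_eqI)
  qed
  moreover have "finite (UNIV \<times> ?S \<times> ?S \<times> ?S :: ((3 \<Rightarrow> 3) \<times> _) set)"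
    by (intro finite_cartesian_product finite) auto
  ultimately show ?thesis using finite_imageI finite_subset by blast
qed

section \<open>Short vectors orthogonal to a point of the curve\<close>

lemma hdot_self: "hdot w w = of_real ((cmod (w $ 1))\<^sup>2 + (cmod (w $ 2))\<^sup>2 + (cmod (w $ 3))\<^sup>2)"
  unfolding hdot_def of_real_add complex_norm_square ..

lemma hdot_self_nonneg: "hdot w w = of_int k \<Longrightarrow> k \<ge> 0"
proof -
  assume "hdot w w = of_int k"
  hence "complex_of_real ((cmod (w $ 1))\<^sup>2 + (cmod (w $ 2))\<^sup>2 + (cmod (w $ 3))\<^sup>2) = of_real (real_of_int k)"
    unfolding hdot_self by simp
  hence "(cmod (w $ 1))\<^sup>2 + (cmod (w $ 2))\<^sup>2 + (cmod (w $ 3))\<^sup>2 = real_of_int k" by (simp only: of_real_eq_iff)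
  hence "0 \<le> real_of_int k" by (metis add_nonneg_nonneg zero_le_power2)
  thus ?thesis by simp
qed

lemma hdot_self_eq_0: "hdot w w = 0 \<Longrightarrow> w = 0"
proof -
  assume "hdot w w = 0"
  hence "(cmod (w $ 1))\<^sup>2 + (cmod (w $ 2))\<^sup>2 + (cmod (w $ 3))\<^sup>2 = 0"
    unfolding hdot_self by (simp only: of_real_eq_0_iff)
  hence "w $ 1 = 0 \<and> w $ 2 = 0 \<and> w $ 3 = 0"
    using zero_le_power2[of "cmod (w $ 1)"] zero_le_power2[of "cmod (w $ 2)"] zero_le_power2[of "cmod (w $ 3)"]
    by (smt (verit) power2_less_eq_zero_iff zero_eq_power2 norm_eq_zero)
  thus ?thesis by (simp add: vec_eq_iff forall_3)
qed

text \<open>The integer \<open>n\<close> is the norm of the component of \<open>v\<close> in the plane.\<close>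

lemma perp_j0:
  assumes v: "v \<in> Lattice" and I: "Im \<tau> > 0" and perp: "herm (\<tau> *s v1 + v2) v = 0"
  obtains n where "hdot (proj v) (proj v) = herm v v - of_int n" "n \<ge> 0"
    "n = 0 \<longrightarrow> herm v v1 = 0 \<and> herm v v2 = 0" "n = 1 \<longrightarrow> sl2_eq omega \<tau>"
proof -
  define \<alpha> \<beta> where "\<alpha> = herm v v1" and "\<beta> = herm v v2"
  have E: "\<alpha> \<in> eisenstein" "\<beta> \<in> eisenstein" using v by (auto simp: \<alpha>_def \<beta>_def)
  obtain a1 a2 where a: "\<alpha> = of_int a1 + of_int a2 * omega" using E(1) by (elim eisensteinE)
  obtain b1 b2 where b: "\<beta> = of_int b1 + of_int b2 * omega" using E(2) by (elim eisensteinE)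
  define n where "n = a1 * b2 - a2 * b1"
  have n: "\<beta> * cnj \<alpha> - \<alpha> * cnj \<beta> = of_int n * theta"
    by (simp add: a b n_def theta_eq omega_simps)
  have "herm v v = hdot (proj v) (proj v) - (\<beta> * cnj \<alpha> - \<alpha> * cnj \<beta>) * theta / 3"
  proof -
    have "herm v v = herm (iota (proj v) + (\<beta> / theta) *s v1 + (- \<alpha> / theta) *s v2)
        (iota (proj v) + (\<beta> / theta) *s v1 + (- \<alpha> / theta) *s v2)"
      using U_W_decomp[of v] by (simp add: \<alpha>_def \<beta>_def)
    also have "\<dots> = hdot (proj v) (proj v) - (\<beta> * cnj \<alpha> - \<alpha> * cnj \<beta>) * theta / (- (theta * theta))"
      by (simp add: herm_lin herm_iota_iota field_simps)
    finally show ?thesis by (simp add: theta_sq)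
  qed
  hence norm: "hdot (proj v) (proj v) = herm v v - of_int n"
    unfolding n by (simp add: mult.assoc theta_sq)
  have eq: "cnj \<beta> = - \<tau> * cnj \<alpha>"
    using perp herm_cnj[of v v1] herm_cnj[of v v2] by (simp add: herm_lin \<alpha>_def \<beta>_def add_eq_0_iff)
  have "\<alpha> * cnj \<beta> = - \<tau> * of_real ((cmod \<alpha>)\<^sup>2)" unfolding eq complex_norm_square by simp
  hence Im1: "Im (\<alpha> * cnj \<beta>) = - (cmod \<alpha>)\<^sup>2 * Im \<tau>" by (simp del: of_real_power)
  have "Im (\<beta> * cnj \<alpha>) = - Im (\<alpha> * cnj \<beta>)" by (simp add: algebra_simps)
  hence "Im (\<beta> * cnj \<alpha> - \<alpha> * cnj \<beta>) = 2 * ((cmod \<alpha>)\<^sup>2 * Im \<tau>)" using Im1 by (simp add: algebra_simps)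
  hence n2: "real_of_int n * sqrt 3 = 2 * ((cmod \<alpha>)\<^sup>2 * Im \<tau>)" unfolding n by (simp add: theta_eq)
  have n0: "n \<ge> 0"
  proof -
    have "0 \<le> real_of_int n * sqrt 3" unfolding n2 using I by simp
    thus ?thesis by (simp add: zero_le_mult_iff)
  qed
  have z: "herm v v1 = 0 \<and> herm v v2 = 0" if "n = 0"
  proof -
    have "(cmod \<alpha>)\<^sup>2 * Im \<tau> = 0" using n2 that by simp
    hence "\<alpha> = 0" using I by simp
    thus ?thesis using eq by (simp add: \<alpha>_def \<beta>_def)
  qed
  have s: "sl2_eq omega \<tau>" if "n = 1"
  proof -
    have "\<alpha> \<noteq> 0" using n2 that by auto
    \<comment> \<open>Orthogonality exhibits \<tau> as a ratio of Eisenstein integers, hence as an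
      integral Moebius image of \<open>omega\<close>, and the determinant of that matrix is
      n.\<close>
    hence "\<tau> = - cnj \<beta> / cnj \<alpha>" using eq by simp
    also have "\<dots> = (of_int b2 * omega + of_int (b2 - b1)) / (of_int (- a2) * omega + of_int (a1 - a2))"
      by (simp add: a b algebra_simps)
    finally have \<tau>: "\<tau> = (of_int b2 * omega + of_int (b2 - b1)) / (of_int (- a2) * omega + of_int (a1 - a2))" .
    have "b2 * (a1 - a2) - (b2 - b1) * (- a2) = 1" using that by (simp add: n_def algebra_simps)
    with \<tau> show ?thesis unfolding sl2_eq_def by blast
  qed
  show ?thesis using that[OF norm n0] z s by blast
qed

lemma U_coeffs_eis:
  assumes "a *s v1 + b *s v2 \<in> Lattice"
  shows "a \<in> eisenstein" "b \<in> eisenstein"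
proof -
  show "b \<in> eisenstein" using LatticeD[OF assms, of 5] by simp
  have "omega * (a * omega\<^sup>2) \<in> eisenstein" using LatticeD[OF assms, of 2] by (auto intro!: eis_mult)
  also have "omega * (a * omega\<^sup>2) = a" by (simp add: omega_sq omega_simps)
  finally show "a \<in> eisenstein" .
qed

lemma proj_0_decomp: "proj v = 0 \<Longrightarrow> v = (herm v v2 / theta) *s v1 + (- herm v v1 / theta) *s v2"
  using U_W_decomp[of v] by (simp add: iota_lin)

text \<open>In the plane a norm is \<open>theta\<close> times the difference of an Eisenstein
  integer and its conjugate, and such a difference is again an integer multiple of
  \<open>theta\<close>.\<close>

lemma proj_0_norm:
  assumes "v \<in> Lattice" "proj v = 0"
  obtains k where "herm v v = of_int (3 * k)"
proof -
  obtain a b where ab: "v = a *s v1 + b *s v2" using proj_0_decomp[OF assms(2)] by blast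
  have "a * cnj b \<in> eisenstein" using U_coeffs_eis assms(1) ab by (auto intro!: eis_mult)
  then obtain m k where mk: "a * cnj b = of_int m + of_int k * omega" by (elim eisensteinE)
  have "herm v v = (a * cnj b - cnj (a * cnj b)) * theta"
    unfolding ab by (simp add: herm_lin algebra_simps)
  also have "\<dots> = of_int (3 * (- k))"
    unfolding mk by (simp add: theta_eq omega_simps)
  finally show ?thesis using that by blast
qed

lemma cmod_kappa: "cmod kappa < 1"
proof -
  have "cmod kappa = cmod (2 + omega) / 3" by (simp add: kappa_def norm_divide)
  moreover have "cmod (2 + omega) < 3"
  proof (rule power2_less_imp_less)
    have "(cmod (2 + omega))\<^sup>2 = 3" by (simp add: cmod_power2 power_divide)
    thus "(cmod (2 + omega))\<^sup>2 < 3\<^sup>2" by (simp only:) simp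
  qed simp
  ultimately show ?thesis by simp
qed

text \<open>Such a vector would have a single unit among its three coordinates, and its first
  lattice coordinate, \<open>kappa\<close> times that unit, would be a nonzero Eisenstein integer of
  modulus below 1.\<close>

lemma iota_norm_ne_1:
  assumes "iota w \<in> Lattice" shows "hdot w w \<noteq> 1"
proof
  assume h: "hdot w w = 1"
  have E: "w $ i \<in> eisenstein" for i
    using LatticeD[OF assms, of 2] LatticeD[OF assms, of 3] LatticeD[OF assms, of 4] exhaust_3[of i] by auto
  have "\<forall>i. \<exists>n::nat. (cmod (w $ i))\<^sup>2 = real n" using E eis_cmod_sq_int by metis
  then obtain f :: "3 \<Rightarrow> nat" where f: "\<And>i. (cmod (w $ i))\<^sup>2 = real (f i)" by metis
  have "complex_of_real (real (\<Sum>i\<in>UNIV. f i)) = 1" using h unfolding hdot_self f sum_3 by simp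
  hence "(\<Sum>i\<in>UNIV. f i) = 1" by (metis of_nat_eq_1_iff of_real_of_nat_eq)
  then obtain i where i: "f i = 1" "\<And>k. k \<noteq> i \<Longrightarrow> f k = 0" by (rule nat_sum_3_eq_1) blast
  have "w $ k = 0" if "k \<noteq> i" for k using f[of k] i(2)[OF that] by simp
  hence "(\<Sum>k\<in>UNIV. w $ k) = (\<Sum>k\<in>UNIV. if k = i then w $ i else 0)" by (intro sum.cong) auto
  also have "\<dots> = w $ i" by simp
  finally have "w $ 1 + w $ 2 + w $ 3 = w $ i" unfolding sum_3 .
  hence k: "kappa * w $ i \<in> eisenstein" using LatticeD[OF assms, of 1] by simp
  have c1: "cmod (w $ i) = 1" using f[of i] i(1) by (intro power2_eq_imp_eq[of _ 1]) auto
  hence "cmod (kappa * w $ i) < 1" using cmod_kappa by (simp add: norm_mult)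
  hence "kappa * w $ i = 0" using k eis_cmod_lt_1 by blast
  moreover have "kappa \<noteq> 0" using kappa_theta by auto
  ultimately show False using c1 by auto
qed

text \<open>The norm splits as (1 - n) + n with both parts nonnegative. For n = 0 the vector lies in
  \<open>W\<close>, which has no norm 1; for n = 1 it lies in the plane, where norms are divisible
  by 3.\<close>

lemma perp_j0_norm_1:
  assumes "v \<in> Lattice" "Im \<tau> > 0" "herm (\<tau> *s v1 + v2) v = 0"
  shows "herm v v \<noteq> 1"
proof
  assume h: "herm v v = 1"
  obtain n where n: "hdot (proj v) (proj v) = herm v v - of_int n" "n \<ge> 0"
    "n = 0 \<longrightarrow> herm v v1 = 0 \<and> herm v v2 = 0" by (rule perp_j0[OF assms])
  have "hdot (proj v) (proj v) = of_int (1 - n)" using n(1) h by simp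
  hence "n \<le> 1" using hdot_self_nonneg by fastforce
  with n(2) consider "n = 0" | "n = 1" by linarith
  thus False
  proof cases
    case 1
    hence "v = iota (proj v)" using n(3) U_W_decomp[of v] by simp
    thus False using iota_norm_ne_1[of "proj v"] assms(1) n(1) 1 h by simp
  next
    case 2
    hence "proj v = 0" using n(1) h hdot_self_eq_0 by simp
    then obtain k where "herm v v = of_int (3 * k)" using proj_0_norm assms(1) by blast
    hence "(of_int (3 * k) :: complex) = of_int 1" using h by simp
    hence "3 * k = 1" by (simp only: of_int_eq_iff)
    thus False by presburger
  qed
qed

text \<open>The same splitting 2 = (2 - n) + n: n = 2 contradicts divisibility by 3 in the plane,
  and n = 1 puts \<tau> in the orbit of \<open>omega\<close>.\<close>

lemma perp_j0_norm_2:
  assumes "v \<in> Lattice" "Im \<tau> > 0" "herm (\<tau> *s v1 + v2) v = 0" "herm v v = 2" "\<not> sl2_eq omega \<tau>"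
  shows "herm v v1 = 0 \<and> herm v v2 = 0"
proof -
  obtain n where n: "hdot (proj v) (proj v) = herm v v - of_int n" "n \<ge> 0"
    "n = 0 \<longrightarrow> herm v v1 = 0 \<and> herm v v2 = 0" "n = 1 \<longrightarrow> sl2_eq omega \<tau>" by (rule perp_j0[OF assms(1-3)])
  have "hdot (proj v) (proj v) = of_int (2 - n)" using n(1) assms(4) by simp
  hence "n \<le> 2" using hdot_self_nonneg by fastforce
  moreover have "n \<noteq> 2"
  proof
    assume "n = 2"
    hence "proj v = 0" using n(1) assms(4) hdot_self_eq_0 by simp
    then obtain k where "herm v v = of_int (3 * k)" using proj_0_norm assms(1) by blast
    hence "(of_int (3 * k) :: complex) = of_int 2" using assms(4) by simp
    hence "3 * k = 2" by (simp only: of_int_eq_iff)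
    thus False by presburger
  qed
  moreover have "n \<noteq> 1" using n(4) assms(5) by blast
  ultimately have "n = 0" using n(2) by linarith
  thus ?thesis using n(3) by blast
qed

lemma j0_ch4': "Im \<tau> > 0 \<Longrightarrow> j0 \<tau> \<in> ch4'"
  unfolding ch4'_def using j0_ch4 perp_j0_norm_1 j0_mem by blast

section \<open>Automorphisms between points of the curve\<close>

text \<open>The hypotheses force the matrix to equal its determinant times its complex conjugate, so up to a unit
  its entries are all real or all imaginary; the latter would make the determinant divisible by 3.\<close>

lemma unitary_plane:
  assumes E: "\<alpha> \<in> eisenstein" "\<beta> \<in> eisenstein" "\<gamma> \<in> eisenstein" "\<delta> \<in> eisenstein"
    and h: "\<alpha> * cnj \<gamma> = \<gamma> * cnj \<alpha>" "\<beta> * cnj \<delta> = \<delta> * cnj \<beta>" "\<alpha> * cnj \<delta> - \<gamma> * cnj \<beta> = 1"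
  obtains z a b c d where "z \<in> Eunits" "a * d - b * c = (1::int)" "\<alpha> = z * of_int a" "\<beta> = z * of_int b"
    "\<gamma> = z * of_int c" "\<delta> = z * of_int d"
proof -
  define u where "u = \<alpha> * \<delta> - \<beta> * \<gamma>"
  have h3: "cnj \<alpha> * \<delta> - cnj \<gamma> * \<beta> = 1" using arg_cong[OF h(3), of cnj] by simp
  \<comment> \<open>Unitarity expresses the inverse matrix through conjugates, Cramer's rule through
    the determinant \<open>u\<close>; comparing the two gives these equations.\<close>
  have cj: "\<alpha> = u * cnj \<alpha>" "\<beta> = u * cnj \<beta>" "\<gamma> = u * cnj \<gamma>" "\<delta> = u * cnj \<delta>"
    unfolding u_def using h h3 by algebra+
  have "\<alpha> \<noteq> 0 \<or> \<gamma> \<noteq> 0" using h(3) by auto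
  hence "cmod u = 1"
    using arg_cong[OF cj(1), of cmod] arg_cong[OF cj(3), of cmod] by (auto simp: norm_mult)
  moreover have uE: "u \<in> eisenstein" unfolding u_def using E by auto
  ultimately have "u \<in> Eunits" by (simp add: Eunits_def)
  then obtain z s where zU: "z \<in> Eunits" and zs: "s = 1 \<or> s = -1" "u = s * z\<^sup>2" by (rule eis_unit_square)
  have zz: "cnj z * z = 1" using Eunits_cnj_mult[OF zU] .
  \<comment> \<open>After division by the root \<open>z\<close>, the relation
    \<open>x = u * cnj x\<close> says that conjugation acts by the sign \<open>s\<close>.\<close>
  have conj: "cnj (cnj z * x) = s * (cnj z * x)" if "x = u * cnj x" for x
  proof -
    have "s * (cnj z * x) = s * (cnj z * (s * z\<^sup>2 * cnj x))" using that zs(2) by metis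
    also have "\<dots> = s * s * (cnj z * z) * (z * cnj x)" by (simp add: power2_eq_square)
    also have "\<dots> = z * cnj x" using zz zs(1) by auto
    finally show ?thesis by simp
  qed
  have zback: "x = z * (cnj z * x)" for x using zz by (metis mult.assoc mult.commute mult_1)
  have E': "cnj z * x \<in> eisenstein" if "x \<in> eisenstein" for x
    using zU that by (auto simp: Eunits_def intro!: eis_mult)
  have det: "(cnj z * \<alpha>) * (cnj z * \<delta>) - (cnj z * \<beta>) * (cnj z * \<gamma>) = s"
  proof -
    have "(cnj z * \<alpha>) * (cnj z * \<delta>) - (cnj z * \<beta>) * (cnj z * \<gamma>) = cnj z * cnj z * u"
      by (simp add: u_def algebra_simps)
    also have "\<dots> = s * ((cnj z * z) * (cnj z * z))" unfolding zs(2) by (simp add: power2_eq_square)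
    finally show ?thesis unfolding zz by simp
  qed
  show ?thesis
  proof (cases "s = 1")
    case True
    have "\<exists>n. cnj z * x = of_int n" if "x = u * cnj x" "x \<in> eisenstein" for x
    proof -
      have "Im (cnj z * x) = 0" using arg_cong[OF conj[OF that(1)], of Im] True by simp
      thus ?thesis using eis_real[OF E'[OF that(2)]] by metis
    qed
    then obtain a b c d where abcd: "cnj z * \<alpha> = of_int a" "cnj z * \<beta> = of_int b" "cnj z * \<gamma> = of_int c" "cnj z * \<delta> = of_int d"
      using cj E by metis
    have "(of_int (a * d - b * c) :: complex) = of_int 1" using det True unfolding abcd by simp
    hence "a * d - b * c = 1" by (simp only: of_int_eq_iff)
    moreover have "\<alpha> = z * of_int a" "\<beta> = z * of_int b" "\<gamma> = z * of_int c" "\<delta> = z * of_int d"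
      using zback abcd by metis+
    ultimately show ?thesis using that zU by blast
  next
    case False
    hence s: "s = -1" using zs(1) by simp
    have "\<exists>n. cnj z * x = of_int n * theta" if "x = u * cnj x" "x \<in> eisenstein" for x
    proof -
      have "Re w = 0" if "cnj w = - w" for w using that by (simp add: complex_eq_iff)
      from this[of "cnj z * x"] have "Re (cnj z * x) = 0" using conj[OF that(1)] s by simp
      thus ?thesis using eis_imaginary[OF E'[OF that(2)]] by metis
    qed
    then obtain a b c d where abcd: "cnj z * \<alpha> = of_int a * theta" "cnj z * \<beta> = of_int b * theta"
      "cnj z * \<gamma> = of_int c * theta" "cnj z * \<delta> = of_int d * theta"
      using cj E by metis
    have "(of_int a * of_int d - of_int b * of_int c) * (theta * theta) = -1"
      using det s unfolding abcd by (simp add: algebra_simps)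
    hence "(of_int (3 * (a * d - b * c)) :: complex) = of_int 1" unfolding theta_sq by (simp add: algebra_simps)
    hence "3 * (a * d - b * c) = 1" by (simp only: of_int_eq_iff)
    thus ?thesis by presburger
  qed
qed

text \<open>\<open>A\<close> sends the norm 2 vectors of \<open>W\<close> to norm 2 vectors
  orthogonal to \<open>j0 \<tau>'\<close>, which lie in \<open>W\<close> again. As they span the
  complement of the plane, the inverse \<open>B\<close> preserves the plane, and
  \<open>unitary_plane\<close> makes it integral there up to a unit.\<close>

lemma j0_morphism:
  assumes A: "A \<in> Lattice_mats" "(*v) A ` j0 \<tau> = j0 \<tau>'" and I: "Im \<tau> > 0" "Im \<tau>' > 0"
    and nw: "\<not> sl2_eq omega \<tau>'"
  obtains B z a b c d where "B \<in> Lattice_mats" "A ** B = mat 1" "B ** A = mat 1" "z \<in> Eunits" "a * d - b * c = (1::int)"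
    "B *v v1 = z *s (of_int a *s v1 + of_int c *s v2)" "B *v v2 = z *s (of_int b *s v1 + of_int d *s v2)"
    "\<tau> = (of_int a * \<tau>' + of_int b) / (of_int c * \<tau>' + of_int d)"
proof -
  obtain B where B: "B \<in> Lattice_mats" "A ** B = mat 1" "B ** A = mat 1" using mats_inv[OF A(1)] .
  have AB: "A *v (B *v x) = x" for x by (simp add: matrix_vector_mul_assoc B)
  have "\<tau>' *s v1 + v2 \<in> (*v) A ` j0 \<tau>" unfolding A(2) by (rule j0_mem)
  then obtain y where y: "y \<in> j0 \<tau>" "\<tau>' *s v1 + v2 = A *v y" by blast
  obtain c where "y = c *s (\<tau> *s v1 + v2)" using y(1) unfolding j0_def span_singleton by blast
  with y(2) have c: "\<tau>' *s v1 + v2 = c *s (A *v (\<tau> *s v1 + v2))" by (simp only: vec.scale)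
  have pB: "proj (B *v x) = 0" if x: "x = v1 \<or> x = v2" for x
  proof -
    have root: "hdot w (proj (B *v x)) = 0" if w: "iota w \<in> Lattice" "hdot w w = 2" for w
    proof -
      have "herm (\<tau>' *s v1 + v2) (A *v iota w) = 0"
        unfolding c herm_scale_left mats_herm[OF A(1)] by (simp add: herm_lin)
      moreover have "herm (A *v iota w) (A *v iota w) = 2"
        using w(2) by (simp add: mats_herm[OF A(1)] herm_iota_iota)
      ultimately have "herm (A *v iota w) x = 0"
        using perp_j0_norm_2[OF mats_Lattice[OF A(1) w(1)] I(2)] nw x by blast
      hence "herm (iota w) (B *v x) = 0" using mats_herm[OF A(1), of "iota w" "B *v x"] by (simp add: AB)
      hence "hdot (proj (B *v x)) w = 0" using herm_eq_0_sym herm_iota by metis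
      thus ?thesis by (metis herm_iota_iota herm_eq_0_sym)
    qed
    define q where "q = proj (B *v x)"
    \<comment> \<open>Three norm 2 vectors of \<open>W\<close> that form a basis of the
      three-dimensional space.\<close>
    have "hdot (vector [1, -1, 0]) q = 0" "hdot (vector [0, 1, -1]) q = 0" "hdot (vector [1, - omega, 0]) q = 0"
      unfolding q_def by (rule root; simp add: Lattice_iff5 hdot_def kappa_def omega_simps)+
    hence "cnj (q $ 1) = cnj (q $ 2)" "cnj (q $ 2) = cnj (q $ 3)" "cnj (q $ 1) = omega * cnj (q $ 2)"
      by (simp_all add: hdot_def)
    moreover from this have "(1 - omega) * cnj (q $ 2) = 0" by (simp add: algebra_simps)
    ultimately show ?thesis unfolding q_def[symmetric] by (auto simp: vec_eq_iff forall_3)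
  qed
  have BL: "B *v v1 \<in> Lattice" "B *v v2 \<in> Lattice" using mats_Lattice[OF B(1)] by auto
  obtain \<alpha> \<gamma> where 1: "B *v v1 = \<alpha> *s v1 + \<gamma> *s v2" using proj_0_decomp pB by metis
  obtain \<beta> \<delta> where 2: "B *v v2 = \<beta> *s v1 + \<delta> *s v2" using proj_0_decomp pB by metis
  have E: "\<alpha> \<in> eisenstein" "\<beta> \<in> eisenstein" "\<gamma> \<in> eisenstein" "\<delta> \<in> eisenstein"
    using U_coeffs_eis BL unfolding 1 2 by blast+
  have h: "(\<alpha> * cnj \<gamma> - \<gamma> * cnj \<alpha>) * theta = 0" "(\<beta> * cnj \<delta> - \<delta> * cnj \<beta>) * theta = 0"
    "(\<alpha> * cnj \<delta> - \<gamma> * cnj \<beta>) * theta = theta"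
    using mats_herm[OF B(1), of v1 v1] mats_herm[OF B(1), of v2 v2] mats_herm[OF B(1), of v1 v2]
    unfolding 1 2 by (simp_all add: herm_lin algebra_simps)
  hence h': "\<alpha> * cnj \<gamma> = \<gamma> * cnj \<alpha>" "\<beta> * cnj \<delta> = \<delta> * cnj \<beta>" "\<alpha> * cnj \<delta> - \<gamma> * cnj \<beta> = 1" by auto
  obtain z a b c' d where z: "z \<in> Eunits" "a * d - b * c' = (1::int)" "\<alpha> = z * of_int a" "\<beta> = z * of_int b"
    "\<gamma> = z * of_int c'" "\<delta> = z * of_int d" by (rule unitary_plane[OF E h'])
  have B1: "B *v v1 = z *s (of_int a *s v1 + of_int c' *s v2)" "B *v v2 = z *s (of_int b *s v1 + of_int d *s v2)"
    unfolding 1 2 z by (simp_all add: vec_eq_iff algebra_simps)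
  have "B *v (\<tau>' *s v1 + v2) = c *s (B *v (A *v (\<tau> *s v1 + v2)))" unfolding c by (simp add: vec.scale)
  also have "\<dots> = (c * \<tau>) *s v1 + c *s v2"
    by (simp add: matrix_vector_mul_assoc B vec_eq_iff algebra_simps)
  also have "B *v (\<tau>' *s v1 + v2) = (z * (of_int a * \<tau>' + of_int b)) *s v1 + (z * (of_int c' * \<tau>' + of_int d)) *s v2"
    by (simp add: matrix_vector_right_distrib vec.scale B1 vec_eq_iff algebra_simps)
  finally have "z * (of_int a * \<tau>' + of_int b) = c * \<tau>" "z * (of_int c' * \<tau>' + of_int d) = c"
    using v1_v2_independent by blast+
  hence "z * (of_int a * \<tau>' + of_int b) = z * ((of_int c' * \<tau>' + of_int d) * \<tau>)" by (metis mult.assoc)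
  moreover have "z \<noteq> 0" using z(1) by (auto simp: Eunits_def)
  ultimately have "of_int a * \<tau>' + of_int b = (of_int c' * \<tau>' + of_int d) * \<tau>" by simp
  hence "\<tau> = (of_int a * \<tau>' + of_int b) / (of_int c' * \<tau>' + of_int d)"
    using moebius_denom_nz[OF I(2) z(2)] by (simp add: field_simps)
  thus ?thesis using that B z(1,2) B1 by blast
qed

section \<open>Stabilizers\<close>

lemma mult_PGamma_stab: "x \<otimes>\<^bsub>PGamma_stab L\<^esub> y = x \<otimes>\<^bsub>PGamma\<^esub> y"
  by (simp add: PGamma_stab_def)

text \<open>Inverts an isomorphism using closure of \<open>G\<close> under its product; applied in
  both directions between \<open>G333\<close> and a stabilizer, which is treated as a bare monoid
  record.\<close>

lemma iso_inverse:
  assumes h: "h \<in> iso G H" and closed: "\<And>x y. x \<in> carrier G \<Longrightarrow> y \<in> carrier G \<Longrightarrow> x \<otimes>\<^bsub>G\<^esub> y \<in> carrier G"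
  obtains k where "k \<in> iso H G" "\<And>x. x \<in> carrier G \<Longrightarrow> k (h x) = x"
proof -
  define k where "k = inv_into (carrier G) h"
  have b: "bij_betw h (carrier G) (carrier H)" and hm: "h \<in> hom G H" using h by (auto simp: iso_def)
  have kb: "bij_betw k (carrier H) (carrier G)" unfolding k_def by (rule bij_betw_inv_into[OF b])
  have kh: "k (h x) = x" if "x \<in> carrier G" for x
    unfolding k_def using b that by (simp add: bij_betw_inv_into_left)
  have "k \<in> hom H G"
  proof (rule homI)
    fix x assume "x \<in> carrier H" thus "k x \<in> carrier G" using kb by (auto simp: bij_betw_def)
  next
    fix x y assume xy: "x \<in> carrier H" "y \<in> carrier H"
    hence "x \<in> h ` carrier G" "y \<in> h ` carrier G" using b by (simp_all add: bij_betw_def)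
    then obtain a c where ac: "a \<in> carrier G" "x = h a" "c \<in> carrier G" "y = h c" by blast
    have "k (x \<otimes>\<^bsub>H\<^esub> y) = k (h (a \<otimes>\<^bsub>G\<^esub> c))" using hom_mult[OF hm ac(1,3)] ac by simp
    also have "\<dots> = k x \<otimes>\<^bsub>G\<^esub> k y" using closed ac kh by simp
    finally show "k (x \<otimes>\<^bsub>H\<^esub> y) = k x \<otimes>\<^bsub>G\<^esub> k y" .
  qed
  hence "k \<in> iso H G" using kb by (simp add: iso_def)
  thus ?thesis using that kh by blast
qed

lemma W_ext_j0: "(*v) (W_ext N) ` j0 \<tau> = j0 \<tau>"
  unfolding j0_def image_span by (simp add: matrix_vector_right_distrib vec.scale)

lemma W_ext_coset_inj:
  assumes "W_ext N = mat u ** W_ext M" shows "N = M"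
proof -
  have "v1 = u *s v1" using arg_cong[OF assms, of "\<lambda>A. A *v v1"] by (simp add: matrix_vector_mul_assoc[symmetric])
  hence "omega\<^sup>2 = u * omega\<^sup>2" by (metis v1_nth(2) vector_smult_component)
  hence "u = 1" by simp
  thus ?thesis using assms W_ext_inj by (simp add: matrix_mul_lid)
qed

text \<open>The integral matrix found by \<open>j0_morphism\<close> fixes \<tau>, hence is 1 or -1
  off the elliptic orbits. A unit multiple of \<open>A\<close> therefore fixes \<open>v1\<close> and
  \<open>v2\<close>.\<close>

lemma j0_stab_W_ext:
  assumes \<tau>: "\<tau> \<in> upper_half_plane'" and A: "A \<in> Lattice_mats" "(*v) A ` j0 \<tau> = j0 \<tau>"
  obtains N where "N \<in> carrier G333" "lat_coset A = lat_coset (W_ext N)"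
proof -
  have I: "Im \<tau> > 0" and nw: "\<not> sl2_eq omega \<tau>" using \<tau> upper_half_plane'_iff by auto
  obtain B z a b c d where B: "B \<in> Lattice_mats" "A ** B = mat 1" "B ** A = mat 1" "z \<in> Eunits" "a * d - b * c = (1::int)"
    "B *v v1 = z *s (of_int a *s v1 + of_int c *s v2)" "B *v v2 = z *s (of_int b *s v1 + of_int d *s v2)"
    "\<tau> = (of_int a * \<tau> + of_int b) / (of_int c * \<tau> + of_int d)" by (rule j0_morphism[OF A I I nw])
  have abcd: "b = 0 \<and> c = 0 \<and> (a = 1 \<and> d = 1 \<or> a = -1 \<and> d = -1)"
    by (rule stabilizer_SL2Z_trivial[OF \<tau> B(5) B(8)[symmetric]])
  define u where "u = z * of_int a"
  have u: "u \<in> Eunits" using B(4) abcd by (auto simp: u_def Eunits_def)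
  have Bv: "B *v v1 = u *s v1" "B *v v2 = u *s v2" using B(6,7) abcd by (auto simp: u_def)
  have AB: "A *v (B *v x) = x" for x by (simp add: matrix_vector_mul_assoc B)
  have "u *s (A *v v1) = v1" "u *s (A *v v2) = v2" using AB[of v1] AB[of v2] unfolding Bv by (simp_all add: vec.scale)
  hence "(mat u ** A) *v v1 = v1" "(mat u ** A) *v v2 = v2" by (simp_all add: matrix_vector_mul_assoc[symmetric])
  moreover have uA: "mat u ** A \<in> Lattice_mats" using mats_mult[OF Eunits_mats[OF u] A(1)] .
  ultimately obtain N where N: "mat u ** A = W_ext N" using mats_fix_v_W_ext by blast
  have "N \<in> carrier G333" unfolding carrier_G333 using uA N by simp
  moreover have "lat_coset A = lat_coset (W_ext N)" using lat_coset_mat[OF u, of A] N by simp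
  ultimately show ?thesis using that by blast
qed

lemma G333_iso_stab:
  assumes \<tau>: "\<tau> \<in> upper_half_plane'"
  shows "(\<lambda>N. lat_coset (W_ext N)) \<in> iso G333 (PGamma_stab (j0 \<tau>))"
proof -
  let ?f = "\<lambda>N. lat_coset (W_ext N)"
  have c4: "j0 \<tau> \<in> ch4" using \<tau> j0_ch4 upper_half_plane'_iff by blast
  have mem: "?f N \<in> carrier (PGamma_stab (j0 \<tau>))" if "N \<in> carrier G333" for N
    unfolding carrier_stab[OF c4] using that W_ext_j0 by (auto simp: carrier_G333)
  have "?f \<in> hom G333 (PGamma_stab (j0 \<tau>))"
  proof (rule homI[OF mem])
    fix N M assume "N \<in> carrier G333" "M \<in> carrier G333"
    thus "?f (N \<otimes>\<^bsub>G333\<^esub> M) = ?f N \<otimes>\<^bsub>PGamma_stab (j0 \<tau>)\<^esub> ?f M"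
      unfolding carrier_G333 mult_G333 mult_PGamma_stab by (simp add: mult_PGamma W_ext_mult)
  qed
  moreover have "inj_on ?f (carrier G333)"
  proof (rule inj_onI)
    fix N M assume "?f N = ?f M"
    thus "N = M" using lat_coset_eqD W_ext_coset_inj by metis
  qed
  moreover have "?f ` carrier G333 = carrier (PGamma_stab (j0 \<tau>))"
  proof (intro equalityI subsetI)
    fix X assume "X \<in> carrier (PGamma_stab (j0 \<tau>))"
    then obtain A where "X = lat_coset A" "A \<in> Lattice_mats" "(*v) A ` j0 \<tau> = j0 \<tau>"
      unfolding carrier_stab[OF c4] by blast
    thus "X \<in> ?f ` carrier G333" using j0_stab_W_ext[OF \<tau>] by (metis imageI)
  qed (use mem in blast)
  ultimately show ?thesis by (auto simp: iso_def bij_betw_def)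
qed

lemma j0_ch4'_G:
  assumes "\<tau> \<in> upper_half_plane'" shows "j0 \<tau> \<in> ch4'_G"
proof -
  have "x \<otimes>\<^bsub>G333\<^esub> y \<in> carrier G333" if "x \<in> carrier G333" "y \<in> carrier G333" for x y
    using that G333_mult mult_G333 by simp
  then obtain k where "k \<in> iso (PGamma_stab (j0 \<tau>)) G333"
    using iso_inverse[OF G333_iso_stab[OF assms]] by blast
  hence "PGamma_stab (j0 \<tau>) \<cong> G333" by (auto simp: is_iso_def)
  thus ?thesis using assms j0_ch4' upper_half_plane'_iff by (simp add: ch4'_G_def)
qed

text \<open>The classes of \<open>W_ext N\<close> embed G in the stabilizer of \<open>j0 p\<close>
  too. If that stabilizer were isomorphic to G, the embedding would be onto by counting; but it
  misses an elliptic element, which moves the line of \<open>v1\<close>.\<close>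

lemma ch4'_G_not_elliptic:
  assumes L: "L \<in> ch4'_G" and A: "A \<in> Lattice_mats" "(*v) A ` L = j0 p" and p: "p = \<i> \<or> p = omega"
  shows False
proof -
  have Ip: "Im p > 0" using p by auto
  have c4: "L \<in> ch4" using L by (auto simp: ch4'_G_def ch4'_def)
  obtain B where B: "B \<in> Lattice_mats" "A ** B = mat 1" "B ** A = mat 1" using mats_inv[OF A(1)] .
  \<comment> \<open>The elliptic matrix with rows (0, -1) and (1, e): e is 0 for i, and 1 for
    \<open>omega\<close> because omega (omega + 1) = -1.\<close>
  have "\<exists>e. (of_int 0 * p + of_int (-1)) / (of_int 1 * p + of_int e) = p"
  proof (cases "p = \<i>")
    case True
    thus ?thesis by (intro exI[of _ 0]) simp
  next
    case False
    hence "p = omega" using p by blast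
    moreover have "omega + 1 \<noteq> 0" by (simp add: complex_eq_iff)
    ultimately show ?thesis by (intro exI[of _ 1]) (simp add: field_simps omega_mult)
  qed
  then obtain e where e: "(of_int 0 * p + of_int (-1)) / (of_int 1 * p + of_int e) = p" by blast
  obtain S where S: "S \<in> Lattice_mats" "S *v v1 = of_int 0 *s v1 + of_int 1 *s v2"
    "S *v v2 = of_int (-1) *s v1 + of_int e *s v2" using SL2Z_lift[of 0 e "-1" 1] by auto
  have Sp: "(*v) S ` j0 p = j0 p" using j0_lift[OF Ip _ S(2,3)] e by simp
  \<comment> \<open>Conjugation by \<open>A\<close> carries the stabilizer of \<open>j0 p\<close> to
    that of \<open>L\<close>.\<close>
  define f where "f = (\<lambda>C. lat_coset (B ** (C ** A)))"
  have fm: "f C \<in> carrier (PGamma_stab L)" if "C \<in> Lattice_mats" "(*v) C ` j0 p = j0 p" for C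
  proof -
    have "(*v) (B ** (C ** A)) ` L = (*v) B ` ((*v) C ` ((*v) A ` L))"
      by (simp add: image_image matrix_vector_mul_assoc)
    also have "\<dots> = (*v) B ` ((*v) A ` L)" using A that by simp
    also have "\<dots> = L" by (simp add: image_image matrix_vector_mul_assoc B)
    finally have "(*v) (B ** (C ** A)) ` L = L" .
    moreover have "B ** (C ** A) \<in> Lattice_mats" using mats_mult[OF B(1) mats_mult[OF that(1) A(1)]] .
    ultimately show ?thesis unfolding f_def carrier_stab[OF c4] by blast
  qed
  have fi: "\<exists>u. C = mat u ** D" if eq: "f C = f D" for C D
  proof -
    obtain u where u: "B ** (C ** A) = mat u ** (B ** (D ** A))"
      using lat_coset_eqD[OF eq[unfolded f_def]] by blast
    have AB: "A *v (B *v x) = x" for x by (simp add: matrix_vector_mul_assoc B)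
    have "C *v x = mat u ** D *v x" for x
    proof -
      have "A *v ((B ** (C ** A)) *v (B *v x)) = C *v x"
        by (simp add: matrix_vector_mul_assoc[symmetric] AB)
      moreover have "A *v ((mat u ** (B ** (D ** A))) *v (B *v x)) = mat u ** D *v x"
        by (simp add: matrix_vector_mul_assoc[symmetric] AB vec.scale)
      ultimately show ?thesis unfolding u by simp
    qed
    thus ?thesis using matrix_eq by blast
  qed
  obtain h where h: "h \<in> iso (PGamma_stab L) G333" using L by (auto simp: ch4'_G_def is_iso_def)
  hence hb: "bij_betw h (carrier (PGamma_stab L)) (carrier G333)" by (simp add: iso_def)
  have fin: "finite (carrier (PGamma_stab L))" using bij_betw_finite[OF hb] finite_G333 by blast
  have "inj_on (\<lambda>N. f (W_ext N)) (carrier G333)"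
    by (rule inj_onI) (use fi W_ext_coset_inj in blast)
  hence "card ((\<lambda>N. f (W_ext N)) ` carrier G333) = card (carrier G333)" by (rule card_image)
  also have "\<dots> = card (carrier (PGamma_stab L))" using bij_betw_same_card[OF hb] by simp
  finally have "(\<lambda>N. f (W_ext N)) ` carrier G333 = carrier (PGamma_stab L)"
    using fm W_ext_j0 carrier_G333 by (intro card_subset_eq[OF fin]) auto
  moreover have "f S \<in> carrier (PGamma_stab L)" using fm S Sp by blast
  ultimately obtain N where "f S = f (W_ext N)" by (metis imageE)
  then obtain u where "S = mat u ** W_ext N" using fi by blast
  hence "S *v v1 = u *s v1 + 0 *s v2" by (simp add: matrix_vector_mul_assoc[symmetric])
  hence "0 *s v1 + 1 *s v2 = u *s v1 + 0 *s v2" using S(2) by simp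
  from v1_v2_independent(2)[OF this] show False by simp
qed

lemma ch4'_G_upper_half_plane':
  assumes L: "L \<in> ch4'_G" and A: "A \<in> Lattice_mats" "(*v) A ` L = j0 \<tau>" and I: "Im \<tau> > 0"
  shows "\<tau> \<in> upper_half_plane'"
proof (rule ccontr)
  assume "\<tau> \<notin> upper_half_plane'"
  then obtain p where p: "p = \<i> \<or> p = omega" "sl2_eq p \<tau>" using I upper_half_plane'_iff by blast
  have Ip: "Im p > 0" using p by auto
  obtain C where C: "C \<in> Lattice_mats" "(*v) C ` j0 \<tau> = j0 p"
    using sl2_eq_j0[OF sl2_eq_sym[OF p(2) Ip] I] by blast
  have "(*v) (C ** A) ` L = (*v) C ` ((*v) A ` L)" by (simp add: image_image matrix_vector_mul_assoc)
  hence "(*v) (C ** A) ` L = j0 p" using A C by simp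
  thus False using ch4'_G_not_elliptic[OF L mats_mult[OF C(1) A(1)] _ p(1)] by blast
qed

section \<open>The induced map on orbits\<close>

lemma j0_orbit_eq:
  assumes "sl2_eq \<tau> \<tau>'" "Im \<tau> > 0"
  shows "orbit PGamma PGamma_act (j0 \<tau>') = orbit PGamma PGamma_act (j0 \<tau>)"
proof -
  obtain A where "A \<in> Lattice_mats" "(*v) A ` j0 \<tau> = j0 \<tau>'" using sl2_eq_j0[OF assms] .
  thus ?thesis using orbit_PGamma_eqI[OF j0_ch4[OF assms(2)]] by metis
qed

lemma j0_orbit_eq_imp:
  assumes "\<tau> \<in> upper_half_plane'" "\<tau>' \<in> upper_half_plane'"
    "orbit PGamma PGamma_act (j0 \<tau>) = orbit PGamma PGamma_act (j0 \<tau>')"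
  shows "sl2_eq \<tau>' \<tau>"
proof -
  have I: "Im \<tau> > 0" "Im \<tau>' > 0" and nw: "\<not> sl2_eq omega \<tau>'" using assms upper_half_plane'_iff by auto
  have "(*v) (mat 1) ` j0 \<tau>' = j0 \<tau>'" by simp
  hence "j0 \<tau>' \<in> orbit PGamma PGamma_act (j0 \<tau>')" unfolding orbit_PGamma[OF j0_ch4[OF I(2)]] using mats_1 by blast
  hence "j0 \<tau>' \<in> orbit PGamma PGamma_act (j0 \<tau>)" using assms(3) by simp
  then obtain A where A: "A \<in> Lattice_mats" "(*v) A ` j0 \<tau> = j0 \<tau>'"
    unfolding orbit_PGamma[OF j0_ch4[OF I(1)]] by blast
  obtain a b c d where "a * d - b * c = (1::int)" "\<tau> = (of_int a * \<tau>' + of_int b) / (of_int c * \<tau>' + of_int d)"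
    by (rule j0_morphism[OF A I nw])
  thus ?thesis unfolding sl2_eq_def by blast
qed

lemma j0_bar_bijection:
  assumes key: "\<And>L. L \<in> ch4'_G \<Longrightarrow> \<exists>A \<tau>. A \<in> Lattice_mats \<and> Im \<tau> > 0 \<and> (*v) A ` L = j0 \<tau>"
  shows "j0 ` upper_half_plane' \<subseteq> ch4'_G \<and>
    (\<forall>X \<in> orbits PSL2Z upper_half_plane' PSL2Z_act.
       \<forall>\<tau> \<in> X. j0_bar X = orbit PGamma PGamma_act (j0 \<tau>)) \<and>
    bij_betw j0_bar
      (orbits PSL2Z upper_half_plane' PSL2Z_act)
      (orbits PGamma ch4'_G PGamma_act)"
proof -
  have Im: "Im \<tau> > 0" if "\<tau> \<in> upper_half_plane'" for \<tau> using that upper_half_plane'_iff by blast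
  have bar: "j0_bar (orbit PSL2Z PSL2Z_act \<tau>) = orbit PGamma PGamma_act (j0 \<tau>)" if "\<tau> \<in> upper_half_plane'" for \<tau>
  proof -
    define f where "f = (\<lambda>\<sigma>. orbit PGamma PGamma_act (j0 \<sigma>))"
    have "f ` {\<sigma>. sl2_eq \<tau> \<sigma>} = {f \<tau>}"
    proof (intro equalityI subsetI)
      fix Y assume "Y \<in> f ` {\<sigma>. sl2_eq \<tau> \<sigma>}"
      then obtain \<sigma> where "sl2_eq \<tau> \<sigma>" "Y = f \<sigma>" by blast
      thus "Y \<in> {f \<tau>}" using j0_orbit_eq[OF _ Im[OF that]] unfolding f_def by blast
    next
      fix Y assume "Y \<in> {f \<tau>}"
      thus "Y \<in> f ` {\<sigma>. sl2_eq \<tau> \<sigma>}" using sl2_eq_refl by blast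
    qed
    thus ?thesis unfolding j0_bar_def orbit_PSL2Z[OF Im[OF that]] f_def by simp
  qed
  have 2: "j0_bar X = orbit PGamma PGamma_act (j0 \<sigma>)" if X: "X \<in> orbits PSL2Z upper_half_plane' PSL2Z_act" "\<sigma> \<in> X" for X \<sigma>
  proof -
    obtain \<tau> where \<tau>: "\<tau> \<in> upper_half_plane'" "X = orbit PSL2Z PSL2Z_act \<tau>" using X(1) by (auto simp: orbits_def)
    have "sl2_eq \<tau> \<sigma>" using X(2) unfolding \<tau>(2) orbit_PSL2Z[OF Im[OF \<tau>(1)]] by simp
    from j0_orbit_eq[OF this Im[OF \<tau>(1)]] show ?thesis unfolding \<tau>(2) bar[OF \<tau>(1)] by (rule sym)
  qed
  have inj: "inj_on j0_bar (orbits PSL2Z upper_half_plane' PSL2Z_act)"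
  proof (rule inj_onI)
    fix X Y assume XY: "X \<in> orbits PSL2Z upper_half_plane' PSL2Z_act" "Y \<in> orbits PSL2Z upper_half_plane' PSL2Z_act"
      "j0_bar X = j0_bar Y"
    obtain \<tau> where \<tau>: "\<tau> \<in> upper_half_plane'" "X = orbit PSL2Z PSL2Z_act \<tau>" using XY(1) by (auto simp: orbits_def)
    obtain \<sigma> where \<sigma>: "\<sigma> \<in> upper_half_plane'" "Y = orbit PSL2Z PSL2Z_act \<sigma>" using XY(2) by (auto simp: orbits_def)
    have "orbit PGamma PGamma_act (j0 \<tau>) = orbit PGamma PGamma_act (j0 \<sigma>)"
      using XY(3) unfolding \<tau>(2) \<sigma>(2) bar[OF \<tau>(1)] bar[OF \<sigma>(1)] .
    hence e: "sl2_eq \<sigma> \<tau>" by (rule j0_orbit_eq_imp[OF \<tau>(1) \<sigma>(1)])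
    hence "sl2_eq \<tau> \<sigma>" using sl2_eq_sym Im[OF \<sigma>(1)] by blast
    with e show "X = Y" unfolding \<tau>(2) \<sigma>(2) orbit_PSL2Z[OF Im[OF \<tau>(1)]] orbit_PSL2Z[OF Im[OF \<sigma>(1)]]
      using sl2_eq_trans Im \<tau>(1) \<sigma>(1) by blast
  qed
  have "j0_bar ` orbits PSL2Z upper_half_plane' PSL2Z_act = orbits PGamma ch4'_G PGamma_act"
  proof (intro equalityI subsetI)
    fix Y assume "Y \<in> j0_bar ` orbits PSL2Z upper_half_plane' PSL2Z_act"
    then obtain \<tau> where "\<tau> \<in> upper_half_plane'" "Y = orbit PGamma PGamma_act (j0 \<tau>)"
      using bar by (auto simp: orbits_def)
    thus "Y \<in> orbits PGamma ch4'_G PGamma_act" using j0_ch4'_G by (auto simp: orbits_def)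
  next
    fix Y assume "Y \<in> orbits PGamma ch4'_G PGamma_act"
    then obtain L where L: "L \<in> ch4'_G" "Y = orbit PGamma PGamma_act L" by (auto simp: orbits_def)
    obtain A \<tau> where A: "A \<in> Lattice_mats" "Im \<tau> > 0" "(*v) A ` L = j0 \<tau>" using key[OF L(1)] by blast
    have "L \<in> ch4" using L(1) by (auto simp: ch4'_G_def ch4'_def)
    hence "Y = orbit PGamma PGamma_act (j0 \<tau>)" using orbit_PGamma_eqI A L(2) by metis
    moreover have "\<tau> \<in> upper_half_plane'" by (rule ch4'_G_upper_half_plane'[OF L(1) A(1,3,2)])
    ultimately show "Y \<in> j0_bar ` orbits PSL2Z upper_half_plane' PSL2Z_act"
      using bar by (auto simp: orbits_def image_iff)
  qed
  with inj 2 j0_ch4'_G show ?thesis by (auto simp: bij_betw_def)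
qed

section \<open>Lifting the Heisenberg group\<close>

lemma no_eis_sqrt_minus_1: "x \<in> eisenstein \<Longrightarrow> x\<^sup>2 \<noteq> -1"
proof
  assume x: "x \<in> eisenstein" "x\<^sup>2 = -1"
  hence "(cmod x)\<^sup>2 = 1" by (metis norm_minus_cancel norm_one norm_power)
  hence "cmod x = 1" by (intro power2_eq_imp_eq[of _ 1]) auto
  hence "x \<in> {1, -1, omega, -omega, omega\<^sup>2, -(omega\<^sup>2)}" using eis_cmod_1 x by blast
  moreover have "(omega\<^sup>2)\<^sup>2 = omega" by (simp add: omega_sq power2_eq_square omega_simps)
  ultimately have "x\<^sup>2 = 1 \<or> x\<^sup>2 = omega\<^sup>2 \<or> x\<^sup>2 = omega" by auto
  thus False unfolding x(2) by (auto simp: omega_sq complex_eq_iff)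
qed

lemma det_mats_eis: "A \<in> Lattice_mats \<Longrightarrow> det A \<in> eisenstein"
  unfolding det_def Lattice_mats_def by (intro eis_sum eis_mult eis_prod) (auto simp: sign_def)

lemma det_mat5: "det (mat u :: complex ^ 5 ^ 5) = u ^ 5"
  by (simp add: det_diagonal mat_def)

text \<open>The determinant satisfies det(A)^2 = u^5. If u were - z^2, then det(A) divided by z^5
  would be a square root of -1 in the Eisenstein integers; oddness of the rank is essential.\<close>

lemma mats_square_scalar:
  assumes "A \<in> Lattice_mats" "A ** A = mat u" "u \<in> Eunits"
  obtains z where "z \<in> Eunits" "u = z\<^sup>2"
proof -
  obtain z s where zs: "z \<in> Eunits" "s = 1 \<or> s = -1" "u = s * z\<^sup>2" by (rule eis_unit_square[OF assms(3)])
  have "s \<noteq> -1"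
  proof
    assume s: "s = -1"
    have d: "det A * det A = u ^ 5" using assms(2) det_mul[of A A] det_mat5 by simp
    have "(det A * cnj z ^ 5)\<^sup>2 = (det A * det A) * (cnj z ^ 5)\<^sup>2" by (simp add: power2_eq_square)
    also have "\<dots> = - ((cnj z * z) ^ 10)" unfolding d zs(3) s by (simp add: power_mult_distrib power_mult[symmetric])
    also have "\<dots> = -1" unfolding Eunits_cnj_mult[OF zs(1)] by simp
    finally have "(det A * cnj z ^ 5)\<^sup>2 = -1" .
    moreover have "det A * cnj z ^ 5 \<in> eisenstein"
      using det_mats_eis[OF assms(1)] zs(1) by (auto simp: Eunits_def intro!: eis_mult eis_power)
    ultimately show False using no_eis_sqrt_minus_1 by blast
  qed
  thus ?thesis using that zs by auto
qed

locale stab_point =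
  fixes L :: "(complex ^ 5) set" and l :: "complex ^ 5" and k :: "complex ^ 3 ^ 3 \<Rightarrow> (complex ^ 5 \<Rightarrow> complex ^ 5) set"
  assumes L: "L = vec.span {l}" and neg: "Re (herm l l) < 0"
    and k: "k \<in> iso G333 (PGamma_stab L)"
begin

lemma L_ch4: "L \<in> ch4" using L neg ch4_iff by blast

lemma l_nz: "l \<noteq> 0" using neg by auto

text \<open>Representatives of a coset differ by scalars, so requiring \<open>l\<close> itself to be
  fixed singles out at most one of them.\<close>

definition lifts :: "complex ^ 3 ^ 3 \<Rightarrow> complex ^ 5 ^ 5 \<Rightarrow> bool" where
  "lifts N X \<longleftrightarrow> N \<in> carrier G333 \<and> X \<in> Lattice_mats \<and> X *v l = l \<and> k N = lat_coset X"

lemma k_mult: "N \<in> carrier G333 \<Longrightarrow> M \<in> carrier G333 \<Longrightarrow> k (N ** M) = k N \<otimes>\<^bsub>PGamma\<^esub> k M"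
  using hom_mult[of k G333 "PGamma_stab L"] k unfolding iso_def mult_G333 mult_PGamma_stab by blast

lemma k_coset:
  assumes "N \<in> carrier G333"
  obtains A c where "A \<in> Lattice_mats" "k N = lat_coset A" "A *v l = c *s l"
proof -
  have "k N \<in> carrier (PGamma_stab L)" using k assms by (auto simp: iso_def hom_def)
  then obtain A where A: "A \<in> Lattice_mats" "(*v) A ` L = L" "k N = lat_coset A"
    unfolding carrier_stab[OF L_ch4] by blast
  have "A *v l \<in> L" using A(2) L vec.span_base[of l "{l}"] by blast
  hence "\<exists>c. A *v l = c *s l" unfolding L span_singleton by blast
  with A that show ?thesis by blast
qed

lemma lifts_mult: "lifts N X \<Longrightarrow> lifts M Y \<Longrightarrow> lifts (N ** M) (X ** Y)"
  unfolding lifts_def using k_mult G333_mult mult_PGamma mats_mult by (simp add: matrix_vector_mul_assoc[symmetric])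

lemma lifts_unique:
  assumes "lifts N X" "lifts N Y" shows "X = Y"
proof -
  obtain u where u: "X = mat u ** Y" using assms lat_coset_eqD unfolding lifts_def by metis
  have "l = u *s l" using assms u by (simp add: lifts_def matrix_vector_mul_assoc[symmetric])
  moreover obtain i where "l $ i \<noteq> 0" using l_nz by (auto simp: vec_eq_iff)
  ultimately have "u = 1" by (metis mult_cancel_right2 vector_smult_component)
  thus ?thesis using u by (simp add: matrix_mul_lid)
qed

text \<open>Multiplicativity of \<open>k\<close> makes the image of the identity an idempotent
  coset; cancelling in the matrix group shows that its representative is a scalar.\<close>

lemma lifts_1: "lifts (mat 1) (mat 1)"
proof -
  obtain C c where C: "C \<in> Lattice_mats" "k (mat 1) = lat_coset C" by (rule k_coset[OF G333_one])
  have "lat_coset C = lat_coset (C ** C)"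
    using k_mult[OF G333_one G333_one] mult_PGamma[OF C(1) C(1)] C(2) by simp
  then obtain u where u: "u \<in> Eunits" "C = mat u ** (C ** C)" using lat_coset_eqD by blast
  obtain D where D: "D \<in> Lattice_mats" "C ** D = mat 1" "D ** C = mat 1" using mats_inv[OF C(1)] .
  have "mat u ** C = mat 1"
  proof -
    have "mat u ** C = mat u ** (C ** C) ** D" by (simp add: matrix_mul_assoc[symmetric] D)
    also have "\<dots> = mat 1" using u(2) D by simp
    finally show ?thesis .
  qed
  hence "lat_coset C = lat_coset (mat 1)" using lat_coset_mat[OF u(1), of C] by simp
  thus ?thesis unfolding lifts_def using G333_one mats_1 C by simp
qed

lemma lifts_trivial: "lifts N (mat 1) \<Longrightarrow> N = mat 1"
proof -
  assume N: "lifts N (mat 1)"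
  have "inj_on k (carrier G333)" using k by (simp add: iso_def bij_betw_def)
  thus ?thesis by (rule inj_onD) (use N lifts_1 in \<open>simp_all add: lifts_def\<close>)
qed

text \<open>A representative squares to a unit scalar, which is a square by
  \<open>mats_square_scalar\<close>. Dividing by the root gives an involution, with eigenvalue 1 or
  -1 on \<open>l\<close>; in the latter case its negative is taken.\<close>

lemma lift_involution:
  assumes "N \<in> carrier G333" "N ** N = mat 1"
  obtains X where "lifts N X" "X ** X = mat 1"
proof -
  obtain A c where A: "A \<in> Lattice_mats" "k N = lat_coset A" "A *v l = c *s l" by (rule k_coset[OF assms(1)])
  have "lat_coset (A ** A) = lat_coset (mat 1)"
    using k_mult[OF assms(1) assms(1)] assms(2) mult_PGamma[OF A(1) A(1)] A(2) lifts_1 by (simp add: lifts_def)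
  then obtain u where u: "u \<in> Eunits" "A ** A = mat u ** mat 1" by (rule lat_coset_eqD)
  hence AA: "A ** A = mat u" by simp
  obtain z where z: "z \<in> Eunits" "u = z\<^sup>2" by (rule mats_square_scalar[OF A(1) AA u(1)])
  define X where "X = mat (cnj z) ** A"
  have zc: "cnj z \<in> Eunits" using z by blast
  have Xm: "X \<in> Lattice_mats" unfolding X_def by (rule mats_mult[OF Eunits_mats[OF zc] A(1)])
  have XX: "X ** X = mat 1"
  proof -
    have "X ** X = mat (cnj z) ** (A ** mat (cnj z)) ** A" by (simp add: X_def matrix_mul_assoc)
    also have "\<dots> = mat (cnj z) ** (mat (cnj z) ** A) ** A" by (simp only: mat_commute)
    also have "\<dots> = mat (cnj z * cnj z) ** (A ** A)" by (simp add: matrix_mul_assoc mat_mult_mat)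
    also have "\<dots> = mat ((cnj z * z) * (cnj z * z))" unfolding AA mat_mult_mat z(2)
      by (simp add: power2_eq_square mult_ac)
    finally show ?thesis unfolding Eunits_cnj_mult[OF z(1)] by simp
  qed
  have kX: "k N = lat_coset X" unfolding X_def lat_coset_mat[OF zc] by (rule A(2))
  define e where "e = cnj z * c"
  have Xl: "X *v l = e *s l" by (simp add: X_def matrix_vector_mul_assoc[symmetric] A(3) e_def)
  have "l = X *v (X *v l)" by (simp add: matrix_vector_mul_assoc XX)
  hence "l = (e * e) *s l" unfolding Xl vec.scale by simp
  moreover obtain i where i: "l $ i \<noteq> 0" using l_nz by (auto simp: vec_eq_iff)
  ultimately have "e * e = 1" by (metis mult_cancel_right2 vector_smult_component)
  hence "e = 1 \<or> e = -1" by (metis power2_eq_1_iff power2_eq_square)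
  thus ?thesis
  proof
    assume "e = 1"
    thus ?thesis using that[of X] XX Xm kX Xl assms by (simp add: lifts_def)
  next
    assume e: "e = -1"
    have m1: "- 1 \<in> Eunits" by (simp add: Eunits_def)
    define Y where "Y = mat (-1) ** X"
    have "Y ** Y = mat 1"
    proof -
      have "Y ** Y = mat (-1) ** (X ** mat (-1)) ** X" by (simp add: Y_def matrix_mul_assoc)
      also have "\<dots> = mat (-1) ** (mat (-1) ** X) ** X" by (simp only: mat_commute)
      also have "\<dots> = mat ((-1) * (-1)) ** (X ** X)" by (simp only: matrix_mul_assoc mat_mult_mat)
      finally show ?thesis by (simp add: XX)
    qed
    moreover have "lifts N Y"
      unfolding lifts_def Y_def using assms(1) mats_mult[OF Eunits_mats[OF m1] Xm] lat_coset_mat[OF m1, of X] kX Xl e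
      by (simp add: matrix_vector_mul_assoc[symmetric])
    ultimately show ?thesis using that by blast
  qed
qed

lemma lift_Heisenberg:
  obtains A B Z where "A \<in> Lattice_mats" "B \<in> Lattice_mats" "Z \<in> Lattice_mats"
    "A *v l = l" "B *v l = l" "Z *v l = l"
    "A ** (A ** A) = mat 1" "B ** (B ** B) = mat 1" "Z ** (Z ** Z) = mat 1"
    "A ** B = Z ** (B ** A)" "Z ** A = A ** Z" "Z ** B = B ** Z" "Z \<noteq> mat 1"
proof -
  \<comment> \<open>\<open>s1\<close> and \<open>s3\<close> are transpositions and \<open>s2\<close>
    is one twisted by cube roots of unity. Their products are the diagonal generator
    \<open>a\<close> and the 3-cycle \<open>b\<close>, whose commutator is the scalar
    \<open>z\<close>.\<close>
  define s1 s2 s3 a b z :: "complex ^ 3 ^ 3" where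
    "s1 = vector [vector [1, 0, 0], vector [0, 0, 1], vector [0, 1, 0]]" and
    "s2 = vector [vector [1, 0, 0], vector [0, 0, omega\<^sup>2], vector [0, omega, 0]]" and
    "s3 = vector [vector [0, 1, 0], vector [1, 0, 0], vector [0, 0, 1]]" and
    "a = dd 1 omega (omega\<^sup>2)" and "b = s3 ** s1" and "z = dd omega omega omega"
  note mm = vec_eq_iff forall_3 matrix_matrix_mult_def sum_3 mat_def
  have w: "omega\<^sup>2 * omega = 1" "omega * omega\<^sup>2 = 1" "omega\<^sup>2 * omega\<^sup>2 = omega" "omega * omega = omega\<^sup>2"
    by (simp_all add: omega_sq omega_simps)
  have w': "omega ^ 4 = omega" "omega ^ 5 = omega\<^sup>2" "omega ^ 6 = 1"
    using power_add[of omega 3 1] power_add[of omega 3 2] power_add[of omega 3 3] by simp_all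
  have s1p: "s1 = perm_matrix (\<lambda>i. if i = 2 then 3 else if i = 3 then 2 else i)"
    by (simp add: s1_def perm_matrix_def vec_eq_iff forall_3)
  have s3p: "s3 = perm_matrix (\<lambda>i. if i = 1 then 2 else if i = 2 then 1 else i)"
    by (simp add: s3_def perm_matrix_def vec_eq_iff forall_3)
  have "bij (\<lambda>i::3. if i = 2 then 3 else if i = 3 then 2 else i)" "bij (\<lambda>i::3. if i = 1 then 2 else if i = 2 then 1 else i)"
    by (rule involuntory_imp_bij, simp)+
  hence G1: "s1 \<in> carrier G333" and G3: "s3 \<in> carrier G333" unfolding s1p s3p using G333_perm by blast+
  have aG: "a \<in> carrier G333" unfolding a_def by (rule G333_dd) (simp_all add: omega_sq)
  have s12: "s1 ** a = s2" by (simp add: s1_def s2_def a_def dd_def diag3_def mm)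
  have G2: "s2 \<in> carrier G333" using G333_mult[OF G1 aG] s12 by simp
  have inv: "s1 ** s1 = mat 1" "s2 ** s2 = mat 1" "s3 ** s3 = mat 1"
    by (simp_all add: s1_def s2_def s3_def mm w)
  have a12: "s1 ** s2 = a" unfolding s12[symmetric] by (simp add: matrix_mul_assoc inv)
  obtain S1 where S1: "lifts s1 S1" "S1 ** S1 = mat 1" by (rule lift_involution[OF G1 inv(1)])
  obtain S2 where S2: "lifts s2 S2" "S2 ** S2 = mat 1" by (rule lift_involution[OF G2 inv(2)])
  obtain S3 where S3: "lifts s3 S3" "S3 ** S3 = mat 1" by (rule lift_involution[OF G3 inv(3)])
  define A B where "A = S1 ** S2" and "B = S3 ** S1"
  have A: "lifts a A" unfolding A_def a12[symmetric] by (rule lifts_mult[OF S1(1) S2(1)])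
  have B: "lifts b B" unfolding B_def b_def by (rule lifts_mult[OF S3(1) S1(1)])
  \<comment> \<open>The commutator of \<open>A\<close> and \<open>B\<close>, with squares in place
    of inverses of elements of order 3, so that it is visibly a product of lifts.\<close>
  define Z where "Z = A ** (B ** ((A ** A) ** (B ** B)))"
  have ids: "a ** (a ** a) = mat 1" "b ** (b ** b) = mat 1" "z ** (z ** z) = mat 1" "a ** b = z ** (b ** a)"
    "z ** a = a ** z" "z ** b = b ** z" "a ** (b ** ((a ** a) ** (b ** b))) = z"
    by (simp_all add: a_def b_def z_def s3_def s1_def dd_def diag3_def mm w w')
  have Z: "lifts z Z" unfolding Z_def using lifts_mult[OF A lifts_mult[OF B lifts_mult[OF lifts_mult[OF A A] lifts_mult[OF B B]]]] ids(7) by simp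
  have "Z \<noteq> mat 1"
  proof
    assume "Z = mat 1"
    hence "z = mat 1" using Z lifts_trivial by blast
    hence "z $ 1 $ 1 = (mat 1 :: complex ^ 3 ^ 3) $ 1 $ 1" by simp
    thus False by (simp add: z_def dd_def diag3_def mat_def omega_sq complex_eq_iff)
  qed
  moreover have "A ** (A ** A) = mat 1"
    using lifts_mult[OF A lifts_mult[OF A A]] lifts_1 lifts_unique unfolding ids by blast
  moreover have "B ** (B ** B) = mat 1"
    using lifts_mult[OF B lifts_mult[OF B B]] lifts_1 lifts_unique unfolding ids by blast
  moreover have "Z ** (Z ** Z) = mat 1"
    using lifts_mult[OF Z lifts_mult[OF Z Z]] lifts_1 lifts_unique unfolding ids by blast
  moreover have "A ** B = Z ** (B ** A)"
    using lifts_unique[OF lifts_mult[OF A B] lifts_mult[OF Z lifts_mult[OF B A], folded ids(4)]] .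
  moreover have "Z ** A = A ** Z"
    using lifts_unique[OF lifts_mult[OF Z A] lifts_mult[OF A Z, folded ids(5)]] .
  moreover have "Z ** B = B ** Z"
    using lifts_unique[OF lifts_mult[OF Z B] lifts_mult[OF B Z, folded ids(6)]] .
  ultimately show ?thesis using A B Z that unfolding lifts_def by blast
qed

end

section \<open>Orthogonal frames\<close>

definition orth_set :: "(complex ^ 5) set \<Rightarrow> bool" where
  "orth_set S \<longleftrightarrow> finite S \<and> (\<forall>x\<in>S. herm x x \<noteq> 0) \<and> (\<forall>x\<in>S. \<forall>y\<in>S. x \<noteq> y \<longrightarrow> herm x y = 0)"

lemma orth_set_card: "orth_set S \<Longrightarrow> card S \<le> 5"
proof -
  assume S: "orth_set S"
  have "vec.independent S"
    unfolding vec.independent_explicit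
  proof (intro conjI allI impI)
    show "finite S" using S by (simp add: orth_set_def)
    fix u assume u: "(\<Sum>v\<in>S. u v *s v) = 0"
    show "\<forall>v\<in>S. u v = 0"
    proof
      fix v assume v: "v \<in> S"
      have "0 = herm (\<Sum>x\<in>S. u x *s x) v" using u by simp
      also have "\<dots> = (\<Sum>x\<in>S. u x * herm x v)" by (simp add: herm_sum_left herm_scale_left)
      also have "\<dots> = (\<Sum>x\<in>S. if x = v then u v * herm v v else 0)"
        by (intro sum.cong) (use S v in \<open>auto simp: orth_set_def\<close>)
      also have "\<dots> = u v * herm v v" using S v by (simp add: orth_set_def)
      finally show "u v = 0" using S v by (auto simp: orth_set_def)
    qed
  qed
  hence "card S \<le> vec.dim (UNIV :: (complex ^ 5) set)" by (intro vec.independent_card_le_dim) auto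
  thus ?thesis by (simp add: vec.dim_UNIV card_cart_basis)
qed

lemma orth_set_insert:
  assumes "orth_set S" "herm x x \<noteq> 0" "\<And>y. y \<in> S \<Longrightarrow> herm x y = 0"
  shows "orth_set (insert x S)" "card (insert x S) = Suc (card S)"
proof -
  have "herm y x = 0" if "y \<in> S" for y using assms(3)[OF that] herm_eq_0_sym by blast
  thus "orth_set (insert x S)" using assms by (auto simp: orth_set_def)
  have "x \<notin> S" using assms(2,3) by auto
  thus "card (insert x S) = Suc (card S)" using assms(1) by (simp add: orth_set_def)
qed

text \<open>The dimension bound behind all multiplicity arguments below. One half of the
  orthogonality relations is listed; the other half follows by conjugation.\<close>

lemma no_six_orthogonal:
  assumes "herm a a \<noteq> 0" "herm b b \<noteq> 0" "herm c c \<noteq> 0" "herm d d \<noteq> 0" "herm e e \<noteq> 0" "herm f f \<noteq> 0"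
    "herm b a = 0" "herm c a = 0" "herm c b = 0" "herm d a = 0" "herm d b = 0" "herm d c = 0"
    "herm e a = 0" "herm e b = 0" "herm e c = 0" "herm e d = 0"
    "herm f a = 0" "herm f b = 0" "herm f c = 0" "herm f d = 0" "herm f e = 0"
  shows False
proof -
  have 0: "orth_set {}" by (simp add: orth_set_def)
  note 1 = orth_set_insert[OF 0 assms(1)]
  have 2: "orth_set {b, a}" "card {b, a} = 2" using orth_set_insert[OF 1(1) assms(2)] 1(2) assms by auto
  have 3: "orth_set {c, b, a}" "card {c, b, a} = 3" using orth_set_insert[OF 2(1) assms(3)] 2(2) assms by auto
  have 4: "orth_set {d, c, b, a}" "card {d, c, b, a} = 4" using orth_set_insert[OF 3(1) assms(4)] 3(2) assms by auto
  have 5: "orth_set {e, d, c, b, a}" "card {e, d, c, b, a} = 5" using orth_set_insert[OF 4(1) assms(5)] 4(2) assms by auto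
  have 6: "orth_set {f, e, d, c, b, a}" "card {f, e, d, c, b, a} = 6" using orth_set_insert[OF 5(1) assms(6)] 5(2) assms by auto
  show False using orth_set_card[OF 6(1)] 6(2) by simp
qed

lemma herm_self: "herm x x = of_real (- (cmod (x$1))\<^sup>2 + (\<Sum>i\<in>{2,3,4,5}. (cmod (x$i))\<^sup>2))"
  unfolding herm_def of_real_add of_real_minus of_real_sum complex_norm_square by simp

text \<open>Signature (4,1): by Cauchy-Schwarz on the four positive coordinates, orthogonality to a
  negative vector keeps the first coordinate of \<open>x\<close> below the rest.\<close>

lemma neg_perp_pos:
  assumes "Re (herm l l) < 0" "herm x l = 0" "x \<noteq> 0"
  shows "Re (herm x x) > 0"
proof -
  let ?I = "{2, 3, 4, 5 :: 5}"
  define X Y where "X = (\<Sum>i\<in>?I. (cmod (x$i))\<^sup>2)" and "Y = (\<Sum>i\<in>?I. (cmod (l$i))\<^sup>2)"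
  have Y: "Y < (cmod (l$1))\<^sup>2" using assms(1) unfolding herm_self Y_def by simp
  have pos: "X \<ge> 0" "Y \<ge> 0" by (auto simp: X_def Y_def intro!: sum_nonneg)
  have "x$1 * cnj (l$1) = (\<Sum>i\<in>?I. x$i * cnj (l$i))" using assms(2) by (simp add: herm_def)
  hence "cmod (x$1) * cmod (l$1) = cmod (\<Sum>i\<in>?I. x$i * cnj (l$i))" by (metis norm_mult complex_mod_cnj)
  also have "\<dots> \<le> (\<Sum>i\<in>?I. \<bar>cmod (x$i)\<bar> * \<bar>cmod (l$i)\<bar>)"
    by (rule order_trans[OF norm_sum]) (simp add: norm_mult)
  also have "\<dots> \<le> L2_set (\<lambda>i. cmod (x$i)) ?I * L2_set (\<lambda>i. cmod (l$i)) ?I" by (rule L2_set_mult_ineq)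
  finally have "(cmod (x$1) * cmod (l$1))\<^sup>2 \<le> (L2_set (\<lambda>i. cmod (x$i)) ?I * L2_set (\<lambda>i. cmod (l$i)) ?I)\<^sup>2"
    by (rule power_mono) simp
  hence cs: "(cmod (x$1))\<^sup>2 * (cmod (l$1))\<^sup>2 \<le> X * Y"
    unfolding power_mult_distrib L2_set_def X_def Y_def by (simp add: sum_nonneg)
  have xX: "X > 0"
  proof (rule ccontr)
    assume "\<not> X > 0"
    hence X0: "X = 0" using pos by simp
    have z: "x $ i = 0" if "i \<in> ?I" for i
      using X0 that unfolding X_def by (subst (asm) sum_nonneg_eq_0_iff) auto
    have "(cmod (x$1))\<^sup>2 * (cmod (l$1))\<^sup>2 \<le> 0" using cs X0 by simp
    moreover have "(cmod (l$1))\<^sup>2 > 0" using Y pos by linarith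
    ultimately have "x $ 1 = 0" by (simp add: mult_le_0_iff)
    thus False using z assms(3) by (simp add: vec_eq_iff forall_5)
  qed
  have "(cmod (x$1))\<^sup>2 * (cmod (l$1))\<^sup>2 < X * (cmod (l$1))\<^sup>2"
    using cs xX Y by (meson mult_strict_left_mono order_le_less_trans)
  hence "(cmod (x$1))\<^sup>2 < X" by (simp add: mult_less_cancel_right)
  thus ?thesis unfolding herm_self X_def by simp
qed

section \<open>Eigenvectors of the Heisenberg group\<close>

lemma isometry_eigen_orth:
  assumes "A \<in> Lattice_mats" "A *v x = a *s x" "A *v y = b *s y" "a * cnj b \<noteq> 1"
  shows "herm x y = 0"
proof -
  have "herm x y = a * cnj b * herm x y"
    using mats_herm[OF assms(1), of x y] unfolding assms(2,3) herm_scale_left herm_scale_right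
    by (metis mult.assoc mult.left_commute)
  thus ?thesis using assms(4) by (metis mult_cancel_right2)
qed

text \<open>(Z - 1) x is killed by Z^2 + Z + 1, whose roots are \<open>omega\<close> and
  \<open>omega\<^sup>2\<close>; so it, or its image under Z - \<open>omega\<^sup>2\<close>, is an
  eigenvector. \<open>V\<close> stands for an invariant subspace.\<close>

lemma order3_eigenvector:
  assumes Z3: "Z ** (Z ** Z) = mat 1" and x: "Z *v x \<noteq> (x :: complex ^ 5)"
    and V: "\<And>u v. u \<in> V \<Longrightarrow> v \<in> V \<Longrightarrow> u - v \<in> V" "\<And>u c. u \<in> V \<Longrightarrow> c *s u \<in> V"
      "\<And>u. u \<in> V \<Longrightarrow> Z *v u \<in> V" "x \<in> V"
  obtains c y where "c \<in> {omega, omega\<^sup>2}" "y \<noteq> 0" "y \<in> V" "Z *v y = c *s y"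
proof -
  have Z3': "Z *v (Z *v (Z *v u)) = u" for u by (simp add: matrix_vector_mul_assoc Z3)
  define y1 where "y1 = Z *v x - x"
  have y1: "y1 \<noteq> 0" "y1 \<in> V" using x V by (auto simp: y1_def)
  define y2 where "y2 = Z *v y1 - omega\<^sup>2 *s y1"
  have y2V: "y2 \<in> V" using y1 V by (auto simp: y2_def)
  show ?thesis
  proof (cases "y2 = 0")
    case True
    hence "Z *v y1 = omega\<^sup>2 *s y1" by (simp add: y2_def)
    thus ?thesis using that[of "omega\<^sup>2" y1] y1 by blast
  next
    case False
    have "Z *v (Z *v y1) = - y1 - Z *v y1"
      unfolding y1_def by (simp add: matrix_vector_mult_diff_distrib Z3')
    hence "Z *v y2 = omega *s y2"
      unfolding y2_def by (simp add: matrix_vector_mult_diff_distrib vec.scale vec_eq_iff omega_sq omega_simps)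
    thus ?thesis using that[of omega y2] False y2V by blast
  qed
qed

text \<open>Projection, up to the factor 3, onto the \<open>c\<close>-eigenspace of an operator of order 3.\<close>

definition eproj :: "complex ^ 5 ^ 5 \<Rightarrow> complex \<Rightarrow> complex ^ 5 \<Rightarrow> complex ^ 5" where
  "eproj A c x = x + c\<^sup>2 *s (A *v x) + c *s (A *v (A *v x))"

lemma eproj_eigen:
  assumes "A ** (A ** A) = mat 1" "c ^ 3 = 1"
  shows "A *v eproj A c x = c *s eproj A c x"
proof -
  have A3: "A *v (A *v (A *v u)) = u" for u by (simp add: matrix_vector_mul_assoc assms)
  have c: "c * c * c = 1" "c * (c * (c * t)) = t" for t using assms(2) by (simp_all add: power3_eq_cube mult.assoc[symmetric])
  have "A *v eproj A c x = A *v x + c\<^sup>2 *s (A *v (A *v x)) + c *s x"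
    by (simp add: eproj_def matrix_vector_right_distrib vec.scale A3)
  also have "\<dots> = c *s eproj A c x"
    unfolding eproj_def by (simp add: vec_eq_iff power2_eq_square algebra_simps c)
  finally show ?thesis .
qed

lemma eproj_of_eigen: "A *v x = c *s x \<Longrightarrow> c ^ 3 = 1 \<Longrightarrow> eproj A c x = 3 *s x"
proof -
  assume a: "A *v x = c *s x" and "c ^ 3 = 1"
  hence c: "c * (c * c) = 1" "c * (c * (c * t)) = t" for t by (simp_all add: power3_eq_cube mult.assoc[symmetric])
  show ?thesis unfolding eproj_def a vec.scale a
    by (simp add: vec_eq_iff power2_eq_square algebra_simps c)
qed

lemma omega_sq_cube: "(omega\<^sup>2) ^ 3 = 1"
  by (metis omega_cube power_mult power_one mult.commute)

text \<open>\<open>x\<close>, \<open>B x\<close>, \<open>B (B x)\<close> run through the three eigenvalues of \<open>A\<close>.\<close>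

lemma Heisenberg_eigenvectors:
  assumes A: "A \<in> Lattice_mats" "A ** (A ** A) = mat 1" and B: "B \<in> Lattice_mats" "B ** (B ** B) = mat 1"
    and comm: "A ** B = Z ** (B ** A)" "Z ** A = A ** Z" "Z ** B = B ** Z"
    and c: "c \<in> {omega, omega\<^sup>2}" and y: "y \<noteq> 0" "Z *v y = c *s y"
    and V: "\<And>u v. u \<in> V \<Longrightarrow> v \<in> V \<Longrightarrow> u + v \<in> V" "\<And>u d. u \<in> V \<Longrightarrow> d *s u \<in> V"
      "\<And>u. u \<in> V \<Longrightarrow> A *v u \<in> V" "\<And>u. u \<in> V \<Longrightarrow> B *v u \<in> V" "y \<in> V"
  obtains x0 x1 x2 where "\<And>x. x \<in> {x0, x1, x2} \<Longrightarrow> Z *v x = c *s x \<and> x \<noteq> 0 \<and> x \<in> V"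
    "A *v x0 = x0" "A *v x1 = omega *s x1" "A *v x2 = omega\<^sup>2 *s x2"
proof -
  have ZA: "Z *v (A *v u) = A *v (Z *v u)" and ZB: "Z *v (B *v u) = B *v (Z *v u)"
    and AB: "A *v (B *v u) = Z *v (B *v (A *v u))" for u
    by (simp_all add: matrix_vector_mul_assoc comm)
  have w: "omega\<^sup>2 * omega = 1" "omega * omega\<^sup>2 = 1" "omega\<^sup>2 * omega\<^sup>2 = omega" "omega * omega = omega\<^sup>2"
    by (simp_all add: omega_sq omega_simps)
  have w6: "omega ^ 6 = 1" using power_add[of omega 3 3] by simp
  \<comment> \<open>The three projections of \<open>y\<close> add up to 3 y, so they do not all
    vanish.\<close>
  have "\<exists>m\<in>{1, omega, omega\<^sup>2}. eproj A m y \<noteq> 0"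
  proof (rule ccontr)
    assume "\<not> ?thesis"
    hence "eproj A 1 y + eproj A omega y + eproj A (omega\<^sup>2) y = 0" by simp
    also have "eproj A 1 y + eproj A omega y + eproj A (omega\<^sup>2) y = 3 *s y"
      unfolding eproj_def by (simp add: vec_eq_iff omega_sq algebra_simps power2_eq_square omega_mult omega_mult')
    finally show False using y(1) by (simp add: vec_eq_iff)
  qed
  then obtain m where m: "m \<in> {1, omega, omega\<^sup>2}" "eproj A m y \<noteq> 0" by blast
  define x where "x = eproj A m y"
  have m3: "m ^ 3 = 1" using m(1) omega_sq_cube by auto
  have xV: "x \<in> V" unfolding x_def eproj_def by (intro V)
  have Ax: "A *v x = m *s x" unfolding x_def by (rule eproj_eigen[OF A(2) m3])
  have Zx: "Z *v x = c *s x" unfolding x_def eproj_def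
    by (simp add: matrix_vector_right_distrib vec.scale ZA y(2) mult.commute)
  have x0: "x \<noteq> 0" using m(2) by (simp add: x_def)
  have B0: "B *v u \<noteq> 0" if "u \<noteq> 0" for u
    using isometry_inj[OF mats_herm[OF B(1)]] that by (metis injD matrix_vector_mult_0_right)
  have step: "Z *v (B *v u) = c *s (B *v u) \<and> B *v u \<noteq> 0 \<and> B *v u \<in> V \<and> A *v (B *v u) = (c * n) *s (B *v u)"
    if "Z *v u = c *s u" "u \<noteq> 0" "u \<in> V" "A *v u = n *s u" for u n
    using that B0 V ZB AB by (simp add: vec.scale mult.commute)
  note s0 = Zx x0 xV Ax
  define x' where "x' = B *v x"
  define x'' where "x'' = B *v x'"
  have s1: "Z *v x' = c *s x'" "x' \<noteq> 0" "x' \<in> V" "A *v x' = (c * m) *s x'" using step[OF s0] unfolding x'_def by auto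
  have s2: "Z *v x'' = c *s x''" "x'' \<noteq> 0" "x'' \<in> V" "A *v x'' = (c * (c * m)) *s x''" using step[OF s1] unfolding x''_def by auto
  have all: "\<And>v. v \<in> {x, x', x''} \<Longrightarrow> Z *v v = c *s v \<and> v \<noteq> 0 \<and> v \<in> V" using s0 s1 s2 by blast
  consider "m = 1" "c = omega" | "m = omega" "c = omega" | "m = omega\<^sup>2" "c = omega"
    | "m = 1" "c = omega\<^sup>2" | "m = omega" "c = omega\<^sup>2" | "m = omega\<^sup>2" "c = omega\<^sup>2"
    using m(1) c by blast
  thus ?thesis
  proof cases
    case 1 show ?thesis by (rule that[of x x' x'']) (use all Ax s1(4) s2(4) 1 w in auto)
  next
    case 2 show ?thesis by (rule that[of x'' x x']) (use all Ax s1(4) s2(4) 2 w in auto)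
  next
    case 3 show ?thesis by (rule that[of x' x'' x]) (use all Ax s1(4) s2(4) 3 w in auto)
  next
    case 4 show ?thesis by (rule that[of x x'' x']) (use all Ax s1(4) s2(4) 4 w in auto)
  next
    case 5 show ?thesis by (rule that[of x' x x'']) (use all Ax s1(4) s2(4) 5 w in auto)
  next
    case 6 show ?thesis by (rule that[of x'' x' x]) (use all Ax s1(4) s2(4) 6 w w6 in auto)
  qed
qed

lemma isometry_eigen_perp:
  assumes "M \<in> Lattice_mats" "M *v w = a *s w" "a \<noteq> 0" "herm v w = 0"
  shows "herm (M *v v) w = 0"
proof -
  have "cnj a * herm (M *v v) w = 0" using mats_herm[OF assms(1), of v w] assms by (simp add: herm_lin)
  thus ?thesis using assms(3) by simp
qed

text \<open>An eigenspace projection of an isometry is self-adjoint, so pairing with an eigenvector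
  sees only the factor 3.\<close>

lemma herm_eproj:
  assumes A: "A \<in> Lattice_mats" and w: "A *v w = k *s w" and k: "k \<in> {omega, omega\<^sup>2}"
  shows "herm (eproj A k y) w = 3 * herm y w"
proof -
  have "omega * cnj omega = 1" "omega * omega * omega = 1" "omega\<^sup>2 * cnj (omega\<^sup>2) = 1"
    "omega\<^sup>2 * omega\<^sup>2 * omega\<^sup>2 = 1"
    by (simp_all add: omega_sq omega_simps)
  hence kk: "k * cnj k = 1" "k * k * k = 1" using k by blast+
  have s: "cnj k * herm (A *v u) w = herm u w" for u
    using mats_herm[OF A, of u w] unfolding w by (simp add: herm_lin)
  have s': "herm (A *v u) w = k * herm u w" for u
    using arg_cong[OF s[of u], of "\<lambda>t. k * t"] kk(1) by (simp add: mult.assoc[symmetric])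
  have "herm (eproj A k y) w = herm y w + (k * k * k) * herm y w + (k * k * k) * herm y w"
    unfolding eproj_def by (simp add: herm_lin s' power2_eq_square algebra_simps)
  thus ?thesis unfolding kk by simp
qed

lemma eproj_lin: "eproj A c (sum f I) = (\<Sum>i\<in>I. eproj A c (f i))" "eproj A c (d *s x) = d *s eproj A c x"
proof -
  have add: "eproj A c (x + y) = eproj A c x + eproj A c y" for x y
    unfolding eproj_def by (simp add: matrix_vector_right_distrib vec_eq_iff algebra_simps)
  have z: "eproj A c 0 = 0" unfolding eproj_def by simp
  show "eproj A c (sum f I) = (\<Sum>i\<in>I. eproj A c (f i))"
    by (induction I rule: infinite_finite_induct) (simp_all add: add z)
  show "eproj A c (d *s x) = d *s eproj A c x"
    unfolding eproj_def by (simp add: vec.scale vec_eq_iff algebra_simps)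
qed

lemma eproj_Lattice: "A \<in> Lattice_mats \<Longrightarrow> c \<in> eisenstein \<Longrightarrow> x \<in> Lattice \<Longrightarrow> eproj A c x \<in> Lattice"
  unfolding eproj_def by (intro Lattice_add Lattice_scale mats_Lattice eis_power)

text \<open>Three times the projection onto the eigenspace is integral, so the norm of a primitive vector
  divides 3.\<close>

lemma simple_eigenvector_norm:
  assumes A: "A \<in> Lattice_mats" "A ** (A ** A) = mat 1" and k: "k \<in> {omega, omega\<^sup>2}"
    and x: "x \<noteq> 0" "A *v x = k *s x" "Re (herm x x) > 0" and one: "\<And>v. A *v v = k *s v \<Longrightarrow> \<exists>t. v = t *s x"
  obtains w y t where "w \<in> Lattice" "y \<in> Lattice" "herm y w = 1" "w = t *s x" "t \<noteq> 0" "herm w w = 1 \<or> herm w w = 3"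
proof -
  have k3: "k ^ 3 = 1" and kE: "k \<in> eisenstein" using k omega_sq_cube by auto
  have eq: "A *v eproj A k u = k *s eproj A k u" for u by (rule eproj_eigen[OF A(2) k3])
  have "\<exists>j. eproj A k (axis j 1) \<noteq> 0"
  proof (rule ccontr)
    assume "\<not> ?thesis"
    hence "eproj A k (\<Sum>j\<in>UNIV. x $ j *s axis j 1) = 0" by (simp add: eproj_lin)
    hence "eproj A k x = 0" by (simp add: basis_expansion)
    thus False using eproj_of_eigen[OF x(2) k3] x(1) by (simp add: vec_eq_iff)
  qed
  then obtain j where j: "eproj A k (axis j 1) \<noteq> 0" by blast
  have vL: "eproj A k (axis j 1) \<in> Lattice" by (rule eproj_Lattice[OF A(1) kE Lattice_axis])
  obtain c w y where w: "c \<noteq> 0" "w \<in> Lattice" "eproj A k (axis j 1) = c *s w" "y \<in> Lattice" "herm y w = 1"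
    by (rule Lattice_primitive[OF vL j])
  obtain r where r: "eproj A k (axis j 1) = r *s x" using one[OF eq] by blast
  define t where "t = r / c"
  have rz: "r \<noteq> 0" using r j by auto
  have wx: "w = t *s x"
  proof -
    have "c *s w = r *s x" using w(3) r by simp
    thus ?thesis using w(1) by (simp add: t_def vec_eq_iff field_simps)
  qed
  have tz: "t \<noteq> 0" using rz w(1) by (simp add: t_def)
  have Aw: "A *v w = k *s w" unfolding wx by (simp add: vec.scale x(2) mult.commute)
  obtain q where q: "eproj A k y = q *s x" using one[OF eq] by blast
  define p where "p = q / t"
  have pw: "eproj A k y = p *s w" using q tz wx by (simp add: p_def)
  have pE: "p \<in> eisenstein"
  proof -
    have "p *s w \<in> Lattice" using eproj_Lattice[OF A(1) kE w(4)] pw by simp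
    hence "herm y (p *s w) \<in> eisenstein" using w(4) by blast
    thus ?thesis using w(5) by (simp add: herm_lin)
  qed
  have "3 = p * herm w w" using herm_eproj[OF A(1) Aw k, of y] w(5) unfolding pw by (simp add: herm_lin)
  moreover obtain n where n: "herm w w = of_int n" using eis_real[OF herm_Lattice[OF w(2) w(2)] herm_self_real] by blast
  ultimately have pn: "3 = p * of_int n" by simp
  have "Re (herm w w) = (cmod t)\<^sup>2 * Re (herm x x)"
  proof -
    have "herm w w = of_real ((cmod t)\<^sup>2) * herm x x"
      unfolding wx by (simp add: herm_lin complex_norm_square del: of_real_power)
    thus ?thesis by (simp del: of_real_power)
  qed
  hence "Re (herm w w) > 0" using x(3) tz by simp
  hence n0: "n > 0" using n by simp
  have "Im p * of_int n = 0" using arg_cong[OF pn, of Im] by simp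
  hence "Im p = 0" using n0 by simp
  then obtain m where m: "p = of_int m" using eis_real[OF pE] by blast
  have "(of_int (m * n) :: complex) = of_int 3" using pn m by simp
  hence mn: "m * n = 3" by (simp only: of_int_eq_iff)
  hence "n dvd 3" by (metis dvd_triv_right)
  hence "n \<le> 3" by (rule zdvd_imp_le) simp
  moreover have "n \<noteq> 2"
  proof
    assume "n = 2"
    with mn have "m * 2 = 3" by simp
    thus False by presburger
  qed
  ultimately have "n = 1 \<or> n = 3" using n0 by linarith
  thus ?thesis using that[OF w(2,4,5) wx tz] n by auto
qed

context stab_point
begin

text \<open>\<open>Z\<close> is nontrivial on a three-dimensional subspace of the complement of
  \<open>l\<close>. An eigenvalue of \<open>A\<close> that is simple on the whole space yields a
  lattice vector \<open>w1\<close> there, and \<open>B\<close> permutes its translates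
  cyclically.\<close>

lemma Heisenberg_frame:
  assumes no1: "\<And>v. v \<in> Lattice \<Longrightarrow> herm v v = 1 \<Longrightarrow> herm v l \<noteq> 0"
  obtains w1 w2 w3 B y where "w1 \<in> Lattice" "w2 \<in> Lattice" "w3 \<in> Lattice"
    "herm w1 w1 = 3" "herm w2 w2 = 3" "herm w3 w3 = 3" "herm w1 w2 = 0" "herm w1 w3 = 0" "herm w2 w3 = 0"
    "herm w1 l = 0" "herm w2 l = 0" "herm w3 l = 0"
    "B \<in> Lattice_mats" "B *v w1 = w2" "B *v w2 = w3" "B *v w3 = w1" "y \<in> Lattice" "herm y w1 = 1"
    "\<forall>x\<in>Lattice. (herm x w1 / theta) *s w1 + (herm x w2 / theta) *s w2 + (herm x w3 / theta) *s w3 \<in> Lattice"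
proof -
  obtain A B Z where ABZ: "A \<in> Lattice_mats" "B \<in> Lattice_mats" "Z \<in> Lattice_mats"
    "A *v l = l" "B *v l = l" "Z *v l = l"
    "A ** (A ** A) = mat 1" "B ** (B ** B) = mat 1" "Z ** (Z ** Z) = mat 1"
    "A ** B = Z ** (B ** A)" "Z ** A = A ** Z" "Z ** B = B ** Z" "Z \<noteq> mat 1" by (rule lift_Heisenberg)
  have w: "omega\<^sup>2 * omega = 1" "omega * omega\<^sup>2 = 1" "omega\<^sup>2 * omega\<^sup>2 = omega" "omega * omega = omega\<^sup>2"
    "cnj omega = omega\<^sup>2" "cnj (omega\<^sup>2) = omega" "omega\<^sup>2 \<noteq> 1" "omega \<noteq> 1" "omega\<^sup>2 \<noteq> omega"
    by (simp_all add: omega_sq omega_simps power2_eq_square complex_eq_iff)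
  have AB: "A *v (B *v u) = Z *v (B *v (A *v u))" and ZB: "Z *v (B *v u) = B *v (Z *v u)"
    and B3: "B *v (B *v (B *v u)) = u" for u
    by (simp_all add: matrix_vector_mul_assoc ABZ)
  have perp_l: "herm x l = 0" if "Z *v x = c *s x" "c \<in> {omega, omega\<^sup>2}" for x c
    using isometry_eigen_orth[OF ABZ(3) that(1), of l 1] ABZ(6) that(2) w by auto
  have pos: "Re (herm x x) > 0" if "Z *v x = c *s x" "c \<in> {omega, omega\<^sup>2}" "x \<noteq> 0" for x c
    using neg_perp_pos[OF neg perp_l[OF that(1,2)] that(3)] .
  obtain x where "Z *v x \<noteq> x" using ABZ(13) matrix_eq[of Z "mat 1"] by auto
  then obtain c y where cy: "c \<in> {omega, omega\<^sup>2}" "y \<noteq> 0" "Z *v y = c *s y"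
    by (rule order3_eigenvector[OF ABZ(9), of _ UNIV]) auto
  obtain x0 x1 x2 where xs: "\<And>x. x \<in> {x0, x1, x2} \<Longrightarrow> Z *v x = c *s x \<and> x \<noteq> 0 \<and> x \<in> UNIV"
    "A *v x0 = x0" "A *v x1 = omega *s x1" "A *v x2 = omega\<^sup>2 *s x2"
    by (rule Heisenberg_eigenvectors[OF ABZ(1,7,2,8,10,11,12) cy, of UNIV]) auto
  have A1: "A *v l = 1 *s l" "A *v x0 = 1 *s x0" using ABZ(4) xs(2) by simp_all
  \<comment> \<open>The eigenvalue 1 is already taken twice, by \<open>l\<close> and
    \<open>x0\<close>. If neither of the other two were simple, further eigenvectors
    \<open>p'\<close> and \<open>q'\<close> would bring the orthogonal family to six.\<close>
  have one: "(\<forall>v. A *v v = omega *s v \<longrightarrow> (\<exists>t. v = t *s x1)) \<or> (\<forall>v. A *v v = omega\<^sup>2 *s v \<longrightarrow> (\<exists>t. v = t *s x2))"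
  proof (rule ccontr)
    assume "\<not> ?thesis"
    then obtain p q where pq: "A *v p = omega *s p" "\<And>t. p \<noteq> t *s x1" "A *v q = omega\<^sup>2 *s q" "\<And>t. q \<noteq> t *s x2" by blast
    define p' where "p' = p - (herm p x1 / herm x1 x1) *s x1"
    define q' where "q' = q - (herm q x2 / herm x2 x2) *s x2"
    have n1: "herm x1 x1 \<noteq> 0" using pos[of x1 c] xs(1)[of x1] cy(1) by auto
    have n2: "herm x2 x2 \<noteq> 0" using pos[of x2 c] xs(1)[of x2] cy(1) by auto
    have n0: "herm x0 x0 \<noteq> 0" using pos[of x0 c] xs(1)[of x0] cy(1) by auto
    have Ap: "A *v p' = omega *s p'" and Aq: "A *v q' = omega\<^sup>2 *s q'"
      unfolding p'_def q'_def using pq(1,3) xs(3,4) by (simp_all add: matrix_vector_mult_diff_distrib vec.scale vec_eq_iff algebra_simps)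
    have p0: "p' \<noteq> 0" "q' \<noteq> 0" using pq(2,4) by (auto simp: p'_def q'_def)
    have o: "herm p' x1 = 0" "herm q' x2 = 0" using n1 n2 by (simp_all add: p'_def q'_def herm_lin)
    note eo = isometry_eigen_orth[OF ABZ(1)]
    have pl: "herm p' l = 0" "herm q' l = 0" using eo[OF Ap A1(1)] eo[OF Aq A1(1)] w by simp_all
    have np: "herm p' p' \<noteq> 0" "herm q' q' \<noteq> 0" using neg_perp_pos[OF neg pl(1) p0(1)] neg_perp_pos[OF neg pl(2) p0(2)] by auto
    show False
    proof (rule no_six_orthogonal[of l x0 x1 x2 p' q'])
      show "herm l l \<noteq> 0" using neg by auto
      show "herm x0 l = 0" "herm x1 l = 0" "herm x2 l = 0" using perp_l xs(1) cy(1) by blast+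
      show "herm x1 x0 = 0" "herm x2 x0 = 0" "herm x2 x1 = 0"
        using eo[OF xs(3) A1(2)] eo[OF xs(4) A1(2)] eo[OF xs(4) xs(3)] w by simp_all
      show "herm p' x0 = 0" "herm p' x2 = 0" "herm q' x0 = 0" "herm q' x1 = 0" "herm q' p' = 0"
        using eo[OF Ap A1(2)] eo[OF Ap xs(4)] eo[OF Aq A1(2)] eo[OF Aq xs(3)] eo[OF Aq Ap] w by simp_all
    qed (use n0 n1 n2 np pl o in auto)
  qed
  have "\<exists>k x. k \<in> {omega, omega\<^sup>2} \<and> x \<in> {x0, x1, x2} \<and> A *v x = k *s x \<and> (\<forall>v. A *v v = k *s v \<longrightarrow> (\<exists>t. v = t *s x))"
    using one xs(3,4) by blast
  then obtain k x where kx: "k \<in> {omega, omega\<^sup>2}" "x \<in> {x0, x1, x2}" "A *v x = k *s x"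
    "\<And>v. A *v v = k *s v \<Longrightarrow> \<exists>t. v = t *s x" by blast
  have Zx: "Z *v x = c *s x" "x \<noteq> 0" using xs(1)[OF kx(2)] by auto
  obtain w1 y t where w1: "w1 \<in> Lattice" "y \<in> Lattice" "herm y w1 = 1" "w1 = t *s x" "t \<noteq> 0" "herm w1 w1 = 1 \<or> herm w1 w1 = 3"
    by (rule simple_eigenvector_norm[OF ABZ(1,7) kx(1) Zx(2) kx(3) pos[OF Zx(1) cy(1) Zx(2)] kx(4)])
  define w2 where "w2 = B *v w1"
  define w3 where "w3 = B *v w2"
  have Z1: "Z *v w1 = c *s w1" unfolding w1(4) by (simp add: vec.scale Zx mult.commute)
  have Z2: "Z *v w2 = c *s w2" unfolding w2_def ZB Z1 by (simp add: vec.scale)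
  have Z3: "Z *v w3 = c *s w3" unfolding w3_def ZB Z2 by (simp add: vec.scale)
  have a1: "A *v w1 = k *s w1" unfolding w1(4) by (simp add: vec.scale kx(3) mult.commute)
  have a2: "A *v w2 = (c * k) *s w2" unfolding w2_def AB a1 by (simp add: vec.scale Z2[unfolded w2_def] mult.commute)
  have a3: "A *v w3 = (c * (c * k)) *s w3" unfolding w3_def AB a2 by (simp add: vec.scale Z3[unfolded w3_def] mult.commute)
  have B1: "B *v w3 = w1" unfolding w3_def w2_def by (rule B3)
  have wl: "herm w1 l = 0" "herm w2 l = 0" "herm w3 l = 0" using perp_l Z1 Z2 Z3 cy(1) by blast+
  \<comment> \<open>The alternative norm 1 is impossible for a vector orthogonal to
    \<open>l\<close>.\<close>
  have n1: "herm w1 w1 = 3" using no1[OF w1(1)] w1(6) wl(1) by blast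
  have n2: "herm w2 w2 = 3" unfolding w2_def mats_herm[OF ABZ(2)] by (rule n1)
  have n3: "herm w3 w3 = 3" unfolding w3_def mats_herm[OF ABZ(2)] by (rule n2)
  note eo = isometry_eigen_orth[OF ABZ(1)]
  have o12: "herm w1 w2 = 0" by (rule eo[OF a1 a2]) (use kx(1) cy(1) w in auto)
  have o23: "herm w2 w3 = 0" unfolding w2_def w3_def mats_herm[OF ABZ(2)] using o12 by (simp add: w2_def)
  have o13: "herm w1 w3 = 0" by (rule eo[OF a1 a3]) (use kx(1) cy(1) w in \<open>auto simp: mult.assoc[symmetric]\<close>)
  have wL: "w2 \<in> Lattice" "w3 \<in> Lattice" unfolding w3_def w2_def using w1(1) mats_Lattice[OF ABZ(2)] by auto
  have knz: "k \<noteq> 0" "c \<noteq> 0" using kx(1) cy(1) by auto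
  \<comment> \<open>Otherwise the complement of the frame would contain a second triple of
    eigenvectors of \<open>A\<close>; two of them with \<open>l\<close>, \<open>w1\<close>,
    \<open>w2\<close>, \<open>w3\<close> would be six orthogonal vectors.\<close>
  have Ztriv: "Z *v u = u" if u: "herm u w1 = 0" "herm u w2 = 0" "herm u w3 = 0" for u
  proof (rule ccontr)
    assume nu: "Z *v u \<noteq> u"
    define V where "V = {v. herm v w1 = 0 \<and> herm v w2 = 0 \<and> herm v w3 = 0}"
    have VZ: "Z *v v \<in> V" if "v \<in> V" for v
      using that isometry_eigen_perp[OF ABZ(3) Z1] isometry_eigen_perp[OF ABZ(3) Z2] isometry_eigen_perp[OF ABZ(3) Z3] knz by (simp add: V_def)
    have VA: "A *v v \<in> V" if "v \<in> V" for v
      using that isometry_eigen_perp[OF ABZ(1) a1] isometry_eigen_perp[OF ABZ(1) a2] isometry_eigen_perp[OF ABZ(1) a3] knz by (simp add: V_def)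
    have VB: "B *v v \<in> V" if "v \<in> V" for v
    proof -
      have "herm (B *v v) w2 = herm v w1" "herm (B *v v) w3 = herm v w2" "herm (B *v v) w1 = herm v w3"
        using mats_herm[OF ABZ(2), of v w1] mats_herm[OF ABZ(2), of v w2] mats_herm[OF ABZ(2), of v w3] B1
        by (simp_all add: w2_def w3_def)
      thus ?thesis using that by (simp add: V_def)
    qed
    have uV: "u \<in> V" using u by (simp add: V_def)
    obtain c' y' where c': "c' \<in> {omega, omega\<^sup>2}" "y' \<noteq> 0" "y' \<in> V" "Z *v y' = c' *s y'"
      by (rule order3_eigenvector[OF ABZ(9) nu, of V]) (use uV VZ in \<open>auto simp: V_def herm_lin\<close>)
    obtain z0 z1 z2 where zs: "\<And>x. x \<in> {z0, z1, z2} \<Longrightarrow> Z *v x = c' *s x \<and> x \<noteq> 0 \<and> x \<in> V"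
      "A *v z0 = z0" "A *v z1 = omega *s z1" "A *v z2 = omega\<^sup>2 *s z2"
      by (rule Heisenberg_eigenvectors[OF ABZ(1,7,2,8,10,11,12) c'(1,2,4), of V]) (use c'(3) VA VB in \<open>auto simp: V_def herm_lin\<close>)
    have A0: "A *v z0 = 1 *s z0" using zs(2) by simp
    show False
    proof (rule no_six_orthogonal[of l w1 w2 w3 z0 z1])
      show "herm l l \<noteq> 0" using neg by auto
      show "herm z0 z0 \<noteq> 0" "herm z1 z1 \<noteq> 0" using pos[of z0 c'] pos[of z1 c'] zs(1) c'(1) by auto
      show "herm z0 l = 0" "herm z1 l = 0" using perp_l zs(1) c'(1) by blast+
      show "herm z1 z0 = 0" using eo[OF zs(3) A0] w by simp
      show "herm z0 w1 = 0" "herm z0 w2 = 0" "herm z0 w3 = 0" "herm z1 w1 = 0" "herm z1 w2 = 0" "herm z1 w3 = 0"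
        using zs(1)[of z0] zs(1)[of z1] by (auto simp: V_def)
      show "herm w2 w1 = 0" "herm w3 w1 = 0" "herm w3 w2 = 0" using o12 o13 o23 herm_eq_0_sym by blast+
    qed (use n1 n2 n3 wl in auto)
  qed
  \<comment> \<open>Because \<open>Z\<close> is \<open>c\<close> on the frame and 1 on its
    complement, Z x - x is c - 1 times the projection \<open>p\<close> of \<open>x\<close> to the
    frame. As c - 1 and 3 / theta differ by a unit, (3 / theta) p is a lattice vector.\<close>
  have star: "(herm x w1 / theta) *s w1 + (herm x w2 / theta) *s w2 + (herm x w3 / theta) *s w3 \<in> Lattice" if x: "x \<in> Lattice" for x
  proof -
    define p where "p = (herm x w1 / 3) *s w1 + (herm x w2 / 3) *s w2 + (herm x w3 / 3) *s w3"
    have o: "herm w2 w1 = 0" "herm w3 w1 = 0" "herm w3 w2 = 0" using o12 o13 o23 herm_eq_0_sym by blast+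
    have "Z *v (x - p) = x - p"
      by (rule Ztriv) (simp_all add: p_def herm_lin n1 n2 n3 o12 o13 o23 o)
    moreover have "Z *v p = c *s p"
      unfolding p_def by (simp add: matrix_vector_right_distrib vec.scale Z1 Z2 Z3 mult.commute)
    ultimately have "Z *v x - x = (c - 1) *s p"
      by (simp add: matrix_vector_mult_diff_distrib algebra_simps)
    hence pL: "(c - 1) *s p \<in> Lattice" using Lattice_diff[OF mats_Lattice[OF ABZ(3) x] x] by simp
    have "omega * (omega - 1) = 3 / theta" "- (omega\<^sup>2) * (omega\<^sup>2 - 1) = 3 / theta"
      unfolding div_theta by (simp_all add: theta_eq omega_sq omega_simps)
    moreover have "- (omega\<^sup>2) \<in> eisenstein" by auto
    ultimately obtain r where r: "r \<in> eisenstein" "r * (c - 1) = 3 / theta" using cy(1) eis_omega by blast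
    have "r *s ((c - 1) *s p) \<in> Lattice" using r(1) pL by blast
    also have "r *s ((c - 1) *s p) = (3 / theta) *s p" unfolding vector_smult_assoc r(2) ..
    also have "\<dots> = (herm x w1 / theta) *s w1 + (herm x w2 / theta) *s w2 + (herm x w3 / theta) *s w3"
      unfolding p_def by (simp add: vec_eq_iff field_simps)
    finally show ?thesis .
  qed
  show ?thesis
    using that[OF w1(1) wL n1 n2 n3 o12 o13 o23 wl ABZ(2) w2_def[symmetric] w3_def[symmetric] B1 w1(2,3)] star by blast
qed

end

section \<open>The root lattice spanned by a Heisenberg frame\<close>

text \<open>\<open>J\<close> is the isometric embedding of the hermitian space \<open>\<complex>\<^sup>3\<close> that sends the standard basis to the
  orthonormal vectors \<open>w\<^sub>i / \<theta>\<close>.\<close>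

locale Heisenberg_frame =
  fixes l w1 w2 w3 :: "complex ^ 5" and B :: "complex ^ 5 ^ 5" and y :: "complex ^ 5"
  assumes neg: "Re (herm l l) < 0"
    and no1: "\<And>v. v \<in> Lattice \<Longrightarrow> herm v v = 1 \<Longrightarrow> herm v l \<noteq> 0"
    and wL: "w1 \<in> Lattice" "w2 \<in> Lattice" "w3 \<in> Lattice"
    and wn: "herm w1 w1 = 3" "herm w2 w2 = 3" "herm w3 w3 = 3"
    and wo: "herm w1 w2 = 0" "herm w1 w3 = 0" "herm w2 w3 = 0"
    and wl: "herm w1 l = 0" "herm w2 l = 0" "herm w3 l = 0"
    and B: "B \<in> Lattice_mats" "B *v w1 = w2" "B *v w2 = w3" "B *v w3 = w1"
    and y: "y \<in> Lattice" "herm y w1 = 1"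
    and star: "\<And>x. x \<in> Lattice \<Longrightarrow>
      (herm x w1 / theta) *s w1 + (herm x w2 / theta) *s w2 + (herm x w3 / theta) *s w3 \<in> Lattice"
begin

definition J :: "complex ^ 3 \<Rightarrow> complex ^ 5" where
  "J a = (a $ 1 / theta) *s w1 + (a $ 2 / theta) *s w2 + (a $ 3 / theta) *s w3"

abbreviation v3 :: "complex \<Rightarrow> complex \<Rightarrow> complex \<Rightarrow> complex ^ 3" where
  "v3 a b c \<equiv> vector [a, b, c]"

lemma wo': "herm w2 w1 = 0" "herm w3 w1 = 0" "herm w3 w2 = 0"
  using wo herm_eq_0_sym by blast+

lemma J_lin: "J (a + b) = J a + J b" "J (a - b) = J a - J b" "J (c *s a) = c *s J a" "J (- a) = - J a"
  by (simp_all add: J_def vec_eq_iff algebra_simps add_divide_distrib diff_divide_distrib)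

lemma herm_J_J: "herm (J a) (J b) = hdot a b"
  unfolding J_def hdot_def
  by (simp only: herm_lin wn wo wo') (simp add: algebra_simps theta_sq)

lemma herm_J_l: "herm (J a) l = 0"
  by (simp add: J_def herm_lin wl)

lemma B_J: "B *v J (v3 a b c) = J (v3 c a b)"
  by (simp add: J_def matrix_vector_right_distrib vec.scale B vec_eq_iff algebra_simps)

lemma J_theta_Lattice: "(\<And>i. a $ i \<in> eisenstein) \<Longrightarrow> J (theta *s a) \<in> Lattice"
  unfolding J_def using wL by (auto intro!: Lattice_add Lattice_scale)

lemma J_axis_not_Lattice: "J (v3 1 0 0) \<notin> Lattice"
proof
  assume "J (v3 1 0 0) \<in> Lattice"
  moreover have "herm (J (v3 1 0 0)) (J (v3 1 0 0)) = 1" by (simp add: herm_J_J hdot_def)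
  ultimately show False using no1 herm_J_l by blast
qed

lemma herm_J: "herm x (J a) = - (cnj (a$1) * herm x w1 + cnj (a$2) * herm x w2 + cnj (a$3) * herm x w3) / theta"
  by (simp add: J_def herm_lin add_divide_distrib diff_divide_distrib)

text \<open>The glue of the frame as a ternary code: multiples of \<open>theta\<close> always give
  lattice vectors, so membership depends only on residues modulo 3, and \<open>B\<close> makes the
  code cyclic.\<close>

definition code :: "int \<Rightarrow> int \<Rightarrow> int \<Rightarrow> bool" where
  "code p q r \<longleftrightarrow> J (v3 (of_int p) (of_int q) (of_int r)) \<in> Lattice"

lemma v3_arith: "v3 a b c + v3 a' b' c' = v3 (a + a') (b + b') (c + c')" "v3 a b c - v3 a' b' c' = v3 (a - a') (b - b') (c - c')"
  "- v3 a b c = v3 (- a) (- b) (- c)" "d *s v3 a b c = v3 (d * a) (d * b) (d * c)"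
  by (simp_all add: vec_eq_iff forall_3)

lemma code_add: "code p q r \<Longrightarrow> code p' q' r' \<Longrightarrow> code (p + p') (q + q') (r + r')"
  using Lattice_add unfolding code_def of_int_add v3_arith(1)[symmetric] J_lin by blast

lemma code_neg: "code p q r \<Longrightarrow> code (- p) (- q) (- r)"
  using Lattice_uminus unfolding code_def of_int_minus v3_arith(3)[symmetric] J_lin by blast

lemma code_cyc1: "code p q r \<Longrightarrow> code r p q"
  using mats_Lattice[OF B(1)] B_J unfolding code_def by metis

lemma code_cyc: "code r p q \<longleftrightarrow> code p q r"
  using code_cyc1 by blast

lemma code_theta:
  assumes "a = theta * a'" "b = theta * b'" "c = theta * c'" "a' \<in> eisenstein" "b' \<in> eisenstein" "c' \<in> eisenstein"
  shows "J (v3 a b c) \<in> Lattice"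
proof -
  have "J (theta *s v3 a' b' c') \<in> Lattice"
  proof (rule J_theta_Lattice)
    fix i show "v3 a' b' c' $ i \<in> eisenstein" using exhaust_3[of i] assms by auto
  qed
  thus ?thesis using assms by (simp add: v3_arith)
qed

lemma code_3: "code (3 * p) (3 * q) (3 * r)"
  unfolding code_def
  by (rule code_theta[of _ "- theta * of_int p" _ "- theta * of_int q" _ "- theta * of_int r"])
     (auto simp: theta_sq' intro!: eis_mult)

lemma code_mod: "code p q r \<Longrightarrow> code (p mod 3) (q mod 3) (r mod 3)"
proof -
  assume "code p q r"
  from code_add[OF this code_3[of "- (p div 3)" "- (q div 3)" "- (r div 3)"]]
  show ?thesis by (simp add: minus_mult_div_eq_mod[symmetric])
qed

text \<open>A word of weight one would be a norm 1 vector orthogonal to \<open>l\<close>. The other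
  words produce one together with their shifts: (1,1,0) + (1,0,1) - (0,1,1) = (2,0,0), and (1,1,2) +
  (2,1,1) reduces to (0,2,0).\<close>

lemma code_not_units:
  shows "\<not> code 1 0 0" "\<not> code 2 0 0" "\<not> code 1 1 0" "\<not> code 2 2 0" "\<not> code 1 1 2" "\<not> code 2 2 1"
proof -
  show 1: "\<not> code 1 0 0" unfolding code_def using J_axis_not_Lattice by simp
  show 2: "\<not> code 2 0 0" using 1 code_mod[of "-2" 0 0] code_neg[of 2 0 0] by auto
  show 3: "\<not> code 1 1 0"
  proof
    assume c: "code 1 1 0"
    have d: "code 0 1 1" "code 1 0 1" using c code_cyc1 by blast+
    show False using 2 code_add[OF code_add[OF c d(2)] code_neg[OF d(1)]] by simp
  qed
  show "\<not> code 2 2 0" using 3 code_mod[of "-2" "-2" 0] code_neg[of 2 2 0] by auto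
  show 4: "\<not> code 1 1 2"
  proof
    assume c: "code 1 1 2"
    have "code 3 2 3" using code_add[OF c code_cyc1[OF c]] by simp
    hence "code 0 2 0" using code_mod by fastforce
    thus False using 2 code_cyc1 by blast
  qed
  show "\<not> code 2 2 1" using 4 code_mod[of "-2" "-2" "-1"] code_neg[of 2 2 1] by auto
qed

text \<open>Up to cyclic shifts and sign, \<open>code_not_units\<close> rules out every nonconstant
  word except (1,2,0).\<close>

lemma code_not_diag:
  assumes "code p q r" "p \<in> {0, 1, 2}" "q \<in> {0, 1, 2}" "r \<in> {0, 1, 2}" "\<not> (p = q \<and> q = r)"
  shows "code 1 2 0"
proof -
  have c: "code 0 1 0 = code 1 0 0" "code 0 0 1 = code 1 0 0" "code 0 2 0 = code 2 0 0" "code 0 0 2 = code 2 0 0"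
    "code 0 1 1 = code 1 1 0" "code 1 0 1 = code 1 1 0" "code 0 2 2 = code 2 2 0" "code 2 0 2 = code 2 2 0"
    "code 0 1 2 = code 1 2 0" "code 2 0 1 = code 1 2 0" "code 1 0 2 = code 2 1 0" "code 0 2 1 = code 2 1 0"
    "code 1 2 1 = code 1 1 2" "code 2 1 1 = code 1 1 2" "code 2 1 2 = code 2 2 1" "code 1 2 2 = code 2 2 1"
    using code_cyc by blast+
  have d: "code 2 1 0 \<Longrightarrow> code 1 2 0" using code_mod[of "-2" "-1" 0] code_neg[of 2 1 0] by auto
  show ?thesis using assms code_not_units c d by auto
qed

lemma eis_mod_theta_int:
  assumes "x \<in> eisenstein"
  obtains k z where "k \<in> {0, 1, 2}" "z \<in> eisenstein" "x = of_int k + theta * z"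
proof -
  obtain k z where kz: "k \<in> {0, 1, -1}" "z \<in> eisenstein" "x = k + theta * z" by (rule eis_mod_theta[OF assms])
  show ?thesis
  proof (cases "k = -1")
    case True
    \<comment> \<open>Uses -1 = 2 + theta^2.\<close>
    show ?thesis by (rule that[of 2 "z + theta"]) (use kz True in \<open>auto simp: algebra_simps theta_sq\<close>)
  next
    case False
    hence "k = of_int 0 \<or> k = of_int 1" using kz(1) by auto
    thus ?thesis using that[of 0 z] that[of 1 z] kz by auto
  qed
qed

text \<open>By \<open>star\<close>, the pairings of a lattice vector with the frame are the
  coordinates of a lattice vector; discarding their multiples of \<open>theta\<close> leaves a
  codeword.\<close>

lemma code_of_Lattice:
  assumes "x \<in> Lattice" "herm x w1 = of_int p + theta * a" "herm x w2 = of_int q + theta * b" "herm x w3 = of_int r + theta * c"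
    "a \<in> eisenstein" "b \<in> eisenstein" "c \<in> eisenstein"
  shows "code p q r"
proof -
  have "J (v3 (herm x w1) (herm x w2) (herm x w3)) \<in> Lattice" using star[OF assms(1)] by (simp add: J_def)
  hence "J (v3 (herm x w1) (herm x w2) (herm x w3)) - J (v3 (theta * a) (theta * b) (theta * c)) \<in> Lattice"
    using code_theta[OF refl refl refl assms(5-7)] by blast
  thus ?thesis unfolding code_def J_lin(2)[symmetric] v3_arith assms(2-4) by simp
qed

text \<open>The code contains its dual modulo \<open>\<theta>\<close> because the lattice is unimodular; without words of weight one
  it can then only be the zero-sum code.\<close>

lemma code_root: "J (v3 1 (-1) 0) \<in> Lattice"
proof -
  have h: "herm x w1 \<in> eisenstein" "herm x w2 \<in> eisenstein" "herm x w3 \<in> eisenstein" if "x \<in> Lattice" for x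
    using that wL by blast+
  have e1: "herm y w1 = of_int 1 + theta * 0" using y(2) by simp
  obtain q b where q: "q \<in> {0, 1, 2}" "b \<in> eisenstein" "herm y w2 = of_int q + theta * b"
    by (rule eis_mod_theta_int[OF h(2)[OF y(1)]])
  obtain r c where r: "r \<in> {0, 1, 2}" "c \<in> eisenstein" "herm y w3 = of_int r + theta * c"
    by (rule eis_mod_theta_int[OF h(3)[OF y(1)]])
  have c1: "code 1 q r" by (rule code_of_Lattice[OF y(1) e1 q(3) r(3) eis_0 q(2) r(2)])
  have "code 1 2 0 \<or> J (v3 1 (-1) 0) \<in> Lattice"
  proof (cases "q = 1 \<and> r = 1")
    case False
    thus ?thesis using code_not_diag[OF c1 _ q(1) r(1)] by auto
  next
    case True
    \<comment> \<open>The constant word decides nothing. Either every lattice vector pairs with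
      \<open>w1\<close> and \<open>w2\<close> alike modulo \<open>theta\<close>, and (w1 - w2)/theta
      is in the dual, or some vector yields a nonconstant word.\<close>
    show ?thesis
    proof (cases "\<forall>x\<in>Lattice. \<exists>t\<in>eisenstein. herm x w1 - herm x w2 = theta * t")
      case all: True
      have "J (v3 1 (-1) 0) \<in> Lattice"
      proof (rule Lattice_unimodular')
        fix x assume "x \<in> Lattice"
        then obtain t where t: "t \<in> eisenstein" "herm x w1 - herm x w2 = theta * t" using all by blast
        have "herm x (J (v3 1 (-1) 0)) = - (herm x w1 - herm x w2) / theta" by (simp add: herm_J)
        also have "\<dots> = - t" unfolding t(2) by simp
        finally show "herm x (J (v3 1 (-1) 0)) \<in> eisenstein" using t(1) by simp
      qed
      thus ?thesis ..
    next
      case False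
      then obtain x where x: "x \<in> Lattice" "\<And>t. t \<in> eisenstein \<Longrightarrow> herm x w1 - herm x w2 \<noteq> theta * t" by blast
      obtain p a where p: "p \<in> {0, 1, 2}" "a \<in> eisenstein" "herm x w1 = of_int p + theta * a"
        by (rule eis_mod_theta_int[OF h(1)[OF x(1)]])
      obtain q b where q: "q \<in> {0, 1, 2}" "b \<in> eisenstein" "herm x w2 = of_int q + theta * b"
        by (rule eis_mod_theta_int[OF h(2)[OF x(1)]])
      obtain r c where r: "r \<in> {0, 1, 2}" "c \<in> eisenstein" "herm x w3 = of_int r + theta * c"
        by (rule eis_mod_theta_int[OF h(3)[OF x(1)]])
      have "code p q r" by (rule code_of_Lattice[OF x(1) p(3) q(3) r(3) p(2) q(2) r(2)])
      moreover have "p \<noteq> q" using x(2)[of "a - b"] p q by (auto simp: algebra_simps)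
      ultimately show ?thesis using code_not_diag[OF _ p(1) q(1) r(1)] by blast
    qed
  qed
  moreover have "J (v3 1 (-1) 0) \<in> Lattice" if "code 1 2 0"
    using code_add[OF that code_3[of 0 "-1" 0]] by (simp add: code_def)
  ultimately show ?thesis by blast
qed

text \<open>Integral triples with sum divisible by \<open>theta\<close> are generated by the roots
  (1,-1,0), (0,1,-1) and the vector (0,0,theta).\<close>

lemma J_W_Lattice:
  assumes "a \<in> eisenstein" "b \<in> eisenstein" "c \<in> eisenstein" "a + b + c = theta * t" "t \<in> eisenstein"
  shows "J (v3 a b c) \<in> Lattice"
proof -
  have r2: "J (v3 0 1 (-1)) \<in> Lattice" using mats_Lattice[OF B(1) code_root] by (simp add: B_J)
  have "v3 a b c = a *s v3 1 (-1) 0 + (a + b) *s v3 0 1 (-1) + v3 0 0 (a + b + c)"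
    by (simp add: vec_eq_iff forall_3)
  moreover have "J (v3 0 0 (a + b + c)) \<in> Lattice"
    by (rule code_theta[of _ 0 _ 0 _ t]) (use assms in auto)
  ultimately show ?thesis using code_root r2 assms by (auto simp: J_lin intro!: Lattice_add Lattice_scale)
qed

end

section \<open>A null vector orthogonal to the frame\<close>

text \<open>The field \<rat>(\<omega>), as the numbers with an Eisenstein denominator.\<close>

definition Eis_field :: "complex set" where
  "Eis_field = {x. \<exists>d\<in>eisenstein. d \<noteq> 0 \<and> d * x \<in> eisenstein}"

lemma Eis_field_eis: "x \<in> eisenstein \<Longrightarrow> x \<in> Eis_field"
  unfolding Eis_field_def by (auto intro!: bexI[of _ 1])

lemma Eis_field_add: "x \<in> Eis_field \<Longrightarrow> y \<in> Eis_field \<Longrightarrow> x + y \<in> Eis_field"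
proof -
  assume "x \<in> Eis_field" "y \<in> Eis_field"
  then obtain d e where de: "d \<in> eisenstein" "d \<noteq> 0" "d * x \<in> eisenstein" "e \<in> eisenstein" "e \<noteq> 0" "e * y \<in> eisenstein"
    unfolding Eis_field_def by blast
  have "(d * e) * (x + y) = e * (d * x) + d * (e * y)" by (simp add: algebra_simps)
  also have "\<dots> \<in> eisenstein" using de by blast
  finally show ?thesis unfolding Eis_field_def using de by (auto intro!: bexI[of _ "d * e"])
qed

lemma Eis_field_mult: "x \<in> Eis_field \<Longrightarrow> y \<in> Eis_field \<Longrightarrow> x * y \<in> Eis_field"
proof -
  assume "x \<in> Eis_field" "y \<in> Eis_field"
  then obtain d e where de: "d \<in> eisenstein" "d \<noteq> 0" "d * x \<in> eisenstein" "e \<in> eisenstein" "e \<noteq> 0" "e * y \<in> eisenstein"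
    unfolding Eis_field_def by blast
  have "(d * e) * (x * y) = (d * x) * (e * y)" by (simp add: algebra_simps)
  also have "\<dots> \<in> eisenstein" using de by blast
  finally show ?thesis unfolding Eis_field_def using de by (auto intro!: bexI[of _ "d * e"])
qed

lemma Eis_field_minus: "x \<in> Eis_field \<Longrightarrow> - x \<in> Eis_field"
  unfolding Eis_field_def by auto

lemma Eis_field_diff: "x \<in> Eis_field \<Longrightarrow> y \<in> Eis_field \<Longrightarrow> x - y \<in> Eis_field"
  using Eis_field_add[of x "- y"] Eis_field_minus by simp

lemma Eis_field_cnj: "x \<in> Eis_field \<Longrightarrow> cnj x \<in> Eis_field"
proof -
  assume "x \<in> Eis_field"
  then obtain d where d: "d \<in> eisenstein" "d \<noteq> 0" "d * x \<in> eisenstein" unfolding Eis_field_def by blast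
  hence "cnj d * cnj x \<in> eisenstein" by (metis complex_cnj_mult eis_cnj)
  thus ?thesis unfolding Eis_field_def using d by (auto intro!: bexI[of _ "cnj d"])
qed

lemma Eis_field_inverse: "x \<in> Eis_field \<Longrightarrow> inverse x \<in> Eis_field"
proof (cases "x = 0")
  case True thus ?thesis using Eis_field_eis eis_0 by simp
next
  case False
  assume "x \<in> Eis_field"
  then obtain d where d: "d \<in> eisenstein" "d \<noteq> 0" "d * x \<in> eisenstein" unfolding Eis_field_def by blast
  have "(d * x) * inverse x = d" using False by simp
  hence "(d * x) * inverse x \<in> eisenstein" using d(1) by (simp only:)
  thus ?thesis unfolding Eis_field_def using d False by (auto intro!: bexI[of _ "d * x"])
qed

definition Eis_space :: "(complex ^ 5) set" where
  "Eis_space = {x. \<forall>i. x $ i \<in> Eis_field}"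

lemma Lattice_Eis_space: "x \<in> Lattice \<Longrightarrow> x \<in> Eis_space"
  by (simp add: Eis_space_def Lattice_def Eis_field_eis)

lemma Eis_space_add: "x \<in> Eis_space \<Longrightarrow> y \<in> Eis_space \<Longrightarrow> x + y \<in> Eis_space"
  and Eis_space_diff: "x \<in> Eis_space \<Longrightarrow> y \<in> Eis_space \<Longrightarrow> x - y \<in> Eis_space"
  and Eis_space_scale: "c \<in> Eis_field \<Longrightarrow> x \<in> Eis_space \<Longrightarrow> c *s x \<in> Eis_space"
  by (simp_all add: Eis_space_def Eis_field_add Eis_field_diff Eis_field_mult)

lemma herm_Eis_space: "x \<in> Eis_space \<Longrightarrow> y \<in> Eis_space \<Longrightarrow> herm x y \<in> Eis_field"
  unfolding herm_eq by (intro Eis_field_add Eis_field_mult Eis_field_minus Eis_field_cnj) (auto simp: Eis_space_def)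

lemma Eis_space_denominator:
  assumes "x \<in> Eis_space"
  obtains d where "d \<noteq> 0" "d *s x \<in> Lattice"
proof -
  have "\<forall>i. \<exists>d. d \<in> eisenstein \<and> d \<noteq> 0 \<and> d * x $ i \<in> eisenstein"
    using assms by (auto simp: Eis_space_def Eis_field_def)
  hence "\<exists>d. \<forall>i. d i \<in> eisenstein \<and> d i \<noteq> 0 \<and> d i * x $ i \<in> eisenstein" by (rule choice)
  then obtain d :: "5 \<Rightarrow> complex" where d: "\<And>i. d i \<in> eisenstein" "\<And>i. d i \<noteq> 0" "\<And>i. d i * x $ i \<in> eisenstein" by blast
  have "(\<Prod>i\<in>UNIV. d i) *s x \<in> Lattice"
  proof (rule LatticeI)
    fix i
    have "(\<Prod>i\<in>UNIV. d i) = d i * (\<Prod>j\<in>UNIV - {i}. d j)" by (simp add: prod.remove)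
    hence "((\<Prod>i\<in>UNIV. d i) *s x) $ i = (\<Prod>j\<in>UNIV - {i}. d j) * (d i * x $ i)" by simp
    also have "\<dots> \<in> eisenstein" by (intro eis_mult[OF eis_prod d(3)] d(1))
    finally show "((\<Prod>i\<in>UNIV. d i) *s x) $ i \<in> eisenstein" .
  qed
  thus ?thesis using that[of "\<Prod>i\<in>UNIV. d i"] d(2) by simp
qed

text \<open>A quasi-reflection in \<open>f - s e\<close>; the sign \<open>s\<close> avoids the isotropic case.\<close>

lemma Witt_step:
  assumes "e \<in> Eis_space" "f \<in> Eis_space" "herm e e = 1" "herm f f = 1"
  obtains s \<phi> where "s = 1 \<or> s = -1" "\<phi> f = s *s e" "\<And>x y. herm (\<phi> x) (\<phi> y) = herm x y"
    "\<forall>x\<in>Eis_space. \<phi> x \<in> Eis_space" "\<forall>x. herm x e = 0 \<longrightarrow> herm x f = 0 \<longrightarrow> \<phi> x = x"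
proof -
  define s :: complex where "s = (if Re (herm f e) \<le> 0 then 1 else -1)"
  have s: "s = 1 \<or> s = -1" by (simp add: s_def)
  hence ss: "cnj s = s" "s * s = 1" by auto
  define d where "d = f - s *s e"
  \<comment> \<open>The sign \<open>s\<close> makes the real part of \<open>c\<close> at least 1, so
    division is possible. Since d has norm c + cnj c, subtracting (herm x d / c) d is an isometry,
    and it sends f to f - d.\<close>
  define c where "c = herm f d"
  have c_eq: "c = 1 - s * herm f e" by (simp add: c_def d_def herm_lin assms ss)
  have "Re c \<ge> 1" unfolding c_eq s_def by auto
  hence c0: "c \<noteq> 0" by auto
  have dd: "herm d d = c + cnj c"
    unfolding c_eq using ss(2) by (simp add: d_def herm_lin assms ss herm_cnj algebra_simps)
  define \<phi> where "\<phi> = (\<lambda>x. x - (herm x d / c) *s d)"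
  have d_E: "d \<in> Eis_space"
    unfolding d_def using s assms Eis_field_eis by (intro Eis_space_diff Eis_space_scale) auto
  show ?thesis
  proof (rule that[OF s])
    show "\<phi> f = s *s e" using c0 by (simp add: \<phi>_def c_def[symmetric]) (simp add: d_def)
    show "herm (\<phi> x) (\<phi> y) = herm x y" for x y
    proof -
      have "herm (\<phi> x) (\<phi> y) = herm x y - cnj (herm y d / c) * herm x d - (herm x d / c) * herm d y
          + (herm x d / c) * cnj (herm y d / c) * herm d d"
        unfolding \<phi>_def by (simp add: herm_lin algebra_simps)
      also have "herm d y = cnj (herm y d)" by (simp add: herm_cnj)
      also have "herm x y - cnj (herm y d / c) * herm x d - (herm x d / c) * cnj (herm y d)
          + (herm x d / c) * cnj (herm y d / c) * herm d d = herm x y"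
        unfolding dd using c0 by (simp add: field_simps)
      finally show ?thesis .
    qed
    show "\<forall>x\<in>Eis_space. \<phi> x \<in> Eis_space"
      unfolding \<phi>_def c_def divide_inverse using d_E assms
      by (intro ballI Eis_space_diff Eis_space_scale Eis_field_mult Eis_field_inverse herm_Eis_space)
    show "\<forall>x. herm x e = 0 \<longrightarrow> herm x f = 0 \<longrightarrow> \<phi> x = x"
      by (simp add: \<phi>_def d_def herm_lin)
  qed
qed

text \<open>Three Witt steps move the standard vectors at positions 2, 3, 4 to the given ones up to
  sign. Each step fixes the vectors already placed, as they are orthogonal to both vectors that
  define it. The null vector \<open>axis 1 1 + axis 5 1\<close> is carried along.\<close>

lemma null_vector:
  assumes E: "e1 \<in> Eis_space" "e2 \<in> Eis_space" "e3 \<in> Eis_space"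
    and n: "herm e1 e1 = 1" "herm e2 e2 = 1" "herm e3 e3 = 1" and o: "herm e1 e2 = 0" "herm e1 e3 = 0" "herm e2 e3 = 0"
  obtains r where "r \<in> Eis_space" "r \<noteq> 0" "herm r r = 0" "herm r e1 = 0" "herm r e2 = 0" "herm r e3 = 0"
proof -
  have aE: "axis i 1 \<in> Eis_space" for i using Lattice_Eis_space by blast
  have ha: "herm (axis i 1) (axis j 1) = (if i = j then if i = 1 then -1 else 1 else 0)" for i j
    using exhaust_5[of j] by (elim disjE) (auto simp: herm_axis axis_nth)
  obtain s1 f1 where f1: "s1 = 1 \<or> s1 = -1" "f1 (axis 2 1) = s1 *s e1" "\<And>x y. herm (f1 x) (f1 y) = herm x y"
    "\<forall>x\<in>Eis_space. f1 x \<in> Eis_space" "\<forall>x. herm x e1 = 0 \<longrightarrow> herm x (axis 2 1) = 0 \<longrightarrow> f1 x = x"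
    by (rule Witt_step[OF E(1) aE n(1), of 2]) (simp_all add: ha)
  define g where "g = f1 (axis 3 1)"
  have gE: "g \<in> Eis_space" and gn: "herm g g = 1" unfolding g_def using f1(3,4) aE by (simp_all add: ha)
  have perp1: "herm (f1 x) e1 = s1 * herm x (axis 2 1)" for x
  proof -
    have "e1 = s1 *s f1 (axis 2 1)" using f1(1,2) by auto
    thus ?thesis using f1(1) by (auto simp: herm_lin f1(3))
  qed
  have ge1: "herm g e1 = 0" unfolding g_def perp1 by (simp add: ha)
  obtain s2 f2 where f2: "s2 = 1 \<or> s2 = -1" "f2 g = s2 *s e2" "\<And>x y. herm (f2 x) (f2 y) = herm x y"
    "\<forall>x\<in>Eis_space. f2 x \<in> Eis_space" "\<forall>x. herm x e2 = 0 \<longrightarrow> herm x g = 0 \<longrightarrow> f2 x = x"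
    by (rule Witt_step[OF E(2) gE n(2) gn]) blast
  have f2e1: "f2 e1 = e1" using f2(5) o ge1 herm_eq_0_sym by metis
  have perp2: "herm (f2 x) e2 = s2 * herm x g" for x
  proof -
    have "e2 = s2 *s f2 g" using f2(1,2) by auto
    thus ?thesis using f2(1) by (auto simp: herm_lin f2(3))
  qed
  have perp2': "herm (f2 x) e1 = herm x e1" for x using f2(3)[of x e1] f2e1 by simp
  define h where "h = f2 (f1 (axis 4 1))"
  have hE: "h \<in> Eis_space" and hn: "herm h h = 1" unfolding h_def using f1(3,4) f2(3,4) aE by (simp_all add: ha)
  have he: "herm h e1 = 0" "herm h e2 = 0"
    unfolding h_def perp2' perp1 perp2 g_def f1(3) by (simp_all add: ha)
  obtain s3 f3 where f3: "s3 = 1 \<or> s3 = -1" "f3 h = s3 *s e3" "\<And>x y. herm (f3 x) (f3 y) = herm x y"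
    "\<forall>x\<in>Eis_space. f3 x \<in> Eis_space" "\<forall>x. herm x e3 = 0 \<longrightarrow> herm x h = 0 \<longrightarrow> f3 x = x"
    by (rule Witt_step[OF E(3) hE n(3) hn]) blast
  have f3e1: "f3 e1 = e1" using f3(5) o he herm_eq_0_sym by metis
  have f3e2: "f3 e2 = e2" using f3(5) o he herm_eq_0_sym by metis
  have perp3: "herm (f3 x) e3 = s3 * herm x h" for x
  proof -
    have "e3 = s3 *s f3 h" using f3(1,2) by auto
    thus ?thesis using f3(1) by (auto simp: herm_lin f3(3))
  qed
  have perp3': "herm (f3 x) e1 = herm x e1" "herm (f3 x) e2 = herm x e2" for x
    using f3(3)[of x e1] f3(3)[of x e2] f3e1 f3e2 by simp_all
  define v :: "complex ^ 5" where "v = axis 1 1 + axis 5 1"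
  define r where "r = f3 (f2 (f1 v))"
  have vE: "v \<in> Eis_space" unfolding v_def by (intro Eis_space_add aE)
  show ?thesis
  proof (rule that[of r])
    show "r \<in> Eis_space" unfolding r_def using vE f1(4) f2(4) f3(4) by blast
    show "herm r r = 0" unfolding r_def f3(3) f2(3) f1(3) by (simp add: v_def herm_lin ha)
    have "herm r (f3 (f2 (f1 (axis 1 1)))) = -1" unfolding r_def f3(3) f2(3) f1(3) by (simp add: v_def herm_lin ha)
    thus "r \<noteq> 0" by auto
    show "herm r e1 = 0" unfolding r_def perp3' perp2' perp1 by (simp add: v_def herm_lin ha)
    show "herm r e2 = 0" unfolding r_def perp3' perp2 g_def f1(3) by (simp add: v_def herm_lin ha)
    show "herm r e3 = 0" unfolding r_def perp3 h_def f2(3) f1(3) by (simp add: v_def herm_lin ha)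
  qed
qed

context Heisenberg_frame
begin

text \<open>Witt cancellation applies to the unit vectors w_i / theta; the null vector obtained is
  cleared of denominators and made primitive.\<close>

lemma Lattice_null_vector:
  obtains r y0 where "r \<in> Lattice" "y0 \<in> Lattice" "herm y0 r = 1" "herm r r = 0"
    "herm r w1 = 0" "herm r w2 = 0" "herm r w3 = 0"
proof -
  have Ji: "J (v3 1 0 0) = inverse theta *s w1" "J (v3 0 1 0) = inverse theta *s w2" "J (v3 0 0 1) = inverse theta *s w3"
    by (simp_all add: J_def divide_inverse)
  have iE: "inverse theta \<in> Eis_field" using Eis_field_inverse Eis_field_eis eis_theta by blast
  have JE: "J (v3 1 0 0) \<in> Eis_space" "J (v3 0 1 0) \<in> Eis_space" "J (v3 0 0 1) \<in> Eis_space"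
    unfolding Ji using iE wL Lattice_Eis_space Eis_space_scale by blast+
  obtain r where r: "r \<in> Eis_space" "r \<noteq> 0" "herm r r = 0" "herm r (J (v3 1 0 0)) = 0"
    "herm r (J (v3 0 1 0)) = 0" "herm r (J (v3 0 0 1)) = 0"
    by (rule null_vector[OF JE]) (simp_all add: herm_J_J hdot_def)
  obtain d where d: "d \<noteq> 0" "d *s r \<in> Lattice" by (rule Eis_space_denominator[OF r(1)])
  have "d *s r \<noteq> 0" using d r(2) by (simp add: vec_eq_iff)
  then obtain c r' y0 where c: "c \<noteq> 0" "r' \<in> Lattice" "d *s r = c *s r'" "y0 \<in> Lattice" "herm y0 r' = 1"
    by (rule Lattice_primitive[OF d(2)])
  have r': "r' = (d / c) *s r" using c(1,3) by (simp add: vec_eq_iff field_simps)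
  have "herm r w1 = 0" "herm r w2 = 0" "herm r w3 = 0"
    using r(4-6) unfolding Ji by (simp_all add: herm_lin)
  thus ?thesis using that[OF c(2,4,5)] r(3) by (simp add: r' herm_lin)
qed

end

section \<open>Standard position\<close>

locale null_frame = Heisenberg_frame +
  fixes r y0 :: "complex ^ 5"
  assumes rL: "r \<in> Lattice" and y0: "y0 \<in> Lattice" "herm y0 r = 1" and rr: "herm r r = 0"
    and rw: "herm r w1 = 0" "herm r w2 = 0" "herm r w3 = 0"
begin

text \<open>The adjoint of \<open>J\<close>, that is, the coordinates of the orthogonal projection
  to the frame; the minus sign is that of \<open>cnj theta\<close>.\<close>

definition co :: "complex ^ 5 \<Rightarrow> complex ^ 3" where
  "co x = v3 (- herm x w1 / theta) (- herm x w2 / theta) (- herm x w3 / theta)"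

lemma herm_co: "herm x (J a) = hdot (co x) a"
  by (simp add: herm_J co_def hdot_def add_divide_distrib diff_divide_distrib mult.commute)

lemma co_J [simp]: "co (J a) = a"
  unfolding co_def J_def
  by (simp add: vec_eq_iff forall_3 herm_lin wn wo wo' theta_sq)

lemma co_lin: "co (x + z) = co x + co z" "co (x - z) = co x - co z" "co (d *s x) = d *s co x"
  by (simp_all add: co_def vec_eq_iff forall_3 herm_lin add_divide_distrib diff_divide_distrib)

lemma r_J [simp]: "herm r (J a) = 0" "herm (J a) r = 0"
proof -
  show "herm r (J a) = 0" by (simp add: J_def herm_lin rw)
  thus "herm (J a) r = 0" using herm_eq_0_sym by blast
qed

lemma r_nz: "r \<noteq> 0" using y0 by auto

lemma herm_r_l: "herm r l \<noteq> 0"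
  using neg_perp_pos[OF neg, of r] r_nz rr by auto

text \<open>If all lattice vectors orthogonal to \<open>r\<close> pair with \<open>w1\<close> in
  multiples of \<open>theta\<close>, then modulo \<open>theta\<close> pairing with \<open>w1\<close>
  is a multiple of pairing with \<open>r\<close>. By self-duality w1 - k r is then divisible by
  \<open>theta\<close>, which is the second alternative.\<close>

lemma glue_vector:
  obtains x where "x \<in> Lattice" "herm x r = 0" "\<And>t. t \<in> eisenstein \<Longrightarrow> herm x w1 \<noteq> theta * t"
  | x where "x \<in> Lattice" "herm x r = 0" "co x = v3 1 0 0"
proof (cases "\<exists>x\<in>Lattice. herm x r = 0 \<and> (\<forall>t\<in>eisenstein. herm x w1 \<noteq> theta * t)")
  case True
  thus ?thesis using that(1) by blast
next
  case False
  hence all: "\<exists>t\<in>eisenstein. herm x w1 = theta * t" if "x \<in> Lattice" "herm x r = 0" for x using that by blast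
  obtain k z where kz: "k \<in> {0, 1, -1}" "z \<in> eisenstein" "herm y0 w1 = k + theta * z"
    by (rule eis_mod_theta[OF herm_Lattice[OF y0(1) wL(1)]])
  have ck: "cnj k = k" using kz(1) by auto
  define x where "x = (1 / theta) *s (w1 - k *s r)"
  have "x \<in> Lattice"
  proof (rule Lattice_unimodular')
    fix v assume v: "v \<in> Lattice"
    have vr: "herm v r \<in> eisenstein" using v rL by blast
    have "v - herm v r *s y0 \<in> Lattice" using v vr y0 by blast
    moreover have "herm (v - herm v r *s y0) r = 0" using y0(2) by (simp add: herm_lin)
    ultimately obtain t where t: "t \<in> eisenstein" "herm (v - herm v r *s y0) w1 = theta * t" using all by blast
    have "herm v w1 - herm v r * k = theta * (t + herm v r * z)"
      using t(2) by (simp add: herm_lin kz(3) algebra_simps)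
    moreover have "herm v x = - (herm v w1 - herm v r * k) / theta"
      unfolding x_def by (simp add: herm_lin ck diff_divide_distrib mult.commute)
    ultimately have "herm v x = - (t + herm v r * z)" by simp
    thus "herm v x \<in> eisenstein" using t vr kz(2) by (auto intro!: eis_add eis_mult eis_diff)
  qed
  moreover have "herm x r = 0"
    using rw(1) herm_eq_0_sym[of r w1] by (simp add: x_def herm_lin rr)
  moreover have "co x = v3 1 0 0"
    unfolding x_def co_def by (simp add: vec_eq_iff forall_3 herm_lin wn wo rw theta_sq)
  ultimately show ?thesis using that(2) by blast
qed

text \<open>An orthonormal basis that can replace the standard one in the description of
  \<open>W\<close>; the last three conditions provide the corresponding generators.\<close>

definition good_frame :: "complex ^ 3 \<Rightarrow> complex ^ 3 \<Rightarrow> complex ^ 3 \<Rightarrow> bool" where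
  "good_frame f g h \<longleftrightarrow> hdot f f = 1 \<and> hdot g g = 1 \<and> hdot h h = 1 \<and> hdot f g = 0 \<and> hdot f h = 0 \<and> hdot g h = 0 \<and>
     J (g - f) \<in> Lattice \<and> J (h - f) \<in> Lattice \<and> J (theta *s f) \<in> Lattice"

lemma div_theta_cancel: "cnj (a / theta) = - cnj a / theta" "a / theta * (b / theta) = - (a * b) / 3"
  using theta_sq by simp_all

lemma om_theta: "(omega - 1) / theta = - (omega\<^sup>2)" "(omega\<^sup>2 - 1) / theta = omega" "(1 - omega) / theta = omega\<^sup>2"
  "(1 - omega\<^sup>2) / theta = - omega"
  unfolding div_theta by (simp_all add: theta_eq omega_sq field_simps omega_mult omega_mult')

lemma hdot_div_theta:
  "hdot (v3 (a/theta) (b/theta) (c/theta)) (v3 (a'/theta) (b'/theta) (c'/theta)) = (a * cnj a' + b * cnj b' + c * cnj c') / 3"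
proof -
  have "x / theta * cnj (z / theta) = x * cnj z / 3" for x z
    using div_theta_cancel(2)[of x "cnj z"] unfolding div_theta_cancel(1) by simp
  thus ?thesis by (simp only: hdot_def vector_3 add_divide_distrib)
qed

text \<open>The four triangles of the Hesse pencil: up to scaling, the vectors are the coefficients
  of its twelve lines.\<close>

lemma good_frames:
  "good_frame (v3 1 0 0) (v3 0 1 0) (v3 0 0 1)"
  "good_frame (v3 (1/theta) (1/theta) (1/theta)) (v3 (1/theta) (omega/theta) (omega\<^sup>2/theta)) (v3 (1/theta) (omega\<^sup>2/theta) (omega/theta))"
  "good_frame (v3 (1/theta) (1/theta) (omega/theta)) (v3 (1/theta) (omega/theta) (1/theta)) (v3 (omega/theta) (1/theta) (1/theta))"
  "good_frame (v3 (1/theta) (1/theta) (omega\<^sup>2/theta)) (v3 (1/theta) (omega\<^sup>2/theta) (1/theta)) (v3 (omega\<^sup>2/theta) (1/theta) (1/theta))"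
proof -
  have diff: "v3 a b c - v3 a' b' c' = v3 (a - a') (b - b') (c - c')" for a b c a' b' c' by (rule v3_arith(2))
  have th: "theta *s v3 (a/theta) (b/theta) (c/theta) = v3 a b c" for a b c by (simp add: v3_arith)
  have oE: "omega\<^sup>2 \<in> eisenstein" by auto
  have dd: "omega / theta - 1 / theta = - (omega\<^sup>2)" "omega\<^sup>2 / theta - 1 / theta = omega"
    "1 / theta - omega / theta = omega\<^sup>2" "1 / theta - omega\<^sup>2 / theta = - omega"
    using om_theta by (simp_all add: diff_divide_distrib)
  have t3: "1 + 1 + 1 = theta * (- theta)" "1 + 1 + omega = theta * (- omega)" "1 + 1 + omega\<^sup>2 = theta * omega\<^sup>2"
    by (simp_all add: theta_eq omega_sq omega_simps)
  show "good_frame (v3 1 0 0) (v3 0 1 0) (v3 0 0 1)"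
    unfolding good_frame_def diff v3_arith(4)
  proof (intro conjI)
    show "J (v3 (0 - 1) (1 - 0) (0 - 0)) \<in> Lattice" "J (v3 (0 - 1) (0 - 0) (1 - 0)) \<in> Lattice"
      by (rule J_W_Lattice[of _ _ _ 0]; simp)+
    show "J (v3 (theta * 1) (theta * 0) (theta * 0)) \<in> Lattice" by (rule J_W_Lattice[of _ _ _ 1]) auto
  qed (simp_all add: hdot_def)
  show "good_frame (v3 (1/theta) (1/theta) (1/theta)) (v3 (1/theta) (omega/theta) (omega\<^sup>2/theta)) (v3 (1/theta) (omega\<^sup>2/theta) (omega/theta))"
    unfolding good_frame_def diff th dd
  proof (intro conjI)
    show "J (v3 (1 / theta - 1 / theta) (- (omega\<^sup>2)) omega) \<in> Lattice" "J (v3 (1 / theta - 1 / theta) omega (- (omega\<^sup>2))) \<in> Lattice"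
      by (rule J_W_Lattice[of _ _ _ 1]; simp add: oE theta_def)+
    show "J (v3 1 1 1) \<in> Lattice" by (rule J_W_Lattice[OF eis_1 eis_1 eis_1 t3(1)]) simp
  qed (simp_all only: hdot_div_theta, simp_all add: omega_sq field_simps omega_mult omega_mult')
  show "good_frame (v3 (1/theta) (1/theta) (omega/theta)) (v3 (1/theta) (omega/theta) (1/theta)) (v3 (omega/theta) (1/theta) (1/theta))"
    unfolding good_frame_def diff th dd
  proof (intro conjI)
    show "J (v3 (1 / theta - 1 / theta) (- (omega\<^sup>2)) (omega\<^sup>2)) \<in> Lattice" "J (v3 (- (omega\<^sup>2)) (1 / theta - 1 / theta) (omega\<^sup>2)) \<in> Lattice"
      by (rule J_W_Lattice[of _ _ _ 0]; simp add: oE)+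
    show "J (v3 1 1 omega) \<in> Lattice" by (rule J_W_Lattice[OF eis_1 eis_1 eis_omega t3(2)]) simp
  qed (simp_all only: hdot_div_theta, simp_all add: omega_sq field_simps omega_mult omega_mult')
  show "good_frame (v3 (1/theta) (1/theta) (omega\<^sup>2/theta)) (v3 (1/theta) (omega\<^sup>2/theta) (1/theta)) (v3 (omega\<^sup>2/theta) (1/theta) (1/theta))"
    unfolding good_frame_def diff th dd
  proof (intro conjI)
    show "J (v3 (1 / theta - 1 / theta) omega (- omega)) \<in> Lattice" "J (v3 omega (1 / theta - 1 / theta) (- omega)) \<in> Lattice"
      by (rule J_W_Lattice[of _ _ _ 0]; simp add: oE)+
    show "J (v3 1 1 (omega\<^sup>2)) \<in> Lattice" by (rule J_W_Lattice[OF eis_1 eis_1 oE t3(3) oE])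
  qed (simp_all only: hdot_div_theta, simp_all add: omega_sq field_simps omega_mult omega_mult')
qed

text \<open>The nonzero classes of the glue group, up to sign, are represented by the first vectors of the four
  frames of \<open>good_frames\<close>.\<close>

lemma adapted_frame:
  obtains x f g h where "x \<in> Lattice" "herm x r = 0" "co x = f" "good_frame f g h"
proof (cases rule: glue_vector)
  case (2 x)
  show ?thesis by (rule that[OF 2 good_frames(1)])
next
  case (1 x)
  note result = that
  have "herm x w1 \<in> eisenstein" using 1(1) wL by blast
  then obtain k z where kz: "k \<in> {0, 1, -1}" "z \<in> eisenstein" "herm x w1 = k + theta * z" by (rule eis_mod_theta)
  have "k \<noteq> 0" using kz 1(3)[OF kz(2)] by auto
  hence kk: "k = 1 \<or> k = -1" using kz(1) by auto
  \<comment> \<open>Normalises the first coordinate of \<open>co x'\<close> to 1/theta modulo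
    Eisenstein integers.\<close>
  define x' where "x' = (- k) *s x"
  have x': "x' \<in> Lattice" "herm x' r = 0" using 1(1,2) kk by (auto simp: x'_def herm_lin intro!: Lattice_scale)
  define c where "c = co x'"
  define m where "m = k * z"
  have mE: "m \<in> eisenstein" using kk kz(2) by (auto simp: m_def)
  have c1: "c $ 1 = 1 / theta + m"
    using kk by (auto simp: c_def x'_def co_def herm_lin kz(3) m_def add_divide_distrib diff_divide_distrib)
  have "herm x' (J (v3 1 (-1) 0)) \<in> eisenstein" using x'(1) code_root by blast
  hence c12: "c $ 1 - c $ 2 \<in> eisenstein" by (simp add: herm_co hdot_def c_def)
  have "J (v3 1 0 (-1)) \<in> Lattice" by (rule J_W_Lattice[of _ _ _ 0]) auto
  hence "herm x' (J (v3 1 0 (-1))) \<in> eisenstein" using x'(1) by blast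
  hence c13: "c $ 1 - c $ 3 \<in> eisenstein" by (simp add: herm_co hdot_def c_def)
  define m2 m3 where "m2 = m - (c $ 1 - c $ 2)" and "m3 = m - (c $ 1 - c $ 3)"
  have m23: "m2 \<in> eisenstein" "m3 \<in> eisenstein" using mE c12 c13 by (auto simp: m2_def m3_def)
  have c: "c = v3 (1/theta + m) (1/theta + m2) (1/theta + m3)"
    by (simp add: vec_eq_iff forall_3 m2_def m3_def c1)
  \<comment> \<open>All three coordinates are now 1/theta plus an integral part. Modulo
    \<open>W\<close> only the sum of the integral parts modulo \<open>theta\<close> matters, and its
    value \<open>j\<close> selects the frame.\<close>
  obtain j t where jt: "j \<in> {0, 1, -1}" "t \<in> eisenstein" "m + m2 + m3 = j + theta * t"
    using eis_mod_theta[of "m + m2 + m3"] mE m23 by blast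
  have oE: "omega\<^sup>2 \<in> eisenstein" by auto
  have fin: thesis if fr: "good_frame f g h" and n: "c - f = v3 a b d" "a \<in> eisenstein" "b \<in> eisenstein" "d \<in> eisenstein"
      "a + b + d = theta * s" "s \<in> eisenstein" for f g h a b d s
  proof (rule result[of "x' - J (v3 a b d)"])
    show "x' - J (v3 a b d) \<in> Lattice" using x'(1) J_W_Lattice[OF n(2-6)] by blast
    show "herm (x' - J (v3 a b d)) r = 0" using x'(2) by (simp add: herm_lin)
    show "co (x' - J (v3 a b d)) = f" by (simp add: co_lin c_def[symmetric] n(1)[symmetric])
    show "good_frame f g h" by (rule fr)
  qed
  consider "j = 0" | "j = 1" | "j = -1" using jt(1) by auto
  thus ?thesis
  proof cases
    case 1
    show ?thesis
      by (rule fin[OF good_frames(2), where a = m and b = m2 and d = m3 and s = t]) (use mE m23 jt 1 in \<open>simp_all add: c vec_eq_iff forall_3\<close>)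
  next
    case 2
    have "m + m2 + (m3 - omega) = theta * (t + omega\<^sup>2)"
      using jt(3) 2 by (simp add: theta_eq omega_sq omega_simps)
    thus ?thesis
      by (intro fin[OF good_frames(4), where a = m and b = m2 and d = "m3 - omega" and s = "t + omega\<^sup>2"])
        (use mE m23 jt om_theta(4) in \<open>auto simp: c vec_eq_iff forall_3 diff_divide_distrib algebra_simps\<close>)
  next
    case 3
    have "m + m2 + (m3 + omega\<^sup>2) = theta * (t + omega)"
      using jt(3) 3 by (simp add: theta_eq omega_sq omega_simps)
    thus ?thesis
      by (intro fin[OF good_frames(3), where a = m and b = m2 and d = "m3 + omega\<^sup>2" and s = "t + omega"])
        (use mE m23 jt om_theta(3) in \<open>auto simp: c vec_eq_iff forall_3 diff_divide_distrib algebra_simps\<close>)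
  qed
qed

text \<open>The complement of the frame is a plane of signature (1,1), in which the null vector
  \<open>r\<close> spans its own orthogonal space. Otherwise \<open>u\<close>, corrected by a
  multiple of \<open>r\<close>, and the part of \<open>r\<close> orthogonal to \<open>l\<close>
  would complete \<open>l\<close> and the frame to six orthogonal vectors.\<close>

lemma perp_frame_r:
  assumes "herm u r = 0" "co u = 0" obtains t where "u = t *s r"
proof -
  have uJ: "herm u (J a) = 0" for a by (simp add: herm_co assms(2) hdot_lin)
  have lJ: "herm l (J a) = 0" for a using herm_J_l herm_eq_0_sym by blast
  have ll: "herm l l \<noteq> 0" using neg by auto
  define t where "t = herm u l / herm r l"
  define u' where "u' = u - t *s r"
  define s where "s = herm r l / herm l l"
  define r' where "r' = r - s *s l"
  have sz: "s \<noteq> 0" using herm_r_l ll by (simp add: s_def)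
  have u'l: "herm u' l = 0" using herm_r_l by (simp add: u'_def t_def herm_lin)
  have r'l: "herm r' l = 0" using ll by (simp add: r'_def s_def herm_lin)
  have r'0: "r' \<noteq> 0"
  proof
    assume "r' = 0"
    hence r: "r = s *s l" by (simp add: r'_def)
    have "herm r r = s * cnj s * herm l l" unfolding r by (simp add: herm_lin)
    thus False using rr sz ll by simp
  qed
  have "u' = 0"
  proof (rule ccontr)
    assume u'0: "u' \<noteq> 0"
    have ru: "herm r u = 0" using assms(1) herm_eq_0_sym by blast
    have lu: "herm l u' = 0" using u'l herm_eq_0_sym by blast
    have "herm r u' = 0" by (simp add: u'_def herm_lin ru rr)
    hence r'u': "herm r' u' = 0" by (simp add: r'_def herm_lin lu)
    show False
    proof (rule no_six_orthogonal[of l "J (v3 1 0 0)" "J (v3 0 1 0)" "J (v3 0 0 1)" u' r'])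
      show "herm u' u' \<noteq> 0" using neg_perp_pos[OF neg u'l u'0] by auto
      show "herm r' r' \<noteq> 0" using neg_perp_pos[OF neg r'l r'0] by auto
    qed (use ll u'l r'l r'u' uJ lJ in \<open>simp_all add: herm_J_J hdot_def herm_J_l u'_def r'_def herm_lin\<close>)
  qed
  thus ?thesis using that[of t] by (simp add: u'_def)
qed

text \<open>The lattice basis \<open>T, F\<^sub>1, F\<^sub>2, F\<^sub>3, r' - T\<close> has the standard Gram matrix and maps \<open>v2\<close> to \<open>r'\<close>.\<close>

lemma standard_position:
  obtains A where "A \<in> Lattice_mats" "\<And>w. herm (A *v iota w) l = 0"
proof -
  obtain x f g h where x: "x \<in> Lattice" "herm x r = 0" "co x = f" "good_frame f g h" by (rule adapted_frame)
  have fr: "hdot f f = 1" "hdot g g = 1" "hdot h h = 1" "hdot f g = 0" "hdot f h = 0" "hdot g h = 0"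
    "J (g - f) \<in> Lattice" "J (h - f) \<in> Lattice" "J (theta *s f) \<in> Lattice"
    using x(4) by (auto simp: good_frame_def)
  have "herm (x - J f) r = 0" "co (x - J f) = 0" using x(2,3) by (simp_all add: herm_lin co_lin)
  then obtain c where c: "x - J f = c *s r" by (rule perp_frame_r)
  hence xc: "J f = x - c *s r" by (simp add: algebra_simps)
  \<comment> \<open>The vector theta c r lies in the lattice; since \<open>r\<close> is primitive,
    pairing with \<open>y0\<close> recovers its coefficient.\<close>
  have tc: "theta * c \<in> eisenstein"
  proof -
    have "theta *s x - J (theta *s f) \<in> Lattice" using x(1) fr(9) by blast
    also have "theta *s x - J (theta *s f) = (theta * c) *s r" by (simp add: J_lin xc vec_eq_iff algebra_simps)
    finally have "herm y0 ((theta * c) *s r) \<in> eisenstein" using y0(1) by blast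
    hence "cnj (theta * c) \<in> eisenstein" using y0(2) by (simp add: herm_lin)
    thus ?thesis using eis_cnj by blast
  qed
  obtain k m where km: "k \<in> {0, 1, -1}" "m \<in> eisenstein" "theta * c = k + theta * m" by (rule eis_mod_theta[OF tc])
  \<comment> \<open>For k = 0 the unit vector \<open>J f\<close> would be a lattice vector
    orthogonal to \<open>l\<close>.\<close>
  have "k \<noteq> 0"
  proof
    assume "k = 0"
    hence "c = m" using km(3) by simp
    hence "J f \<in> Lattice" unfolding xc using x(1) km(2) rL by blast
    moreover have "herm (J f) (J f) = 1" by (simp add: herm_J_J fr)
    ultimately show False using no1 herm_J_l by blast
  qed
  hence k: "k = 1 \<or> k = -1" using km(1) by auto
  hence k2: "k * k = 1" "cnj k = k" by auto
  define r' where "r' = (- k) *s r"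
  have r'L: "r' \<in> Lattice" using rL k by (auto simp: r'_def intro!: Lattice_scale)
  have r'r': "herm r' r' = 0" by (simp add: r'_def herm_lin rr)
  \<comment> \<open>Chosen so that the non-integral part of the coefficient of \<open>r'\<close> is
    exactly \<open>- kappa\<close>, the constant built into \<open>iota\<close>; this rests on
    1/theta = omega^2 + omega/theta.\<close>
  define m' where "m' = - k * m - omega\<^sup>2"
  have m'E: "m' \<in> eisenstein" using k km(2) by (auto simp: m'_def intro!: eis_diff eis_power)
  have cr: "c *s r = (m' - kappa) *s r'"
  proof -
    have "kappa = omega / theta" using kappa_theta by (simp add: field_simps)
    hence "- k * (m' - kappa) = k * k * m + k * (omega\<^sup>2 + omega / theta)" by (simp add: m'_def algebra_simps)
    also have "omega\<^sup>2 + omega / theta = 1 / theta" using om_theta(3) by (simp add: diff_divide_distrib algebra_simps)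
    finally have "- k * (m' - kappa) = m + k / theta" by (simp add: k2)
    moreover have "c = m + k / theta" using km(3) by (simp add: field_simps)
    ultimately have "c = (m' - kappa) * (- k)" by (simp add: mult.commute)
    thus ?thesis unfolding r'_def by simp
  qed
  define F1 where "F1 = x - m' *s r'"
  define F2 where "F2 = F1 + J (g - f)"
  define F3 where "F3 = F1 + J (h - f)"
  have FL: "F1 \<in> Lattice" "F2 \<in> Lattice" "F3 \<in> Lattice"
    unfolding F1_def F2_def F3_def using x(1) m'E r'L fr by blast+
  have F1: "F1 = J f - kappa *s r'"
    using xc unfolding F1_def cr by (simp add: vec_eq_iff algebra_simps)
  have F2: "F2 = J g - kappa *s r'" and F3: "F3 = J h - kappa *s r'"
    unfolding F2_def F3_def F1 by (simp_all add: J_lin)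
  have r'J: "herm r' (J a) = 0" "herm (J a) r' = 0" for a by (simp_all add: r'_def herm_lin)
  have hdot_sym: "hdot b a = 0" if "hdot a b = 0" for a b
    using that herm_eq_0_sym unfolding herm_J_J[symmetric] by blast
  have gram: "herm F1 F1 = 1" "herm F2 F2 = 1" "herm F3 F3 = 1" "herm F1 F2 = 0" "herm F1 F3 = 0" "herm F2 F3 = 0"
    "herm F2 F1 = 0" "herm F3 F1 = 0" "herm F3 F2 = 0"
    unfolding F1 F2 F3 by (simp_all add: herm_lin herm_J_J fr hdot_sym r'J r'r')
  have Fr: "herm F1 r' = 0" "herm F2 r' = 0" "herm F3 r' = 0" "herm r' F1 = 0" "herm r' F2 = 0" "herm r' F3 = 0"
    unfolding F1 F2 F3 by (simp_all add: herm_lin r'J r'r')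
  define z where "z = k *s y0"
  have zL: "z \<in> Lattice" using y0(1) k by (auto simp: z_def intro!: Lattice_scale)
  have zr: "herm z r' = -1" using y0(2) k by (auto simp: z_def r'_def herm_lin)
  define T0 where "T0 = z - herm z F1 *s F1 - herm z F2 *s F2 - herm z F3 *s F3"
  have T0L: "T0 \<in> Lattice" unfolding T0_def using zL FL by blast
  have T0F: "herm T0 F1 = 0" "herm T0 F2 = 0" "herm T0 F3 = 0"
    unfolding T0_def by (simp_all add: herm_lin gram)
  have T0r: "herm T0 r' = -1" unfolding T0_def by (simp add: herm_lin Fr zr)
  obtain n where n: "herm T0 T0 = of_int n" using eis_real[OF herm_Lattice[OF T0L T0L] herm_self_real] by blast
  \<comment> \<open>Since omega + cnj omega = -1, adding this multiple of \<open>r'\<close> lowers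
    the norm by n + 1, from n to -1; there is no parity obstruction.\<close>
  define T where "T = T0 + (- of_int (n + 1) * omega) *s r'"
  have "- of_int (n + 1) * omega \<in> eisenstein" by (intro eis_mult) (simp_all add: eis_of_int[of "- (n + 1)", simplified])
  hence TL: "T \<in> Lattice" unfolding T_def using T0L r'L by blast
  have rT0: "herm r' T0 = -1" using arg_cong[OF T0r, of cnj] by (simp add: herm_cnj)
  have TF: "herm T F1 = 0" "herm T F2 = 0" "herm T F3 = 0" unfolding T_def by (simp_all add: herm_lin T0F Fr)
  hence FT: "herm F1 T = 0" "herm F2 T = 0" "herm F3 T = 0" using herm_eq_0_sym by blast+
  have Tr: "herm T r' = -1" unfolding T_def by (simp add: herm_lin T0r r'r')
  have rT: "herm r' T = -1" using arg_cong[OF Tr, of cnj] by (simp add: herm_cnj)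
  have TT: "herm T T = -1"
    unfolding T_def by (simp add: herm_lin n T0r rT0 r'r' algebra_simps)
  define S where "S = r' - T"
  have SL: "S \<in> Lattice" unfolding S_def using r'L TL by blast
  have SS: "herm S S = 1" "herm S T = 0" "herm T S = 0" "herm S F1 = 0" "herm S F2 = 0" "herm S F3 = 0"
    "herm F1 S = 0" "herm F2 S = 0" "herm F3 S = 0"
    unfolding S_def by (simp_all add: herm_lin r'r' rT Tr TT TF FT Fr)
  define cl :: "5 \<Rightarrow> complex ^ 5" where
    "cl = (\<lambda>i. if i = 1 then T else if i = 2 then F1 else if i = 3 then F2 else if i = 4 then F3 else S)"
  have clL: "cl i \<in> Lattice" for i using TL FL SL by (auto simp: cl_def)
  have "\<forall>i j. herm (cl i) (cl j) = herm (axis i 1) (axis j 1)"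
    unfolding forall_5 by (simp add: cl_def herm_axis axis_nth gram TT TF FT SS)
  then obtain A where A: "A \<in> Lattice_mats" "\<And>x. A *v x = (\<Sum>i\<in>UNIV. x $ i *s cl i)"
    using mats_columns[of cl] clL by blast
  have "herm (A *v iota w) l = 0" for w
  proof -
    have "A *v iota w = (kappa * (w$1 + w$2 + w$3)) *s T + w$1 *s F1 + w$2 *s F2 + w$3 *s F3 + (kappa * (w$1 + w$2 + w$3)) *s (r' - T)"
      unfolding A(2) sum_5 by (simp add: cl_def S_def)
    \<comment> \<open>The equal \<open>kappa\<close> entries of \<open>iota w\<close> at positions 1
      and 5 combine to a multiple of \<open>r'\<close>, which cancels the corrections in
      \<open>F1\<close>, \<open>F2\<close>, \<open>F3\<close>.\<close>
    also have "\<dots> = w$1 *s J f + w$2 *s J g + w$3 *s J h"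
      unfolding F1 F2 F3 by (simp add: vec_eq_iff algebra_simps)
    finally show ?thesis by (simp add: herm_lin herm_J_l)
  qed
  thus ?thesis using that A(1) by blast
qed

end

text \<open>A vector orthogonal to \<open>W\<close> lies in the plane, and its \<open>v2\<close>
  coefficient is nonzero because \<open>v1\<close> is null; the sign of the norm places the quotient
  of the coefficients in the upper half-plane.\<close>

lemma perp_iota_j0:
  assumes "Re (herm x x) < 0" "\<And>w. herm (iota w) x = 0"
  obtains \<tau> where "Im \<tau> > 0" "vec.span {x} = j0 \<tau>"
proof -
  have "hdot (proj x) w = 0" for w using assms(2)[of w] herm_eq_0_sym herm_iota by metis
  hence "proj x = 0" using hdot_self_eq_0 by blast
  then obtain a b where ab: "x = a *s v1 + b *s v2" using proj_0_decomp by blast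
  have b: "b \<noteq> 0" using assms(1) unfolding ab by (auto simp: herm_lin)
  define \<tau> where "\<tau> = a / b"
  have x: "x = b *s (\<tau> *s v1 + v2)" using b by (simp add: ab \<tau>_def)
  have "herm x x = of_real ((cmod b)\<^sup>2) * herm (\<tau> *s v1 + v2) (\<tau> *s v1 + v2)"
    unfolding x by (simp only: herm_scale_left herm_scale_right complex_norm_square mult_ac)
  hence "Re (herm x x) = (cmod b)\<^sup>2 * (- 2 * sqrt 3 * Im \<tau>)"
    by (simp del: of_real_power add: herm_j0)
  hence "Im \<tau> > 0" using assms(1) b by (simp add: mult_less_0_iff zero_less_mult_iff)
  moreover have "vec.span {x} = j0 \<tau>" unfolding j0_def x by (rule span_unit[OF b])
  ultimately show ?thesis using that by blast
qed

lemma ch4'_G_equiv_j0: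
  assumes "L \<in> ch4'_G"
  shows "\<exists>A \<tau>. A \<in> Lattice_mats \<and> Im \<tau> > 0 \<and> (*v) A ` L = j0 \<tau>"
proof -
  have L4: "L \<in> ch4'" and iso: "PGamma_stab L \<cong> G333" using assms by (auto simp: ch4'_G_def)
  hence c4: "L \<in> ch4" by (simp add: ch4'_def)
  then obtain l where l: "L = vec.span {l}" "Re (herm l l) < 0" using ch4_iff by blast
  obtain h where h: "h \<in> iso (PGamma_stab L) G333" using iso by (auto simp: is_iso_def)
  have closed: "x \<otimes>\<^bsub>PGamma_stab L\<^esub> y \<in> carrier (PGamma_stab L)"
    if xy: "x \<in> carrier (PGamma_stab L)" "y \<in> carrier (PGamma_stab L)" for x y
  proof -
    obtain A B where AB: "x = lat_coset A" "A \<in> Lattice_mats" "(*v) A ` L = L" "y = lat_coset B" "B \<in> Lattice_mats" "(*v) B ` L = L"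
      using xy unfolding carrier_stab[OF c4] by blast
    have "(*v) (A ** B) ` L = (*v) A ` ((*v) B ` L)" by (simp add: image_image matrix_vector_mul_assoc)
    hence "(*v) (A ** B) ` L = L" using AB by simp
    thus ?thesis unfolding carrier_stab[OF c4] mult_PGamma_stab AB(1,4) mult_PGamma[OF AB(2,5)]
      using mats_mult[OF AB(2,5)] by blast
  qed
  obtain k where k: "k \<in> iso G333 (PGamma_stab L)" by (rule iso_inverse[OF h], erule (1) closed, rule that)
  interpret stab_point L l k by unfold_locales (use l k in auto)
  have no1: "herm v l \<noteq> 0" if "v \<in> Lattice" "herm v v = 1" for v
  proof
    assume "herm v l = 0"
    hence "herm l v = 0" using herm_eq_0_sym by blast
    hence "\<forall>x\<in>L. herm x v = 0" unfolding l(1) span_singleton by (auto simp: herm_lin)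
    thus False using L4 that unfolding ch4'_def by blast
  qed
  obtain w1 w2 w3 B y where w: "w1 \<in> Lattice" "w2 \<in> Lattice" "w3 \<in> Lattice"
    "herm w1 w1 = 3" "herm w2 w2 = 3" "herm w3 w3 = 3" "herm w1 w2 = 0" "herm w1 w3 = 0" "herm w2 w3 = 0"
    "herm w1 l = 0" "herm w2 l = 0" "herm w3 l = 0"
    "B \<in> Lattice_mats" "B *v w1 = w2" "B *v w2 = w3" "B *v w3 = w1" "y \<in> Lattice" "herm y w1 = 1"
    "\<forall>x\<in>Lattice. (herm x w1 / theta) *s w1 + (herm x w2 / theta) *s w2 + (herm x w3 / theta) *s w3 \<in> Lattice"
    by (rule Heisenberg_frame[OF no1])
  interpret Heisenberg_frame l w1 w2 w3 B y by unfold_locales (fact l(2) no1 w(1-18) w(19)[rule_format])+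
  obtain r y0 where r: "r \<in> Lattice" "y0 \<in> Lattice" "herm y0 r = 1" "herm r r = 0"
    "herm r w1 = 0" "herm r w2 = 0" "herm r w3 = 0" by (rule Lattice_null_vector)
  interpret null_frame l w1 w2 w3 B y r y0 by unfold_locales (fact r)+
  obtain A where A: "A \<in> Lattice_mats" "\<And>w. herm (A *v iota w) l = 0" by (rule standard_position) blast
  \<comment> \<open>\<open>A\<close> carries \<open>W\<close> into the complement of
    \<open>l\<close>, so its inverse carries \<open>l\<close> into the complement of
    \<open>W\<close>.\<close>
  obtain C where C: "C \<in> Lattice_mats" "A ** C = mat 1" "C ** A = mat 1" using mats_inv[OF A(1)] .
  have AC: "A *v (C *v u) = u" for u by (simp add: matrix_vector_mul_assoc C)
  have perp: "herm (iota w) (C *v l) = 0" for w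
    using A(2)[of w] mats_herm[OF A(1), of "iota w" "C *v l"] by (simp add: AC)
  have "Re (herm (C *v l) (C *v l)) < 0" using l(2) by (simp add: mats_herm[OF C(1)])
  then obtain \<tau> where \<tau>: "Im \<tau> > 0" "vec.span {C *v l} = j0 \<tau>" using perp_iota_j0 perp by metis
  have "(*v) C ` L = j0 \<tau>" unfolding l(1) image_span \<tau>(2) ..
  thus ?thesis using C(1) \<tau>(1) by blast
qed

theorem theorem1:
  shows "j0 ` upper_half_plane' \<subseteq> ch4'_G \<and>
    (\<forall>X \<in> orbits PSL2Z upper_half_plane' PSL2Z_act.
       \<forall>\<tau> \<in> X. j0_bar X = orbit PGamma PGamma_act (j0 \<tau>)) \<and>
    bij_betw j0_bar
      (orbits PSL2Z upper_half_plane' PSL2Z_act)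
      (orbits PGamma ch4'_G PGamma_act)"
  by (rule j0_bar_bijection[OF ch4'_G_equiv_j0])

end
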